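(* Let $(p,q,r)\in\{(3,3,6),(3,4,4),(4,3,6),(5,3,6)\}$, and let $P_{pqr}\subset\mathbb{H}^3$ be a cell of the corresponding fully asymptotic Coxeter tiling. Then every admissible horoball arrangement $\mathcal{B}_{pqr}$ in $P_{pqr}$ (with horoballs of possibly different types at the different vertices) satisfies $$\delta(\mathcal{B}_{pqr})\le s_0,\qquad s_0=\Bigl(1+\tfrac{1}{2^2}-\tfrac{1}{4^2}-\tfrac{1}{5^2}+\tfrac{1}{7^2}+\tfrac{1}{8^2}-\tfrac1{10^2}-\tfrac1{11^2}+\cdots\Bigr)^{-1}\approx 0.85327609,$$ where in the series $1/n^2$ has sign $+$ for $n\equiv 1,2 \pmod 6$, sign $-$ for $n\equiv 4,5\pmod 6$, and coefficient $0$ for $n\equiv 0,3 \pmod 6$. That is, the Böröczky--Florian upper bound $s_0$ for packings by congruent horoballs remains valid.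
   Context: $\mathbb{H}^3$ is hyperbolic 3-space of curvature $-1$. The tiling with Schläfli symbol $(p,q,r)$ is the regular face-to-face tiling of $\mathbb{H}^3$ by congruent regular polyhedra $P_{pqr}$ with Schläfli symbol $(p,q)$ and dihedral angle $2\pi/r$. For the symbols $(3,3,6),(3,4,4),(4,3,6),(5,3,6)$ the cell $P_{pqr}$ is a regular ideal tetrahedron, octahedron, cube, dodecahedron respectively, i.e. all its $N_{pqr}=4,6,8,20$ vertices lie on $\partial\mathbb{H}^3$ (fully asymptotic tilings). An admissible horoball arrangement $\mathcal{B}_{pqr}$ in $P_{pqr}$ consists of one horoball $B_i$ centered at each vertex $E_i$ of $P_{pqr}$ such that (i) the horoballs have pairwise disjoint interiors (tangency is allowed), and (ii) the interior of $B_i$ does not meet any face of $P_{pqr}$ not incident with $E_i$. Horoballs at different vertices need not be equivalent under symmetries of the cell (they may be of different types). The density is $$\delta(\mathcal{B}_{pqr})=\frac{\sum_i \mathrm{Vol}(B_i\cap P_{pqr})}{\mathrm{Vol}(P_{pqr})},$$ the sum being over all vertices of $P_{pqr}$. *)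

theory Defs
  imports "HOL-Analysis.Analysis"
begin

text \<open>
  Hyperbolic 3-space of curvature -1 in the projective (Cayley--Klein) model: its points form the
  open unit ball, the boundary at infinity is the unit sphere, and hyperbolic planes and lines are
  the Euclidean ones cut down to the ball. In particular a hyperbolic polyhedron of finite volume,
  together with its ideal points, is a Euclidean polytope in the closed unit ball. A point
  \<open>x\<close> stands for the unit timelike vector \<open>(x, 1) / sqrt (1 - x \<bullet> x)\<close> of Minkowski space with
  the form \<open>\<langle>(x, t), (y, s)\<rangle> = x \<bullet> y - t * s\<close>.
\<close>

type_synonym point = "real^3"

abbreviation hyp_space :: "point set" where
  "hyp_space \<equiv> ball 0 1"

text \<open>\<open>cosh d = - \<langle>X, Y\<rangle>\<close> for the unit timelike representatives \<open>X\<close>, \<open>Y\<close>.\<close>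

definition hyp_dist :: "point \<Rightarrow> point \<Rightarrow> real" where
  "hyp_dist x y = arcosh ((1 - x \<bullet> y) / sqrt ((1 - x \<bullet> x) * (1 - y \<bullet> y)))"

text \<open>
  Isometries are taken together with their (unique) continuous extension to the boundary at
  infinity, so that they act on ideal vertices; values outside the closed ball are irrelevant.
\<close>

definition hyp_isometry :: "(point \<Rightarrow> point) \<Rightarrow> bool" where
  "hyp_isometry f \<longleftrightarrow>
     continuous_on (cball 0 1) f \<and> f ` hyp_space = hyp_space \<and>
     (\<forall>x\<in>hyp_space. \<forall>y\<in>hyp_space. hyp_dist (f x) (f y) = hyp_dist x y)"

definition hyp_congruent :: "point set \<Rightarrow> point set \<Rightarrow> bool" where
  "hyp_congruent P Q \<longleftrightarrow> (\<exists>f. hyp_isometry f \<and> f ` P = Q)"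

text \<open>
  The Riemannian volume element of the metric
  \<open>|dx|\<^sup>2 / (1 - |x|\<^sup>2) + (x \<bullet> dx)\<^sup>2 / (1 - |x|\<^sup>2)\<^sup>2\<close> is \<open>dx / (1 - |x|\<^sup>2)\<^sup>2\<close>.
\<close>

definition hyp_measure :: "point measure" where
  "hyp_measure =
     density lborel (\<lambda>x. ennreal (indicator hyp_space x / (1 - x \<bullet> x)\<^sup>2))"

abbreviation hyp_vol :: "point set \<Rightarrow> real" where
  "hyp_vol \<equiv> measure hyp_measure"

definition hyp_polyhedron :: "point set \<Rightarrow> bool" where
  "hyp_polyhedron P \<longleftrightarrow> polytope P \<and> interior P \<noteq> {} \<and> P \<subseteq> cball 0 1"

definition vertices :: "point set \<Rightarrow> point set" where
  "vertices P = {v. v extreme_point_of P}"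

definition is_flag :: "point set \<Rightarrow> point \<Rightarrow> point set \<Rightarrow> point set \<Rightarrow> bool" where
  "is_flag P v e F \<longleftrightarrow>
     v \<in> vertices P \<and> e edge_of P \<and> F facet_of P \<and> v \<in> e \<and> e \<subseteq> F"

definition hyp_regular :: "point set \<Rightarrow> bool" where
  "hyp_regular P \<longleftrightarrow>
     (\<forall>v e F v' e' F'. is_flag P v e F \<longrightarrow> is_flag P v' e' F' \<longrightarrow>
        (\<exists>f. hyp_isometry f \<and> f ` P = P \<and> f v = v' \<and> f ` e = e' \<and> f ` F = F'))"

definition schlaefli :: "nat \<Rightarrow> nat \<Rightarrow> point set \<Rightarrow> bool" where
  "schlaefli p q P \<longleftrightarrow>
     (\<forall>F. F facet_of P \<longrightarrow> card (vertices F) = p) \<and>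
     (\<forall>v\<in>vertices P. card {F. F facet_of P \<and> v \<in> F} = q)"

text \<open>
  Hyperbolic angle of the wedge \<open>{x. a \<bullet> x \<le> b} \<inter> {x. c \<bullet> x \<le> d}\<close>: the Minkowski vectors
  \<open>(a, b)\<close> and \<open>(c, d)\<close> are its outward (spacelike) normals, hence the minus sign.
\<close>

definition hyp_wedge_angle :: "point \<Rightarrow> real \<Rightarrow> point \<Rightarrow> real \<Rightarrow> real" where
  "hyp_wedge_angle a b c d =
     arccos (- (a \<bullet> c - b * d) / (sqrt (a \<bullet> a - b\<^sup>2) * sqrt (c \<bullet> c - d\<^sup>2)))"

definition all_dihedral_angles :: "point set \<Rightarrow> real \<Rightarrow> bool" where
  "all_dihedral_angles P \<theta> \<longleftrightarrow>
     (\<forall>F G a b c d. F facet_of P \<longrightarrow> G facet_of P \<longrightarrow> (F \<inter> G) edge_of P \<longrightarrow>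
        P \<subseteq> {x. a \<bullet> x \<le> b} \<longrightarrow> F = P \<inter> {x. a \<bullet> x = b} \<longrightarrow>
        P \<subseteq> {x. c \<bullet> x \<le> d} \<longrightarrow> G = P \<inter> {x. c \<bullet> x = d} \<longrightarrow>
        hyp_wedge_angle a b c d = \<theta>)"

definition regular_cell :: "nat \<Rightarrow> nat \<Rightarrow> nat \<Rightarrow> point set \<Rightarrow> bool" where
  "regular_cell p q r P \<longleftrightarrow>
     hyp_polyhedron P \<and> hyp_regular P \<and> schlaefli p q P \<and>
     all_dihedral_angles P (2 * pi / real r)"

text \<open>Face-to-face, locally finite tilings of hyperbolic space by congruent regular cells.\<close>

definition regular_tiling :: "nat \<Rightarrow> nat \<Rightarrow> nat \<Rightarrow> point set set \<Rightarrow> bool" where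
  "regular_tiling p q r T \<longleftrightarrow>
     (\<forall>P\<in>T. regular_cell p q r P) \<and>
     (\<forall>P\<in>T. \<forall>Q\<in>T. hyp_congruent P Q) \<and>
     hyp_space \<subseteq> \<Union>T \<and>
     pairwise (\<lambda>P Q. interior P \<inter> interior Q = {}) T \<and>
     (\<forall>P\<in>T. \<forall>Q\<in>T. (P \<inter> Q) face_of P \<and> (P \<inter> Q) face_of Q) \<and>
     (\<forall>K. compact K \<and> K \<subseteq> hyp_space \<longrightarrow> finite {P\<in>T. P \<inter> K \<noteq> {}})"

definition fully_asymptotic_tiling :: "nat \<Rightarrow> nat \<Rightarrow> nat \<Rightarrow> point set set \<Rightarrow> bool" where
  "fully_asymptotic_tiling p q r T \<longleftrightarrow>
     regular_tiling p q r T \<and> (\<forall>P\<in>T. vertices P \<subseteq> sphere 0 1)"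

text \<open>
  The closed horoball \<open>{X. - \<langle>X, (u, 1)\<rangle> \<le> s}\<close> centered at the ideal point \<open>u\<close>. Equivalently, it
  is the sublevel set at level \<open>ln s\<close> of the Busemann function
  \<open>ln ((1 - x \<bullet> u) / sqrt (1 - x \<bullet> x))\<close> of \<open>u\<close> normalised at the origin.
\<close>

definition horoball :: "point \<Rightarrow> real \<Rightarrow> point set" where
  "horoball u s = {x \<in> hyp_space. (1 - x \<bullet> u) / sqrt (1 - x \<bullet> x) \<le> s}"

definition is_horoball_at :: "point \<Rightarrow> point set \<Rightarrow> bool" where
  "is_horoball_at u B \<longleftrightarrow> norm u = 1 \<and> (\<exists>s>0. B = horoball u s)"

text \<open>An arrangement assigns a horoball to each vertex; its values elsewhere are irrelevant.\<close>

definition admissible_arrangement :: "point set \<Rightarrow> (point \<Rightarrow> point set) \<Rightarrow> bool" where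
  "admissible_arrangement P B \<longleftrightarrow>
     (\<forall>v\<in>vertices P. is_horoball_at v (B v)) \<and>
     pairwise (\<lambda>v w. interior (B v) \<inter> interior (B w) = {}) (vertices P) \<and>
     (\<forall>v\<in>vertices P. \<forall>F. F facet_of P \<and> v \<notin> F \<longrightarrow> interior (B v) \<inter> F = {})"

definition packing_density :: "point set \<Rightarrow> (point \<Rightarrow> point set) \<Rightarrow> real" where
  "packing_density P B = (\<Sum>v\<in>vertices P. hyp_vol (B v \<inter> P)) / hyp_vol P"

definition s0_coeff :: "nat \<Rightarrow> real" where
  "s0_coeff n =
     (if n mod 6 = 1 \<or> n mod 6 = 2 then 1
      else if n mod 6 = 4 \<or> n mod 6 = 5 then - 1
      else 0)"

definition s0 :: real where
  "s0 = inverse (\<Sum>n. s0_coeff n / (real n)\<^sup>2)"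

end

theory Submission
  imports Defs "HOL-Real_Asymp.Real_Asymp"
begin

text \<open>
  All dihedral angles of the cell are \<open>\<pi> / 2\<close> or \<open>\<pi> / 3\<close>, and this is the only property of the cell
  that matters. It makes any two facet planes behave like mirrors: the foot of the perpendicular from a point of
  the cell to a facet lies in that facet, so that by admissibility the mirror images of a horoball in
  the facets do not overlap it.

  Divide the cell into the Voronoi regions of its horoballs. Seen from its ideal vertex \<open>v\<close> at infinity of the upper
  half-space, with the horosphere at height 1, the region of \<open>v\<close> is the part of a prism over a polygon
  \<open>Q\<close> above hemispheres with centres \<open>c i\<close> in \<open>Q\<close> and squared radii \<open>e i \<le> 1\<close>, one for each other vertex
  and for each facet not through \<open>v\<close>, and disjointness becomes \<open>|c i - c j|\<^sup>2 \<ge> e i * e j\<close>.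
  The volumes of the horoball and of the region are half the integrals over \<open>Q\<close> of \<open>1\<close> and of
  \<open>1 / max\<^sub>i (e i - |y - c i|\<^sup>2)\<close>, so it suffices that the mean of the latter is at least \<open>1 / s0\<close>.
  On the power cell of a centre this follows from two facts: the squared height is at most \<open>3 / 4\<close> where two
  centres compete and at most \<open>2 / 3\<close> where three do. Hence near the centre
  the cell consists of circular sectors and right triangles, on each of which the mean is at least that on the
  triangles occurring for the regular tetrahedron, namely \<open>1 / s0\<close>.
\<close>

section \<open>The series as an integral\<close>

text \<open>The numbers \<open>3 / 4\<close> and \<open>2 / 3\<close> are those of the regular ideal
  tetrahedron with four touching horoballs: seen from one vertex, the other three give unit
  hemispheres centred at the corners of an equilateral triangle of side 1. Two of them meet at
  squared height at most \<open>1 - 1 / 4\<close>, all three at \<open>1 - 1 / 3\<close>. The right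
  triangle from a corner over the midpoint of a side to the centroid is the extremal piece; its
  integral is evaluated exactly, and this is how the series enters. A bound for the mean is
  unavoidable, since over the centre of a unit hemisphere the integrand is only 1, below
  \<open>1 / s0\<close>. As the horoballs may differ in size, no symmetry of the cell can be used;
  the comparison is made for one hemisphere at a time, of any squared radius up to 1. Smaller radii
  only help. Away from the triangles there is slack, so that rational bounds such as
  \<open>6 / 5\<close> or \<open>117 / 98\<close> suffice.\<close>

definition s0_series :: real where
  "s0_series = (\<Sum>n. s0_coeff n / (real n)\<^sup>2)"

lemma s0_series_sums: "(\<lambda>n. s0_coeff n / (real n)\<^sup>2) sums s0_series"
proof -
  have "summable (\<lambda>n. inverse (real n ^ 2))"
    by (intro inverse_power_summable) auto
  hence "summable (\<lambda>n. s0_coeff n / (real n)\<^sup>2)"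
    by (rule summable_comparison_test[rotated])
       (auto simp: s0_coeff_def field_simps intro!: exI[of _ 0])
  thus ?thesis unfolding s0_series_def by (rule summable_sums)
qed

lemma s0_series_sums_6:
  "(\<lambda>m. 1 / (6 * real m + 1)\<^sup>2 + 1 / (6 * real m + 2)\<^sup>2
      - 1 / (6 * real m + 4)\<^sup>2 - 1 / (6 * real m + 5)\<^sup>2) sums s0_series"
proof -
  have "(\<lambda>m. sum (\<lambda>n. s0_coeff n / (real n)\<^sup>2) {m * 6..<m * 6 + 6}) sums s0_series"
    by (intro sums_group s0_series_sums) auto
  moreover have "sum (\<lambda>n. s0_coeff n / (real n)\<^sup>2) {m * 6..<m * 6 + 6} =
      1 / (6 * real m + 1)\<^sup>2 + 1 / (6 * real m + 2)\<^sup>2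
      - 1 / (6 * real m + 4)\<^sup>2 - 1 / (6 * real m + 5)\<^sup>2" for m
  proof -
    have "{m * 6..<m * 6 + 6} = {6*m, 6*m+1, 6*m+2, 6*m+3, 6*m+4, 6*m+5}" by auto
    moreover have "(6*m) mod 6 = 0" "(6*m+1) mod 6 = 1" "(6*m+2) mod 6 = 2"
      "(6*m+3) mod 6 = 3" "(6*m+4) mod 6 = 4" "(6*m+5) mod 6 = 5" by presburger+
    ultimately show ?thesis
      by (simp add: s0_coeff_def del: mod_mult_self1 mod_mult_self2 mod_mult_self3 mod_mult_self4
          mod_mult_self1_is_0 mod_mult_self2_is_0 add: add_ac)
  qed
  ultimately show ?thesis by simp
qed

text \<open>The value is about 1.172. The bound \<open>117 / 98\<close> is the mean that
  \<open>heavy_sector\<close> secures in its worst case.\<close>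

lemma s0_series_bounds: "s0_series \<le> 117 / 98" "0 < s0_series"
proof -
  let ?w = "\<lambda>m. 1 / (6 * real m + 1)\<^sup>2 + 1 / (6 * real m + 2)\<^sup>2
      - 1 / (6 * real m + 4)\<^sup>2 - 1 / (6 * real m + 5)\<^sup>2"
  have pos: "?w m > 0" for m
  proof -
    have "1 / (6 * real m + 4)\<^sup>2 < 1 / (6 * real m + 1)\<^sup>2"
      "1 / (6 * real m + 5)\<^sup>2 < 1 / (6 * real m + 2)\<^sup>2"
      by (intro divide_strict_left_mono power_strict_mono mult_pos_pos zero_less_power; simp)+
    thus ?thesis by linarith
  qed
  show "0 < s0_series"
    using suminf_pos[OF sums_summable[OF s0_series_sums_6] pos] sums_unique[OF s0_series_sums_6]
    by simp
  \<comment> \<open>Shifted blocks: after \<open>1 + 1 / 4\<close> the terms are grouped with signs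
    -, -, +, +, so that every block lowers the sum, and the first block alone brings it below
    \<open>117 / 98\<close>. \<open>a n\<close> takes back the positive pair that the last block
    borrows from the next period.\<close>
  let ?u = "\<lambda>m. 1 / (6 * real m + 4)\<^sup>2 + 1 / (6 * real m + 5)\<^sup>2
      - 1 / (6 * real m + 7)\<^sup>2 - 1 / (6 * real m + 8)\<^sup>2"
  define a where "a = (\<lambda>m. 1 / (6 * real m + 1)\<^sup>2 + 1 / (6 * real m + 2)\<^sup>2)"
  have a0: "a \<longlonglongrightarrow> 0"
    unfolding a_def by real_asymp
  have part: "sum ?w {..<n} = 5 / 4 - a n - sum ?u {..<n}" for n
    by (induction n) (auto simp: a_def algebra_simps power2_eq_square)
  have upos: "0 \<le> ?u m" for m
  proof -
    have "1 / (6 * real m + 7)\<^sup>2 \<le> 1 / (6 * real m + 4)\<^sup>2"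
      "1 / (6 * real m + 8)\<^sup>2 \<le> 1 / (6 * real m + 5)\<^sup>2"
      by (intro divide_left_mono power_mono mult_pos_pos zero_less_power; simp)+
    thus ?thesis by linarith
  qed
  have "sum ?w {..<n} \<le> 117 / 98" if "n \<ge> 1" for n
  proof -
    have "sum ?u {..<1} \<le> sum ?u {..<n}"
      using that upos by (intro sum_mono2) auto
    moreover have "0 \<le> a n" by (simp add: a_def)
    moreover have "5 / 4 - (1/16 + 1/25 - 1/49 - 1/64) \<le> (117 / 98 :: real)" by simp
    ultimately show ?thesis unfolding part by (simp add: power2_eq_square)
  qed
  moreover have "(\<lambda>n. sum ?w {..<n}) \<longlonglongrightarrow> s0_series"
    using s0_series_sums_6 by (simp add: sums_def)
  ultimately show "s0_series \<le> 117 / 98"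
    by (intro LIMSEQ_le_const2[of _ s0_series]) auto
qed

text \<open>Multiplying by \<open>2 / 3\<close> passes from the character of modulus 6 to the one of modulus 3.\<close>

lemma s0_series_sums_3:
  "(\<lambda>m. 1 / (3 * real m + 1)\<^sup>2 - 1 / (3 * real m + 2)\<^sup>2) sums (2 / 3 * s0_series)"
proof -
  let ?h = "\<lambda>m. 1 / (3 * real m + 1)\<^sup>2 - 1 / (3 * real m + 2)\<^sup>2"
  have bnd: "\<bar>?h m\<bar> \<le> inverse (real (Suc m) ^ 2)" for m
  proof -
    have "1 / (3 * real m + 2)\<^sup>2 \<le> 1 / (3 * real m + 1)\<^sup>2"
      "1 / (3 * real m + 1)\<^sup>2 \<le> 1 / (real (Suc m))\<^sup>2"
      by (intro divide_left_mono power_mono mult_pos_pos zero_less_power; simp)+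
    moreover have "0 \<le> 1 / (3 * real m + 2)\<^sup>2" by simp
    ultimately show ?thesis unfolding inverse_eq_divide abs_le_iff by linarith
  qed
  have "summable (\<lambda>n. inverse (real n ^ 2))"
    by (intro inverse_power_summable) auto
  hence "summable (\<lambda>n. inverse (real (Suc n) ^ 2))" by (subst summable_Suc_iff)
  hence "summable ?h"
    by (rule summable_comparison_test[rotated]) (use bnd in auto)
  then obtain H where H: "?h sums H" using summable_sums by blast
  have "(\<lambda>m. sum ?h {m * 2..<m * 2 + 2}) sums H"
    by (intro sums_group H) auto
  moreover have "sum ?h {m * 2..<m * 2 + 2} = ?h (2*m) + ?h (2*m+1)" for m
  proof -
    have "{m * 2..<m * 2 + 2} = {2*m, 2*m+1}" by auto
    thus ?thesis by simp
  qed
  ultimately have "(\<lambda>m. ?h (2*m) + ?h (2*m+1)) sums H" by simp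
  \<comment> \<open>The two series differ only in the signs at even denominators, and twice these
    terms make half the modulus 3 series again. This is an equation for its sum
    \<open>H\<close>.\<close>
  from sums_diff[OF s0_series_sums_6 this]
  have "(\<lambda>m. 1 / 2 * ?h m) sums (s0_series - H)"
  proof (rule sums_cong[THEN iffD1, rotated])
    fix m
    have e: "(6 * real m + 2)\<^sup>2 = 4 * (3 * real m + 1)\<^sup>2" "(6 * real m + 4)\<^sup>2 = 4 * (3 * real m + 2)\<^sup>2"
      by (simp_all add: power2_eq_square algebra_simps)
    show "1 / (6 * real m + 1)\<^sup>2 + 1 / (6 * real m + 2)\<^sup>2 - 1 / (6 * real m + 4)\<^sup>2 -
         1 / (6 * real m + 5)\<^sup>2 -
         (1 / (3 * real (2 * m) + 1)\<^sup>2 - 1 / (3 * real (2 * m) + 2)\<^sup>2 +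
          (1 / (3 * real (2 * m + 1) + 1)\<^sup>2 - 1 / (3 * real (2 * m + 1) + 2)\<^sup>2)) =
         1 / 2 * (1 / (3 * real m + 1)\<^sup>2 - 1 / (3 * real m + 2)\<^sup>2)"
      using e by (simp add: add_ac)
  qed
  moreover have "(\<lambda>m. 1 / 2 * ?h m) sums (1 / 2 * H)" by (intro sums_mult H)
  ultimately have "s0_series - H = 1 / 2 * H" by (rule sums_unique2)
  with H show ?thesis by (simp add: field_simps)
qed

section \<open>Logarithmic integrals for the series\<close>

lemma has_integral_neg_ln_power:
  "((\<lambda>t. - ln t * t ^ k) has_integral 1 / (real k + 1)\<^sup>2) {0..1::real}"
proof -
  let ?F = "\<lambda>t::real. t ^ Suc k / (real k + 1)\<^sup>2 - t ^ Suc k * ln t / (real k + 1)"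
  have "((\<lambda>t. - ln t * t ^ k) has_integral (?F 1 - ?F 0)) {0..1::real}"
  proof (rule fundamental_theorem_of_calculus_interior)
    \<comment> \<open>Only the end point 0 is delicate; there the antiderivative is continuous
      because \<open>t * ln t\<close> tends to 0.\<close>
    have "continuous (at t within {0..1}) ?F" if "t \<in> {0..1}" for t
    proof (cases "t = 0")
      case False
      with that show ?thesis by (auto intro!: continuous_intros)
    next
      case True
      have "((\<lambda>t. t * ln t) \<longlongrightarrow> 0) (at_right (0::real))" by real_asymp
      hence "((\<lambda>t. t ^ Suc k / (real k + 1)\<^sup>2 - t ^ k * (t * ln t) / (real k + 1)) \<longlongrightarrow>
          0 ^ Suc k / (real k + 1)\<^sup>2 - 0 ^ k * 0 / (real k + 1)) (at_right (0::real))"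
        by (intro tendsto_intros) auto
      hence "(?F \<longlongrightarrow> 0) (at_right 0)" by (simp add: mult_ac)
      hence "(?F \<longlongrightarrow> 0) (at 0 within {0..1})"
        by (rule tendsto_mono[rotated])
           (simp add: at_within_Icc_at_right)
      thus ?thesis using True by (simp add: continuous_within)
    qed
    thus "continuous_on {0..1} ?F" by (simp add: continuous_on_eq_continuous_within)
    fix t :: real assume t: "t \<in> {0<..<1}"
    have d1: "((\<lambda>t. t ^ Suc k) has_field_derivative real (Suc k) * t ^ k) (at t)"
      using DERIV_pow[of "Suc k" t] by simp
    have d2: "(ln has_field_derivative 1 / t) (at t)" using t by (intro DERIV_ln_divide) auto
    have "(?F has_field_derivative (real (Suc k) * t ^ k / (real k + 1)\<^sup>2
        - (real (Suc k) * t ^ k * ln t + t ^ Suc k * (1 / t)) / (real k + 1))) (at t)"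
      using DERIV_diff[OF DERIV_cdivide[OF d1] DERIV_cdivide[OF DERIV_mult[OF d1 d2]]]
      by (simp only: mult.commute[of "1 / t"])
    moreover have "real (Suc k) * t ^ k / (real k + 1)\<^sup>2
        - (real (Suc k) * t ^ k * ln t + t ^ Suc k * (1 / t)) / (real k + 1) = - ln t * t ^ k"
    proof -
      have e: "real (Suc k) = real k + 1" "real k + 1 \<noteq> 0" "t ^ Suc k * (1 / t) = t ^ k" using t by auto
      have "n * t ^ k / n\<^sup>2 - (n * t ^ k * ln t + t ^ k) / n = - ln t * t ^ k" if "n \<noteq> 0" for n :: real
        using that by (simp add: field_simps power2_eq_square)
      from this[OF e(2)] show ?thesis unfolding e(1) e(3) .
    qed
    ultimately have "(?F has_field_derivative (- ln t * t ^ k)) (at t)" by simp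
    thus "(?F has_vector_derivative (- ln t * t ^ k)) (at t)"
      by (simp add: has_real_derivative_iff_has_vector_derivative)
  qed simp
  thus ?thesis by simp
qed


text \<open>Expand \<open>1 / (1 - t ^ q)\<close> into a geometric series; all terms are nonnegative
  on the unit interval, so monotone convergence permits termwise integration. With a polynomial
  \<open>p\<close> carrying the signs of one period, a periodic series over inverse squares becomes
  an integral.\<close>

lemma has_integral_neg_ln_div:
  fixes p :: "real \<Rightarrow> real" and w :: "nat \<Rightarrow> real"
  assumes q: "q > 0" and p: "\<And>t. t \<in> {0..1} \<Longrightarrow> p t \<ge> 0"
    and int: "\<And>m. ((\<lambda>t. - ln t * p t * t ^ (q * m)) has_integral w m) {0..1}"
    and w: "w sums s"
  shows "((\<lambda>t. - ln t * p t / (1 - t ^ q)) has_integral s) {0..1}"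
proof (rule has_integral_monotone_convergence_increasing)
  fix k :: nat
  show "((\<lambda>t. \<Sum>m<k. - ln t * p t * t ^ (q * m)) has_integral (\<Sum>m<k. w m)) {0..1}"
    by (intro has_integral_sum int) auto
next
  fix k :: nat and t :: real assume t: "t \<in> {0..1}"
  have "0 \<le> (- ln t) * p t * t ^ (q * k)"
  proof -
    have "0 \<le> - ln t" using t by (cases "t = 0") auto
    thus ?thesis using t p[OF t] by (intro mult_nonneg_nonneg) auto
  qed
  thus "(\<Sum>m<k. - ln t * p t * t ^ (q * m)) \<le> (\<Sum>m<Suc k. - ln t * p t * t ^ (q * m))" by simp
next
  fix t :: real assume t: "t \<in> {0..1}"
  show "(\<lambda>k. \<Sum>m<k. - ln t * p t * t ^ (q * m)) \<longlonglongrightarrow> - ln t * p t / (1 - t ^ q)"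
  \<comment> \<open>At \<open>t = 1\<close> everything vanishes, because \<open>ln 1 = 0\<close> and
    division by zero gives 0.\<close>
  proof (cases "t = 1")
    case False
    with t q have "norm (t ^ q) < 1" by (simp add: power_less_one_iff abs_if)
    from sums_mult[OF geometric_sums[OF this], of "- ln t * p t"] show ?thesis
      by (simp add: sums_def power_mult)
  qed simp
next
  show "(\<lambda>k. \<Sum>m<k. w m) \<longlonglongrightarrow> s" using w by (simp add: sums_def)
qed

text \<open>The signs of one period form \<open>1 + t - t ^ 3 - t ^ 4\<close>, and its quotient by
  \<open>1 - t ^ 6\<close> cancels to \<open>1 / (1 - t + t\<^sup>2)\<close>.\<close>

lemma has_integral_s0_series:
  "((\<lambda>t. - ln t / (1 - t + t\<^sup>2)) has_integral s0_series) {0..1}"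
proof -
  have "((\<lambda>t. - ln t * (1 + t - t ^ 3 - t ^ 4) / (1 - t ^ 6)) has_integral s0_series) {0..1::real}"
  proof (rule has_integral_neg_ln_div[OF _ _ _ s0_series_sums_6])
    fix t :: real assume t: "t \<in> {0..1}"
    have "1 + t - t ^ 3 - t ^ 4 = (1 + t) * (1 - t ^ 3)"
      by (simp add: algebra_simps power_numeral_reduce)
    also have "\<dots> \<ge> 0" using t by (intro mult_nonneg_nonneg) (auto simp: power_le_one)
    finally show "0 \<le> 1 + t - t ^ 3 - t ^ 4" .
  next
    fix m
    let ?I = "\<lambda>j. (\<lambda>t::real. - ln t * t ^ (6 * m + j))"
    have "((\<lambda>t. ?I 0 t + ?I 1 t - ?I 3 t - ?I 4 t) has_integral
        1 / (real (6 * m + 0) + 1)\<^sup>2 + 1 / (real (6 * m + 1) + 1)\<^sup>2 - 1 / (real (6 * m + 3) + 1)\<^sup>2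
         - 1 / (real (6 * m + 4) + 1)\<^sup>2) {0..1}"
      by (intro has_integral_diff has_integral_add has_integral_neg_ln_power)
    moreover have "?I 0 t + ?I 1 t - ?I 3 t - ?I 4 t = - ln t * (1 + t - t ^ 3 - t ^ 4) * t ^ (6 * m)" for t
      by (simp add: algebra_simps power_add)
    ultimately show "((\<lambda>t. - ln t * (1 + t - t ^ 3 - t ^ 4) * t ^ (6 * m)) has_integral
        1 / (6 * real m + 1)\<^sup>2 + 1 / (6 * real m + 2)\<^sup>2
      - 1 / (6 * real m + 4)\<^sup>2 - 1 / (6 * real m + 5)\<^sup>2) {0..1::real}"
      by (simp add: add_ac)
  qed simp
  thus ?thesis
  proof (rule has_integral_eq[rotated])
    fix t :: real assume t: "t \<in> {0..1}"
    show "- ln t * (1 + t - t ^ 3 - t ^ 4) / (1 - t ^ 6) = - ln t / (1 - t + t\<^sup>2)"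
    proof (cases "t = 1")
      case False
      have "1 - t + t\<^sup>2 > 0" using t by (smt (verit) atLeastAtMost_iff zero_le_power2 zero_less_power)
      moreover have "t ^ 6 \<noteq> 1" using False t by (metis atLeastAtMost_iff power_eq_1_iff zero_neq_numeral abs_of_nonneg real_norm_def)
      moreover have "(1 + t - t ^ 3 - t ^ 4) * (1 - t + t\<^sup>2) = 1 - t ^ 6"
        by (simp add: algebra_simps power_numeral_reduce)
      ultimately show ?thesis by (simp add: divide_simps)
    qed simp
  qed
qed

lemma has_integral_s0_series_3:
  "((\<lambda>t. - ln t / (1 + t + t\<^sup>2)) has_integral 2 / 3 * s0_series) {0..1}"
proof -
  have "((\<lambda>t. - ln t * (1 - t) / (1 - t ^ 3)) has_integral 2 / 3 * s0_series) {0..1::real}"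
  proof (rule has_integral_neg_ln_div[OF _ _ _ s0_series_sums_3])
    fix m
    let ?I = "\<lambda>j. (\<lambda>t::real. - ln t * t ^ (3 * m + j))"
    have "((\<lambda>t. ?I 0 t - ?I 1 t) has_integral
        1 / (real (3 * m + 0) + 1)\<^sup>2 - 1 / (real (3 * m + 1) + 1)\<^sup>2) {0..1}"
      by (intro has_integral_diff has_integral_add has_integral_neg_ln_power)
    moreover have "?I 0 t - ?I 1 t = - ln t * (1 - t) * t ^ (3 * m)" for t
      by (simp add: algebra_simps power_add)
    ultimately show "((\<lambda>t. - ln t * (1 - t) * t ^ (3 * m)) has_integral
        1 / (3 * real m + 1)\<^sup>2 - 1 / (3 * real m + 2)\<^sup>2) {0..1::real}"
      by (simp add: add_ac)
  qed simp_all
  thus ?thesis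
  proof (rule has_integral_eq[rotated])
    fix t :: real assume t: "t \<in> {0..1}"
    show "- ln t * (1 - t) / (1 - t ^ 3) = - ln t / (1 + t + t\<^sup>2)"
    proof (cases "t = 1")
      case False
      have "1 + t + t\<^sup>2 > 0" using t by (smt (verit) atLeastAtMost_iff zero_le_power2 zero_less_power)
      moreover have "t ^ 3 \<noteq> 1" using False t by (metis atLeastAtMost_iff power_eq_1_iff zero_neq_numeral abs_of_nonneg real_norm_def)
      moreover have "(1 - t) * (1 + t + t\<^sup>2) = 1 - t ^ 3"
        by (simp add: algebra_simps power_numeral_reduce)
      ultimately show ?thesis by (simp add: divide_simps)
    qed simp
  qed
qed


text \<open>Let X and Y be the integrals over the lower and upper half, so X + Y =
  \<open>s0_series\<close>. The denominator is symmetric about \<open>1 / 2\<close>, so X - Y is the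
  integral of \<open>ln ((1 - t) / t) / (1 - t + t\<^sup>2)\<close> over the lower half; the
  variable \<open>t / (1 - t)\<close> turns it into the modulus 3 integral, two thirds of the sum.
  Hence Y is one sixth.\<close>

lemma has_integral_s0_series_half:
  "((\<lambda>t. - ln t / (1 - t + t\<^sup>2)) has_integral s0_series / 6) {1/2..1}"
proof -
  define f where "f = (\<lambda>t::real. - ln t / (1 - t + t\<^sup>2))"
  define g where "g = (\<lambda>t::real. - ln t / (1 + t + t\<^sup>2))"
  define h where "h = (\<lambda>t::real. f t - f (1 - t))"
  have pos: "1 - t + t\<^sup>2 > 0" for t :: real
    using zero_le_power2[of "t - 1 / 2"] by (simp add: power2_eq_square field_simps)
  have f: "(f has_integral s0_series) {0..1}" and g: "(g has_integral 2 / 3 * s0_series) {0..1}"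
    unfolding f_def g_def by (rule has_integral_s0_series has_integral_s0_series_3)+
  have fi: "f integrable_on {0..1/2}" "f integrable_on {1/2..1}"
    using has_integral_integrable[OF f] by (auto intro: integrable_subinterval_real)
  define X Y where "X = integral {0..1/2} f" and "Y = integral {1/2..1} f"
  have XY: "X + Y = s0_series"
    using Henstock_Kurzweil_Integration.integral_combine[of 0 "1/2" 1 f] has_integral_integrable[OF f] integral_unique[OF f]
    by (simp add: X_def Y_def)
  have fcont: "continuous_on {1/2..1} f"
    unfolding f_def using pos by (intro continuous_intros) (auto simp: less_imp_neq[symmetric])
  have "((\<lambda>t. (-1) *\<^sub>R f (1 - t)) has_integral (integral {1 - 0..1 - 1/2} f - integral {1 - 1/2..1 - 0} f)) {0..1/2}"
    by (rule has_integral_substitution_general[of "{}" _ _ _ "1/2" 1])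
       (use fcont in \<open>auto intro!: continuous_intros derivative_eq_intros\<close>)
  hence "((\<lambda>t. f (1 - t)) has_integral Y) {0..1/2}"
    by (auto dest: has_integral_neg simp: Y_def)
  hence h: "(h has_integral (X - Y)) {0..1/2}"
    unfolding h_def X_def using fi(1) by (intro has_integral_diff) (auto simp: integrable_integral)
  have hg: "h t = 1 / (1 - t)\<^sup>2 * g (t / (1 - t))" if "0 < t" "t \<le> 1/2" for t
  proof -
    have "1 + t / (1 - t) + (t / (1 - t))\<^sup>2 = (1 - t + t\<^sup>2) / (1 - t)\<^sup>2"
      using that by (simp add: divide_simps) (simp add: power2_eq_square algebra_simps)
    moreover have "ln (t / (1 - t)) = ln t - ln (1 - t)" using that by (simp add: ln_div)
    ultimately have 1: "g (t / (1 - t)) = (ln (1 - t) - ln t) * (1 - t)\<^sup>2 / (1 - t + t\<^sup>2)"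
      by (simp add: g_def minus_divide_left minus_mult_left del: minus_divide_left[symmetric] minus_mult_left[symmetric] mult_minus_left)
    have "1 - (1 - t) + (1 - t)\<^sup>2 = 1 - t + t\<^sup>2" by (simp add: power2_eq_square algebra_simps)
    hence "h t = (ln (1 - t) - ln t) / (1 - t + t\<^sup>2)"
      by (simp add: h_def f_def diff_divide_distrib)
    thus ?thesis using that unfolding 1 by simp
  qed
  \<comment> \<open>\<open>g\<close> is unbounded at 0, so the substitution is made from
    \<open>a > 0\<close> on; both sides are continuous in \<open>a\<close> down to 0.\<close>
  define \<phi> \<psi> where "\<phi> = (\<lambda>a. integral {a..1/2} h)" and "\<psi> = (\<lambda>a. integral {a / (1 - a)..1} g)"
  have eq: "\<phi> a = \<psi> a" if a: "0 < a" "a \<le> 1/2" for a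
  proof -
    have img: "(\<lambda>t. t / (1 - t)) ` {a..1/2} \<subseteq> {a..1}"
    proof clarify
      fix t assume t: "t \<in> {a..1/2}"
      have "a * (1 - t) \<le> t * 1" using t a by (intro mult_mono) auto
      thus "t / (1 - t) \<in> {a..1}" using t a by (auto simp: field_simps)
    qed
    have nz: "1 + t + t\<^sup>2 \<noteq> 0" if "t \<ge> a" for t :: real
      using that a by (smt (verit) zero_le_power2)
    have gc: "continuous_on {a..1} g"
      unfolding g_def using a nz by (intro continuous_intros) auto
    have "((\<lambda>t. (1 / (1 - t)\<^sup>2) *\<^sub>R g (t / (1 - t))) has_integral (integral {a / (1 - a)..(1/2) / (1 - 1/2)} g)) {a..1/2}"
      using a img gc
      by (intro has_integral_substitution[of _ _ _ a 1])
         (auto intro!: derivative_eq_intros simp: field_simps power2_eq_square)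
    hence "((\<lambda>t. h t) has_integral (integral {a / (1 - a)..1} g)) {a..1/2}"
      by (rule has_integral_eq[rotated, OF has_integral_eq_rhs]) (use a hg in auto)
    thus ?thesis by (simp add: \<phi>_def \<psi>_def integral_unique)
  qed
  have c1: "continuous_on {0..1/2} \<phi>"
    unfolding \<phi>_def using has_integral_integrable[OF h] by (rule indefinite_integral_continuous_1')
  have "continuous_on {0..1} (\<lambda>x. integral {x..1} g)"
    using has_integral_integrable[OF g] by (rule indefinite_integral_continuous_1')
  hence c2: "continuous_on {0..1/2} \<psi>"
    unfolding \<psi>_def
    by (rule continuous_on_compose2) (auto intro!: continuous_intros simp: field_simps)
  have "(\<phi> \<longlongrightarrow> \<phi> 0) (at_right 0)" "(\<psi> \<longlongrightarrow> \<psi> 0) (at_right 0)"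
    using c1 c2 by (auto simp: continuous_on_Icc_at_rightD)
  moreover have "eventually (\<lambda>a. \<phi> a = \<psi> a) (at_right 0)"
    using eq by (auto simp: eventually_at_right_field intro!: exI[of _ "1/2"])
  ultimately have "\<phi> 0 = \<psi> 0"
    using tendsto_unique[of "at_right (0::real)"] by (metis tendsto_cong trivial_limit_at_right_real)
  hence "X - Y = 2 / 3 * s0_series"
    using integral_unique[OF h] integral_unique[OF g] by (simp add: \<phi>_def \<psi>_def)
  with XY have Y: "Y = s0_series / 6" by simp
  have "(f has_integral s0_series / 6) {1/2..1}"
    using integrable_integral[OF fi(2)] unfolding Y_def[symmetric] Y .
  thus ?thesis by (simp only: f_def)
qed

text \<open>The logarithm splits into \<open>ln ((3 - x) / (3 + x))\<close>, which
  \<open>t = (3 - x) / (3 + x)\<close> carries to the preceding half-interval integral, and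
  \<open>2 * ln ((3 + x) / (2 * sqrt 3))\<close>, whose integral against
  \<open>1 / (3 + x\<^sup>2)\<close> vanishes.\<close>

lemma has_integral_orthoscheme:
  "((\<lambda>x. - 6 * ln ((9 - x\<^sup>2) / 12) / (3 + x\<^sup>2)) has_integral s0_series / 2) {0..1}"
proof -
  have nz: "3 + x\<^sup>2 \<noteq> 0" for x :: real by (smt (verit) zero_le_power2)
  define u where "u = (\<lambda>x::real. ln ((3 + x) / (2 * sqrt 3)) / (3 + x\<^sup>2))"
  have uc: "continuous_on {0..1} u"
    unfolding u_def using nz by (intro continuous_intros) auto
  \<comment> \<open>The involution sending x to 3(1 - x)/(3 + x) is the reflection of a to \<pi>/6 -
    a for \<open>x = sqrt 3 * tan a\<close>. It preserves the measure dx/(3 + x^2) and changes the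
    sign of the logarithm, so the integral of \<open>u\<close> is its own negative.\<close>
  have "((\<lambda>x. (- 12 / (3 + x)\<^sup>2) *\<^sub>R u (3 * (1 - x) / (3 + x))) has_integral
      (integral {3 * (1 - 0) / (3 + 0)..3 * (1 - 1) / (3 + 1)} u
       - integral {3 * (1 - 1) / (3 + 1)..3 * (1 - 0) / (3 + 0)} u)) {0..1}"
    by (rule has_integral_substitution_general[of "{}" _ _ _ 0 1])
       (use uc in \<open>auto intro!: continuous_intros derivative_eq_intros simp: field_simps power2_eq_square\<close>)
  hence "((\<lambda>x. (- 12 / (3 + x)\<^sup>2) *\<^sub>R u (3 * (1 - x) / (3 + x))) has_integral (- integral {0..1} u)) {0..1}"
    by simp
  moreover have "(- 12 / (3 + x)\<^sup>2) *\<^sub>R u (3 * (1 - x) / (3 + x)) = u x" if "x \<in> {0..1}" for x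
  proof -
    have p: "3 + x > 0" using that by simp
    have 1: "3 + 3 * (1 - x) / (3 + x) = 12 / (3 + x)" using p by (simp add: field_simps)
    have "3 + (3 * (1 - x) / (3 + x))\<^sup>2 = 12 * (3 + x\<^sup>2) / (3 + x)\<^sup>2"
      using p by (simp add: divide_simps) (simp add: power2_eq_square algebra_simps)
    moreover have "ln (12 / (3 + x) / (2 * sqrt 3)) = - ln ((3 + x) / (2 * sqrt 3))"
    proof -
      have "12 / (3 + x) / (2 * sqrt 3) = inverse ((3 + x) / (2 * sqrt 3))"
      proof -
        have "sqrt 3 * (sqrt 3 * (3 + x)) = 3 * (3 + x)" by (simp add: mult.assoc[symmetric])
        thus ?thesis using p by (simp add: divide_simps)
      qed
      thus ?thesis using p by (simp only: ln_inverse)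
    qed
    ultimately show ?thesis unfolding u_def 1 using p nz[of x] by (simp add: field_simps)
  qed
  ultimately have "(u has_integral (- integral {0..1} u)) {0..1}"
    by (rule has_integral_eq[rotated]) auto
  moreover have "(u has_integral (integral {0..1} u)) {0..1}"
    using uc by (simp add: integrable_continuous_interval integrable_integral)
  ultimately have "- integral {0..1} u = integral {0..1} u" by (rule has_integral_unique)
  hence u: "(u has_integral 0) {0..1}" using \<open>(u has_integral (integral {0..1} u)) {0..1}\<close> by simp
  define f where "f = (\<lambda>t::real. - ln t / (1 - t + t\<^sup>2))"
  have pos: "1 - t + t\<^sup>2 > 0" for t :: real
    using zero_le_power2[of "t - 1 / 2"] by (simp add: power2_eq_square field_simps)
  have fc: "continuous_on {1/2..1} f"
    unfolding f_def using pos by (intro continuous_intros) (auto simp: less_imp_neq[symmetric])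
  have "((\<lambda>x. (- 6 / (3 + x)\<^sup>2) *\<^sub>R f ((3 - x) / (3 + x))) has_integral
      (integral {(3 - 0) / (3 + 0)..(3 - 1) / (3 + 1)} f - integral {(3 - 1) / (3 + 1)..(3 - 0) / (3 + 0)} f)) {0..1}"
    by (rule has_integral_substitution_general[of "{}" _ _ _ "1/2" 1])
       (use fc in \<open>auto intro!: continuous_intros derivative_eq_intros simp: field_simps power2_eq_square\<close>)
  hence "((\<lambda>x. (- 6 / (3 + x)\<^sup>2) *\<^sub>R f ((3 - x) / (3 + x))) has_integral - (s0_series / 6)) {0..1}"
    using integral_unique[OF has_integral_s0_series_half, folded f_def] by simp
  moreover have "(- 6 / (3 + x)\<^sup>2) *\<^sub>R f ((3 - x) / (3 + x)) = 2 * ln ((3 - x) / (3 + x)) / (3 + x\<^sup>2)"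
    if "x \<in> {0..1}" for x
  proof -
    have p: "3 + x > 0" using that by simp
    have e: "1 - (3 - x) / (3 + x) + ((3 - x) / (3 + x))\<^sup>2 = 3 * (3 + x\<^sup>2) / (3 + x)\<^sup>2"
      using p by (simp add: divide_simps) (simp add: power2_eq_square algebra_simps)
    have R: "(- 6 / A) *\<^sub>R (- L / (3 * C / A)) = 2 * L / C" if "A \<noteq> 0" "C \<noteq> 0" for A C L :: real
      using that by (simp add: field_simps)
    show ?thesis unfolding f_def e by (rule R) (use p nz[of x] in auto)
  qed
  ultimately have f: "((\<lambda>x. 2 * ln ((3 - x) / (3 + x)) / (3 + x\<^sup>2)) has_integral - (s0_series / 6)) {0..1}"
    by (rule has_integral_eq[rotated]) auto
  have "((\<lambda>x. (-3) * (2 * ln ((3 - x) / (3 + x)) / (3 + x\<^sup>2)) + (-12) * u x) has_integral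
      (-3) * - (s0_series / 6) + (-12) * 0) {0..1}"
    by (intro has_integral_add has_integral_mult_right f u)
  moreover have "(-3) * (2 * ln ((3 - x) / (3 + x)) / (3 + x\<^sup>2)) + (-12) * u x
      = - 6 * ln ((9 - x\<^sup>2) / 12) / (3 + x\<^sup>2)" if "x \<in> {0..1}" for x
  proof -
    have "(9 - x\<^sup>2) / 12 = (3 - x) / (3 + x) * ((3 + x) / (2 * sqrt 3))\<^sup>2"
      using that by (simp add: power_divide power_mult_distrib field_simps power2_eq_square)
    moreover have "0 < (3 - x) / (3 + x)" "0 < (3 + x) / (2 * sqrt 3)" using that by auto
    ultimately have "ln ((9 - x\<^sup>2) / 12) = ln ((3 - x) / (3 + x)) + 2 * ln ((3 + x) / (2 * sqrt 3))"
      by (simp only: ln_mult_pos ln_realpow zero_less_power of_nat_numeral)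
    hence e: "ln ((9 - x\<^sup>2) / 12) = ln ((3 - x) / (3 + x)) + 2 * ln ((3 + x) / (2 * sqrt 3))" .
    have R: "(-3) * (2 * L / C) + (-12) * (M / C) = - 6 * (L + 2 * M) / C" if "C \<noteq> 0" for C L M :: real
      using that by (simp add: field_simps)
    show ?thesis unfolding u_def e by (rule R) (use nz in auto)
  qed
  ultimately have "((\<lambda>x. - 6 * ln ((9 - x\<^sup>2) / 12) / (3 + x\<^sup>2)) has_integral
      (-3) * - (s0_series / 6) + (-12) * 0) {0..1}"
    by (rule has_integral_eq[rotated]) auto
  thus ?thesis by simp
qed

text \<open>The extremal triangle has squared legs \<open>1 / 4\<close> and \<open>1 / 12\<close>;
  in the coordinates of \<open>nn_integral_triangle\<close> the unit hemisphere centred at its apex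
  has squared height \<open>1 - s\<^sup>2 * (3 + x\<^sup>2) / 12\<close>. The Jacobian
  \<open>s\<close> has total integral \<open>1 / 2\<close>, so the mean is exactly
  \<open>s0_series\<close>.\<close>

lemma nn_integral_orthoscheme:
  "(\<integral>\<^sup>+x. (\<integral>\<^sup>+s. ennreal (s / (1 - s\<^sup>2 * (3 + x\<^sup>2) / 12)) * indicator {0..1} s \<partial>lborel)
      * indicator {0..1} x \<partial>lborel) = ennreal (s0_series / 2)"
proof -
  have "(\<integral>\<^sup>+s. ennreal (s / (1 - s\<^sup>2 * (3 + x\<^sup>2) / 12)) * indicator {0..1} s \<partial>lborel)
      = ennreal (- 6 * ln ((9 - x\<^sup>2) / 12) / (3 + x\<^sup>2))" if x: "x \<in> {0..1}" for x :: real
  proof -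
    have xx: "0 \<le> x\<^sup>2" "x\<^sup>2 \<le> 1" using x by (auto simp: power_le_one)
    define c where "c = (3 + x\<^sup>2) / 12"
    have c: "0 < c" "c \<le> 1 / 3" using xx by (auto simp: c_def intro!: add_pos_nonneg)
    have den: "1 - s\<^sup>2 * c > 0" if "s \<in> {0..1}" for s
    proof -
      have "s\<^sup>2 * c \<le> 1 * (1 / 3)" using that c by (intro mult_mono) (auto simp: power_le_one)
      thus ?thesis by simp
    qed
    have "((\<lambda>s. s / (1 - s\<^sup>2 * c)) has_integral (- ln (1 - 1\<^sup>2 * c) / (2 * c) - - ln (1 - 0\<^sup>2 * c) / (2 * c))) {0..1}"
    proof (rule fundamental_theorem_of_calculus)
      fix s :: real assume s: "s \<in> {0..1}"
      show "((\<lambda>s. - ln (1 - s\<^sup>2 * c) / (2 * c)) has_vector_derivative s / (1 - s\<^sup>2 * c)) (at s within {0..1})"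
        unfolding has_real_derivative_iff_has_vector_derivative[symmetric]
        using den[OF s] c by (auto intro!: derivative_eq_intros simp: field_simps)
    qed simp
    moreover have "- ln (1 - 1\<^sup>2 * c) / (2 * c) - - ln (1 - 0\<^sup>2 * c) / (2 * c) = - 6 * ln ((9 - x\<^sup>2) / 12) / (3 + x\<^sup>2)"
    proof -
      have e: "1 - c = (9 - x\<^sup>2) / 12" "2 * c = (3 + x\<^sup>2) / 6" by (simp_all add: c_def field_simps)
      have "- ln (1 - 1\<^sup>2 * c) / (2 * c) - - ln (1 - 0\<^sup>2 * c) / (2 * c) = - ln (1 - c) / (2 * c)" by simp
      thus ?thesis unfolding e by simp
    qed
    ultimately have "((\<lambda>s. s / (1 - s\<^sup>2 * (3 + x\<^sup>2) / 12)) has_integral - 6 * ln ((9 - x\<^sup>2) / 12) / (3 + x\<^sup>2)) {0..1}"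
      by (simp add: c_def)
    moreover have "0 \<le> s / (1 - s\<^sup>2 * (3 + x\<^sup>2) / 12)" if "s \<in> {0..1}" for s
      using den[OF that] that by (intro divide_nonneg_nonneg) (auto simp: c_def)
    ultimately show ?thesis
      by (intro nn_integral_has_integral_lebesgue')
  qed
  hence "(\<integral>\<^sup>+x. (\<integral>\<^sup>+s. ennreal (s / (1 - s\<^sup>2 * (3 + x\<^sup>2) / 12)) * indicator {0..1} s \<partial>lborel)
      * indicator {0..1} x \<partial>lborel)
      = (\<integral>\<^sup>+x. ennreal (- 6 * ln ((9 - x\<^sup>2) / 12) / (3 + x\<^sup>2)) * indicator {0..1} x \<partial>lborel)"
    by (intro nn_integral_cong) (auto simp: indicator_def)
  also have "\<dots> = ennreal (s0_series / 2)"
  proof (rule nn_integral_has_integral_lebesgue'[OF _ has_integral_orthoscheme])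
    fix x :: real assume "x \<in> {0..1}"
    hence "x\<^sup>2 \<le> 1" by (auto simp: power_le_one)
    have R: "0 \<le> - 6 * ln ((9 - z) / 12) / (3 + z)" if "0 \<le> z" "z \<le> 1" for z :: real
    proof -
      have "ln ((9 - z) / 12) \<le> 0" using that by (simp add: ln_le_zero_iff)
      thus ?thesis using that by (intro divide_nonneg_nonneg) auto
    qed
    show "0 \<le> - 6 * ln ((9 - x\<^sup>2) / 12) / (3 + x\<^sup>2)"
      by (rule R) (use \<open>x\<^sup>2 \<le> 1\<close> in auto)
  qed
  finally show ?thesis .
qed

section \<open>Powers of points\<close>

text \<open>
  \<open>A\<close>, \<open>B\<close>, \<open>C\<close> are three centres seen from a point whose power with respect to each of them is
  at least \<open>2 / 3\<close>. The angle between any two would exceed \<open>120\<close> degrees.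
\<close>

lemma power_angle:
  fixes A B :: "'a::real_inner"
  assumes w: "\<alpha> \<le> 1" "\<beta> \<le> 1" and A: "(norm A)\<^sup>2 \<le> \<alpha> - 2 / 3" and B: "(norm B)\<^sup>2 < \<beta> - 2 / 3"
    and AB: "\<alpha> * \<beta> \<le> (norm (A - B))\<^sup>2"
  shows "2 * (A \<bullet> B) < - (norm A * norm B)"
proof -
  define p q where "p = norm A" and "q = norm B"
  have p: "0 \<le> p" "p\<^sup>2 \<le> 1 / 3" and q: "0 \<le> q" "q\<^sup>2 < 1 / 3" using A B w by (auto simp: p_def q_def)
  have eq: "(norm (A - B))\<^sup>2 = p\<^sup>2 + q\<^sup>2 - 2 * (A \<bullet> B)"
    by (simp add: p_def q_def power2_norm_eq_inner inner_diff_left inner_diff_right inner_commute)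
  have "(p\<^sup>2 + 2 / 3) * (q\<^sup>2 + 2 / 3) < \<alpha> * \<beta>"
    using A B by (intro mult_le_less_imp_less) (auto simp: p_def q_def add_nonneg_pos)
  with AB eq have *: "2 * (A \<bullet> B) < p\<^sup>2 + q\<^sup>2 - (p\<^sup>2 + 2 / 3) * (q\<^sup>2 + 2 / 3)" by simp
  have "(p * q)\<^sup>2 \<le> (1 / 3) * (1 / 3)" unfolding power_mult_distrib
    using p q by (intro mult_mono) auto
  hence "(p * q)\<^sup>2 \<le> (1 / 3)\<^sup>2" by (simp add: power_divide)
  hence pq: "p * q \<le> 1 / 3" by (rule power2_le_imp_le) simp
  \<comment> \<open>Sharp for \<open>p * q = 1 / 3\<close>: unit weights at the corners of an
    equilateral triangle of side 1, seen from its centroid at angles of exactly 120 degrees.\<close>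
  have "0 \<le> (1 / 3 - p * q) * (2 / 3 - p * q)" using pq by (intro mult_nonneg_nonneg) auto
  hence pq': "p * q - (p * q)\<^sup>2 \<le> 2 / 9" by (simp add: algebra_simps power2_eq_square)
  have s: "p\<^sup>2 + q\<^sup>2 \<le> 2 / 3" using p q by simp
  have m: "(p\<^sup>2 + 2 / 3) * (q\<^sup>2 + 2 / 3) = (p * q)\<^sup>2 + 2 / 3 * (p\<^sup>2 + q\<^sup>2) + 4 / 9"
    by (simp add: algebra_simps power2_eq_square)
  have "p\<^sup>2 + q\<^sup>2 - (p\<^sup>2 + 2 / 3) * (q\<^sup>2 + 2 / 3) \<le> - (p * q)"
  proof -
    have "c - (b + 2 / 3 * c + 4 / 9) \<le> - a" if "a - b \<le> 2 / 9" "c \<le> 2 / 3" for a b c :: real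
      using that by linarith
    thus ?thesis using pq' s by (simp only: m)
  qed
  with * show ?thesis by (simp add: p_def q_def)
qed

lemma three_powers_contradiction:
  fixes A B C :: "'a::real_inner"
  assumes w: "\<alpha> \<le> 1" "\<beta> \<le> 1" "\<gamma> \<le> 1"
    and A: "(norm A)\<^sup>2 \<le> \<alpha> - 2 / 3" and B: "(norm B)\<^sup>2 < \<beta> - 2 / 3" and C: "(norm C)\<^sup>2 < \<gamma> - 2 / 3"
    and "\<alpha> * \<beta> \<le> (norm (A - B))\<^sup>2" "\<alpha> * \<gamma> \<le> (norm (A - C))\<^sup>2" "\<beta> * \<gamma> \<le> (norm (B - C))\<^sup>2"
  shows False
proof -
  have AB: "2 * (A \<bullet> B) < - (norm A * norm B)" and AC: "2 * (A \<bullet> C) < - (norm A * norm C)"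
    and BC: "2 * (B \<bullet> C) < - (norm B * norm C)"
    using power_angle[of \<alpha> \<beta> A B] power_angle[of \<alpha> \<gamma> A C] power_angle[of \<beta> \<gamma> B C] assms by auto
  have nz: "A \<noteq> 0" "B \<noteq> 0" "C \<noteq> 0" using AB AC by auto
  have "2 * (sgn A \<bullet> sgn B) < -1" "2 * (sgn A \<bullet> sgn C) < -1" "2 * (sgn B \<bullet> sgn C) < -1"
    using AB AC BC nz by (simp_all add: sgn_div_norm field_simps)
  moreover have "sgn A \<bullet> sgn A = 1" "sgn B \<bullet> sgn B = 1" "sgn C \<bullet> sgn C = 1"
    using nz by (simp_all add: dot_square_norm norm_sgn)
  moreover have "0 \<le> (sgn A + sgn B + sgn C) \<bullet> (sgn A + sgn B + sgn C)" by simp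
  ultimately show False
    by (simp add: inner_add_left inner_add_right inner_commute)
qed

text \<open>With \<open>Z\<close> the squared distance of two centres,
  \<open>(Z + e - \<epsilon>) / (2 * sqrt Z)\<close> is the signed distance from the first to their
  radical line, so the left side is the greatest squared height over that line. Equality holds for
  \<open>Z = e = \<epsilon> = 1\<close>.\<close>

lemma bisector_height_le:
  fixes Z e \<epsilon> :: real
  assumes e: "e \<le> 1" "\<epsilon> \<le> 1" and Z: "0 < Z" "e * \<epsilon> \<le> Z"
  shows "e - (Z + e - \<epsilon>)\<^sup>2 / (4 * Z) \<le> 3 / 4"
proof -
  have "0 \<le> (1 - e) * (1 - \<epsilon>)" using e by (intro mult_nonneg_nonneg) auto
  hence "0 \<le> Z + 3 - 2 * e - 2 * \<epsilon>" using Z(2) e by (simp add: algebra_simps)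
  hence "0 \<le> Z * (Z + 3 - 2 * e - 2 * \<epsilon>) + (e - \<epsilon>)\<^sup>2" using Z(1) by simp
  also have "\<dots> = (Z + e - \<epsilon>)\<^sup>2 - (4 * e - 3) * Z" by (simp add: algebra_simps power2_eq_square)
  finally show ?thesis using Z(1) by (simp add: field_simps)
qed

section \<open>Linear isometries and Lebesgue measure\<close>

lemma lborel_orthogonal_transformation:
  fixes f :: "real^'n::{finite,wellorder} \<Rightarrow> real^'n::_"
  assumes f: "orthogonal_transformation f"
  shows "distr lborel borel f = lborel"
proof (rule lborel_eqI[symmetric])
  have lin: "linear f" using f by (rule orthogonal_transformation_linear)
  hence meas [measurable]: "f \<in> borel_measurable borel"
    by (simp add: borel_measurable_continuous_onI linear_continuous_on linear_conv_bounded_linear)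
  fix l u :: "real^'n::_" assume lu: "\<And>b. b \<in> Basis \<Longrightarrow> l \<bullet> b \<le> u \<bullet> b"
  have g: "orthogonal_transformation (inv f)" by (rule orthogonal_transformation_inv[OF f])
  have vim: "f -` box l u = inv f ` box l u"
    using orthogonal_transformation_bij[OF f] by (simp add: bij_vimage_eq_inv_image)
  have "measure lebesgue (f -` box l u) = measure lebesgue (box l u)"
    unfolding vim by (rule measure_orthogonal_image[OF g]) auto
  moreover have fin: "f -` box l u \<in> lmeasurable"
    unfolding vim by (rule measurable_orthogonal_image[OF g]) auto
  ultimately have "emeasure lebesgue (f -` box l u) = emeasure lebesgue (box l u)"
    by (metis emeasure_eq_measure2 lmeasurable_box)
  moreover have "f -` box l u \<in> sets borel"
    using measurable_sets[OF meas, of "box l u"] by simp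
  ultimately have "emeasure lborel (f -` box l u) = emeasure lborel (box l u)" by simp
  thus "emeasure (distr lborel borel f) (box l u) = ennreal (prod ((\<bullet>) (u - l)) Basis)"
    using lu by (simp add: emeasure_distr)
qed simp

text \<open>A bijection of the bases identifies the source with the vector type, preserving volume;
  what remains is an orthogonal transformation. The source type is left free because frame
  coordinates live in a product type.\<close>

lemma lborel_linear_isometry_vec:
  fixes f :: "'a::euclidean_space \<Rightarrow> real^'n::{finite,wellorder}"
  assumes lin: "linear f" and iso: "\<And>x. norm (f x) = norm x" and dim: "DIM('a) = CARD('n)"
  shows "distr lborel borel f = lborel"
proof -
  obtain \<beta> :: "'n \<Rightarrow> 'a" where \<beta>: "bij_betw \<beta> UNIV Basis"
    using finite_same_card_bij[of "UNIV :: 'n set" "Basis :: 'a set"] dim by auto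
  define \<phi> where "\<phi> = (\<lambda>x. \<chi> i. x \<bullet> \<beta> i)"
  define \<psi> where "\<psi> = (\<lambda>y :: real^'n::_. \<Sum>i\<in>UNIV. y $ i *\<^sub>R \<beta> i)"
  have \<beta>B: "\<beta> i \<in> Basis" for i using \<beta> by (auto simp: bij_betw_def)
  have \<beta>inj: "\<beta> i = \<beta> j \<longleftrightarrow> i = j" for i j using \<beta> by (auto simp: bij_betw_def inj_on_def)
  have \<beta>\<beta>: "\<beta> i \<bullet> \<beta> j = (if i = j then 1 else 0)" for i j
    using \<beta>B by (simp add: inner_Basis \<beta>inj)
  have lin\<phi>: "linear \<phi>" unfolding \<phi>_def by (rule linearI) (auto simp: vec_eq_iff inner_add_left)
  have lin\<psi>: "linear \<psi>" unfolding \<psi>_def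
    by (rule linearI) (auto simp: scaleR_add_left sum.distrib scaleR_sum_right)
  have meas [measurable]: "\<phi> \<in> borel_measurable borel" "f \<in> borel_measurable borel"
    using lin lin\<phi> by (simp_all add: borel_measurable_continuous_onI linear_continuous_on linear_conv_bounded_linear)
  have meas\<psi> [measurable]: "\<psi> \<in> borel_measurable borel"
    using lin\<psi> by (simp_all add: borel_measurable_continuous_onI linear_continuous_on linear_conv_bounded_linear)
  have \<psi>\<phi>: "\<psi> (\<phi> x) = x" for x
  proof -
    have "\<psi> (\<phi> x) = (\<Sum>b\<in>Basis. (x \<bullet> b) *\<^sub>R b)"
      unfolding \<psi>_def \<phi>_def using sum.reindex_bij_betw[OF \<beta>, of "\<lambda>b. (x \<bullet> b) *\<^sub>R b"] by simp
    thus ?thesis by (simp add: euclidean_representation)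
  qed
  have norm\<psi>: "norm (\<psi> y) = norm y" for y
  proof -
    have "\<psi> y \<bullet> \<psi> y = y \<bullet> y"
      unfolding \<psi>_def by (simp add: inner_sum_left inner_sum_right \<beta>\<beta> inner_vec_def if_distrib cong: if_cong)
    thus ?thesis by (simp add: norm_eq_sqrt_inner)
  qed
  have d\<phi>: "distr lborel borel \<phi> = lborel"
  proof (rule lborel_eqI[symmetric])
    fix l u :: "real^'n::_" assume lu: "\<And>b. b \<in> Basis \<Longrightarrow> l \<bullet> b \<le> u \<bullet> b"
    hence lu': "l $ i \<le> u $ i" for i
      using axis_in_Basis_iff[of i "1::real"] by (metis cart_eq_inner_axis Basis_real_def insertI1)
    have Ball: "(\<forall>b\<in>Basis. P b) \<longleftrightarrow> (\<forall>i. P (\<beta> i))" for P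
    proof -
      have B: "Basis = range \<beta>" using \<beta> by (simp add: bij_betw_def)
      show ?thesis unfolding B by blast
    qed
    have inn: "\<psi> y \<bullet> \<beta> i = y $ i" for y i
      unfolding \<psi>_def by (simp add: inner_sum_left \<beta>\<beta> if_distrib cong: if_cong)
    have "\<phi> -` box l u = box (\<psi> l) (\<psi> u)"
      by (auto simp: box_def[of "\<psi> l"] mem_box_cart Ball inn \<phi>_def)
    moreover have "(\<Prod>b\<in>Basis. (\<psi> u - \<psi> l) \<bullet> b) = (\<Prod>i\<in>UNIV. u $ i - l $ i)"
      using prod.reindex_bij_betw[OF \<beta>, of "\<lambda>b. (\<psi> u - \<psi> l) \<bullet> b"] by (simp add: inner_diff_left inn)
    moreover have "(\<Prod>b\<in>Basis. (u - l) \<bullet> b) = (\<Prod>i\<in>UNIV. u $ i - l $ i)"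
      by (simp add: Basis_vec_def Basis_real_def UNION_singleton_eq_range prod.reindex inj_on_def axis_eq_axis
          inner_axis image_image)
    ultimately show "emeasure (distr lborel borel \<phi>) (box l u) = ennreal (\<Prod>b\<in>Basis. (u - l) \<bullet> b)"
      using lu' by (simp add: emeasure_distr emeasure_lborel_box_eq Ball inn)
  qed simp
  have "orthogonal_transformation (f \<circ> \<psi>)"
    using lin lin\<psi> iso norm\<psi> by (simp add: orthogonal_transformation linear_compose)
  hence "lborel = distr (distr lborel borel \<phi>) borel (f \<circ> \<psi>)"
    unfolding d\<phi> by (rule lborel_orthogonal_transformation[symmetric])
  also have "\<dots> = distr lborel borel f"
    by (subst distr_distr) (auto simp: o_def \<psi>\<phi>)
  finally show ?thesis ..
qed

lemma lborel_linear_isometry_plane: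
  fixes f :: "real \<times> real \<Rightarrow> real \<times> real"
  assumes lin: "linear f" and iso: "\<And>x. norm (f x) = norm x"
  shows "distr lborel borel f = lborel"
proof -
  define \<phi> :: "real \<times> real \<Rightarrow> real^2" where "\<phi> = (\<lambda>p. vector [fst p, snd p])"
  define \<psi> :: "real^2 \<Rightarrow> real \<times> real" where "\<psi> = (\<lambda>y. (y $ 1, y $ 2))"
  have lin\<phi>: "linear \<phi>" unfolding \<phi>_def by (rule linearI) (auto simp: vec_eq_iff forall_2)
  have lin\<psi>: "linear \<psi>" unfolding \<psi>_def by (rule linearI) auto
  have [measurable]: "\<phi> \<in> borel_measurable borel" "f \<in> borel_measurable borel"
    using lin lin\<phi> by (simp_all add: borel_measurable_continuous_onI linear_continuous_on linear_conv_bounded_linear)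
  have [measurable]: "\<psi> \<in> borel_measurable borel"
    using lin\<psi> by (simp_all add: borel_measurable_continuous_onI linear_continuous_on linear_conv_bounded_linear)
  have \<psi>\<phi>: "\<psi> (\<phi> x) = x" for x by (simp add: \<phi>_def \<psi>_def)
  have iso\<phi>: "norm (\<phi> x) = norm x" for x
    by (cases x) (simp add: \<phi>_def norm_vec_def L2_set_def sum_2 norm_Pair)
  have 1: "distr lborel borel \<phi> = lborel"
    by (intro lborel_linear_isometry_vec lin\<phi> iso\<phi>) simp
  have 2: "distr lborel borel (\<phi> \<circ> f) = lborel"
    by (intro lborel_linear_isometry_vec linear_compose lin lin\<phi>) (simp_all add: iso iso\<phi>)
  have "distr lborel borel f = distr (distr lborel borel (\<phi> \<circ> f)) borel \<psi>"
    by (subst distr_distr) (auto simp: o_def \<psi>\<phi>)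
  also have "\<dots> = distr (distr lborel borel \<phi>) borel \<psi>" by (simp only: 1 2)
  also have "\<dots> = lborel"
    by (subst distr_distr) (auto simp: o_def \<psi>\<phi> distr_id2)
  finally show ?thesis .
qed

lemma nn_integral_lborel_scale:
  fixes g :: "'a::euclidean_space \<Rightarrow> ennreal"
  assumes [measurable]: "g \<in> borel_measurable borel" and c: "c > 0"
  shows "(\<integral>\<^sup>+x. g x \<partial>lborel) = ennreal (c ^ DIM('a)) * (\<integral>\<^sup>+x. g (c *\<^sub>R x) \<partial>lborel)"
  using c
  by (subst lborel_affine[of c 0])
     (simp_all add: nn_integral_density nn_integral_distr nn_integral_cmult ennreal_power)

section \<open>Cells of a weighted point set in a polygon\<close>

text \<open>The mean of \<open>f\<close> over \<open>A\<close> is at least \<open>1 / s0\<close>,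
  multiplied out so that null sets qualify and disjoint unions of heavy sets are heavy.\<close>

definition heavy :: "(real \<times> real \<Rightarrow> ennreal) \<Rightarrow> (real \<times> real) set \<Rightarrow> bool" where
  "heavy f A \<longleftrightarrow> A \<in> sets borel \<and>
     ennreal s0_series * emeasure lborel A \<le> (\<integral>\<^sup>+y. f y * indicator A y \<partial>lborel)"

lemma heavy_const:
  assumes [measurable]: "A \<in> sets borel" and c: "s0_series \<le> c" and f: "\<And>y. y \<in> A \<Longrightarrow> ennreal c \<le> f y"
  shows "heavy f A"
proof -
  have "ennreal s0_series * emeasure lborel A = (\<integral>\<^sup>+y. ennreal s0_series * indicator A y \<partial>lborel)"
    by (simp add: nn_integral_cmult_indicator)
  also have "\<dots> \<le> (\<integral>\<^sup>+y. f y * indicator A y \<partial>lborel)"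
    using c f by (intro nn_integral_mono) (auto simp: indicator_def intro: order_trans[OF ennreal_leI])
  finally show ?thesis by (simp add: heavy_def)
qed

lemma heavy_Un:
  assumes [measurable]: "f \<in> borel_measurable borel" and A: "heavy f A" and B: "heavy f B" and "A \<inter> B = {}"
  shows "heavy f (A \<union> B)"
proof -
  have [measurable]: "A \<in> sets borel" "B \<in> sets borel" using A B by (auto simp: heavy_def)
  have "(\<integral>\<^sup>+y. f y * indicator (A \<union> B) y \<partial>lborel)
      = (\<integral>\<^sup>+y. f y * indicator A y + f y * indicator B y \<partial>lborel)"
    using \<open>A \<inter> B = {}\<close> by (intro nn_integral_cong) (auto simp: indicator_def)
  also have "\<dots> = (\<integral>\<^sup>+y. f y * indicator A y \<partial>lborel) + (\<integral>\<^sup>+y. f y * indicator B y \<partial>lborel)"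
    by (intro nn_integral_add) auto
  also have "\<dots> \<ge> ennreal s0_series * emeasure lborel A + ennreal s0_series * emeasure lborel B"
    using A B by (intro add_mono) (auto simp: heavy_def)
  finally have "ennreal s0_series * emeasure lborel A + ennreal s0_series * emeasure lborel B
      \<le> (\<integral>\<^sup>+y. f y * indicator (A \<union> B) y \<partial>lborel)" .
  moreover have "emeasure lborel (A \<union> B) = emeasure lborel A + emeasure lborel B"
    using \<open>A \<inter> B = {}\<close> by (subst plus_emeasure[symmetric]) auto
  ultimately show ?thesis by (simp add: heavy_def distrib_left)
qed

lemma heavy_UN:
  assumes f: "f \<in> borel_measurable borel" and "finite I" and "\<And>i. i \<in> I \<Longrightarrow> heavy f (A i)"
    and "disjoint_family_on A I"
  shows "heavy f (\<Union>i\<in>I. A i)"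
  using assms(2-4)
proof (induction I rule: finite_induct)
  case empty
  show ?case by (simp add: heavy_def)
next
  case (insert i I)
  have "disjoint_family_on A I" using insert.prems(2) by (auto simp: disjoint_family_on_def)
  moreover have "A i \<inter> (\<Union>j\<in>I. A j) = {}"
    using insert.prems(2) insert.hyps by (fastforce simp: disjoint_family_on_def)
  ultimately show ?case using insert by (simp add: heavy_Un[OF f])
qed

lemma heavy_null_diff:
  assumes A: "heavy f A" and [measurable]: "B \<in> sets borel" and AB: "A \<subseteq> B"
    and N: "B - A \<subseteq> N" "N \<in> null_sets lborel"
  shows "heavy f B"
proof -
  have [measurable]: "A \<in> sets borel" using A by (auto simp: heavy_def)
  have "emeasure lborel (B - A) \<le> emeasure lborel N" using N by (intro emeasure_mono) auto
  also have "\<dots> = 0" using N by auto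
  finally have "emeasure lborel (B - A) = 0" by simp
  moreover have "emeasure lborel B = emeasure lborel A + emeasure lborel (B - A)"
    using AB by (subst plus_emeasure) (auto simp: Un_absorb1)
  ultimately have "ennreal s0_series * emeasure lborel B \<le> (\<integral>\<^sup>+y. f y * indicator A y \<partial>lborel)"
    using A by (simp add: heavy_def)
  also have "\<dots> \<le> (\<integral>\<^sup>+y. f y * indicator B y \<partial>lborel)"
    using AB by (intro nn_integral_mono) (auto simp: indicator_def)
  finally show ?thesis by (simp add: heavy_def)
qed

lemma hyperplane_null:
  fixes a :: "'a::euclidean_space"
  assumes "a \<noteq> 0"
  shows "{x. a \<bullet> x = b} \<in> null_sets lborel"
proof -
  have "{x. a \<bullet> x = b} \<in> null_sets lebesgue"
    using negligible_hyperplane[of a b] assms by (simp add: negligible_iff_null_sets)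
  moreover have "{x. a \<bullet> x = b} \<in> sets borel" by (simp add: borel_closed closed_hyperplane)
  ultimately show ?thesis by (auto simp: null_sets_def)
qed

section \<open>Model regions: right triangles and circular sectors\<close>

lemma nn_integral_Icc_Ioo:
  "(\<integral>\<^sup>+x. f x * indicator {0..b::real} x \<partial>lborel) = (\<integral>\<^sup>+x. f x * indicator {0<..<b} x \<partial>lborel)"
proof (rule nn_integral_cong_AE)
  have "AE x in lborel. x \<noteq> (0::real)" "AE x in lborel. x \<noteq> b" by (rule AE_lborel_singleton)+
  thus "AE x in lborel. f x * indicator {0..b} x = f x * indicator {0<..<b} x"
    by eventually_elim (auto simp: indicator_def)
qed

text \<open>\<open>s\<close> scales from the apex 0 and \<open>x\<close> runs along the opposite
  leg, so the point is \<open>(s * d, s * x * W)\<close> with Jacobian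
  \<open>s * d * W\<close>.\<close>

lemma nn_integral_triangle:
  fixes g :: "real \<times> real \<Rightarrow> ennreal"
  assumes d: "0 < d" and W: "0 < W" and [measurable]: "g \<in> borel_measurable borel"
  shows "(\<integral>\<^sup>+y. g y * indicator {y. 0 < fst y \<and> fst y < d \<and> 0 < snd y \<and> snd y * d < W * fst y} y \<partial>lborel)
    = ennreal (d * W) * (\<integral>\<^sup>+x. (\<integral>\<^sup>+s. ennreal s * g (s * d, s * x * W) * indicator {0<..<1} s \<partial>lborel)
         * indicator {0<..<1} x \<partial>lborel)" (is "?L = _")
proof -
  have [measurable]: "g \<in> borel_measurable (borel \<Otimes>\<^sub>M borel)" by (simp add: borel_prod)
  let ?T = "{y. 0 < fst y \<and> fst y < d \<and> 0 < snd y \<and> snd y * d < W * fst y}"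
  have "?T \<in> sets borel"
    by (intro borel_open open_Collect_conj open_Collect_less continuous_intros)
  hence [measurable]: "?T \<in> sets (borel \<Otimes>\<^sub>M borel)" by (subst borel_prod)
  have "?L = (\<integral>\<^sup>+y. g y * indicator ?T y \<partial>(lborel \<Otimes>\<^sub>M lborel))" by (simp only: lborel_prod)
  also have "\<dots> = (\<integral>\<^sup>+a. (\<integral>\<^sup>+b. g (a, b) * indicator ?T (a, b) \<partial>lborel) \<partial>lborel)"
    by (subst lborel.nn_integral_fst) simp_all
  also have "\<dots> = (\<integral>\<^sup>+a. (ennreal (W * a / d) * (\<integral>\<^sup>+x. g (a, x * (W * a / d)) * indicator {0<..<1} x \<partial>lborel))
      * indicator {0<..<d} a \<partial>lborel)"
  proof (rule nn_integral_cong)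
    fix a :: real
    show "(\<integral>\<^sup>+b. g (a, b) * indicator ?T (a, b) \<partial>lborel) =
      (ennreal (W * a / d) * (\<integral>\<^sup>+x. g (a, x * (W * a / d)) * indicator {0<..<1} x \<partial>lborel)) * indicator {0<..<d} a"
    proof (cases "a \<in> {0<..<d}")
      case True
      hence c: "W * a / d > 0" using d W by auto
      have "(\<integral>\<^sup>+b. g (a, b) * indicator ?T (a, b) \<partial>lborel)
        = ennreal \<bar>W * a / d\<bar> * (\<integral>\<^sup>+x. g (a, 0 + (W * a / d) * x) * indicator ?T (a, 0 + (W * a / d) * x) \<partial>lborel)"
        using c by (intro nn_integral_real_affine) auto
      also have "(\<integral>\<^sup>+x. g (a, 0 + (W * a / d) * x) * indicator ?T (a, 0 + (W * a / d) * x) \<partial>lborel)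
        = (\<integral>\<^sup>+x. g (a, x * (W * a / d)) * indicator {0<..<1} x \<partial>lborel)"
      proof (intro nn_integral_cong)
        fix x :: real
        have "0 < W * a / d * x \<longleftrightarrow> 0 < x" using c by (simp add: zero_less_mult_iff del: times_divide_eq_left)
        moreover have "W * a / d * x * d < W * a \<longleftrightarrow> x < 1"
          using True d W by (simp add: mult_less_cancel_left1 mult.commute)
        moreover have "(a, 0 + W * a / d * x) \<in> ?T \<longleftrightarrow> 0 < a \<and> a < d \<and> 0 < W * a / d * x \<and> W * a / d * x * d < W * a"
          by (simp only: mem_Collect_eq fst_conv snd_conv add_0)
        ultimately have "(a, 0 + W * a / d * x) \<in> ?T \<longleftrightarrow> x \<in> {0<..<1}"
          using True by (simp only: greaterThanLessThan_iff) simp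
        thus "g (a, 0 + W * a / d * x) * indicator ?T (a, 0 + W * a / d * x)
          = g (a, x * (W * a / d)) * indicator {0<..<1} x"
          by (simp add: indicator_def mult.commute)
      qed
      finally show ?thesis using True by (simp only: abs_of_pos[OF c] indicator_simps mult_1_right)
    qed (auto simp: indicator_def)
  qed
  also have "\<dots> = ennreal \<bar>d\<bar> * (\<integral>\<^sup>+s. (ennreal (W * (0 + d * s) / d) *
      (\<integral>\<^sup>+x. g (0 + d * s, x * (W * (0 + d * s) / d)) * indicator {0<..<1} x \<partial>lborel))
      * indicator {0<..<d} (0 + d * s) \<partial>lborel)"
    using d by (intro nn_integral_real_affine) auto
  also have "\<dots> = ennreal d * (\<integral>\<^sup>+s. ennreal W * (\<integral>\<^sup>+x. ennreal s * g (s * d, s * x * W) *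
      indicator {0<..<1} s * indicator {0<..<1} x \<partial>lborel) \<partial>lborel)"
  proof -
    have "(ennreal (W * (0 + d * s) / d) *
      (\<integral>\<^sup>+x. g (0 + d * s, x * (W * (0 + d * s) / d)) * indicator {0<..<1} x \<partial>lborel))
      * indicator {0<..<d} (0 + d * s) = ennreal W * (\<integral>\<^sup>+x. ennreal s * g (s * d, s * x * W) *
      indicator {0<..<1} s * indicator {0<..<1} x \<partial>lborel)" for s
    proof (cases "s \<in> {0<..<1}")
      case True
      hence "ennreal (W * s) = ennreal W * ennreal s" using W by (simp add: ennreal_mult)
      moreover have "(\<integral>\<^sup>+x. ennreal s * g (s * d, s * x * W) * indicator {0<..<1} s * indicator {0<..<1} x \<partial>lborel)
        = ennreal s * (\<integral>\<^sup>+x. g (s * d, s * x * W) * indicator {0<..<1} x \<partial>lborel)"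
        using True by (subst nn_integral_cmult[symmetric]) (auto simp: mult_ac)
      ultimately show ?thesis using True d by (simp add: mult_ac)
    next
      case False
      hence "d * s \<notin> {0<..<d}" using d by (auto simp: zero_less_mult_iff)
      thus ?thesis using False by simp
    qed
    thus ?thesis using d by simp
  qed
  also have "\<dots> = ennreal (d * W) * (\<integral>\<^sup>+s. (\<integral>\<^sup>+x. ennreal s * g (s * d, s * x * W) *
      indicator {0<..<1} s * indicator {0<..<1} x \<partial>lborel) \<partial>lborel)"
    using d W by (subst nn_integral_cmult) (auto simp: ennreal_mult mult.assoc)
  also have "(\<integral>\<^sup>+s. (\<integral>\<^sup>+x. ennreal s * g (s * d, s * x * W) *
      indicator {0<..<1} s * indicator {0<..<1} x \<partial>lborel) \<partial>lborel)
    = (\<integral>\<^sup>+x. (\<integral>\<^sup>+s. ennreal s * g (s * d, s * x * W) *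
      indicator {0<..<1} s * indicator {0<..<1} x \<partial>lborel) \<partial>lborel)"
    by (rule lborel_pair.Fubini') measurable
  also have "\<dots> = (\<integral>\<^sup>+x. (\<integral>\<^sup>+s. ennreal s * g (s * d, s * x * W) * indicator {0<..<1} s \<partial>lborel)
         * indicator {0<..<1} x \<partial>lborel)"
    by (intro nn_integral_cong nn_integral_multc) auto
  finally show ?thesis .
qed

text \<open>The reciprocal squared height of a hemisphere with squared radius \<open>e\<close>,
  heights being cut off from below at \<open>2 / 3\<close>. The cut-off only lowers the volume that
  is counted, and it avoids the question whether the hemispheres cover the polygon.\<close>

definition height_weight :: "real \<Rightarrow> real \<times> real \<Rightarrow> ennreal" where
  "height_weight e y = ennreal (1 / max (e - (norm y)\<^sup>2) (2 / 3))"

lemma measurable_height_weight [measurable]: "height_weight e \<in> borel_measurable borel"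
  unfolding height_weight_def by measurable

lemma height_weight_ge:
  assumes "e - (norm y)\<^sup>2 \<le> h" "2 / 3 \<le> h"
  shows "ennreal (1 / h) \<le> height_weight e y"
  using assms unfolding height_weight_def by (intro ennreal_leI divide_left_mono) auto

text \<open>The legs are \<open>d\<close> and \<open>W\<close>, the squared hypotenuse is
  \<open>e - 2 / 3\<close>. Points with the same \<open>s\<close> and \<open>x\<close> are matched
  with the tetrahedral triangle. The Jacobians are proportional, so it suffices that the squared
  height is pointwise at most the tetrahedral one.\<close>

lemma heavy_triangle:
  fixes u p :: "real \<times> real"
  assumes up: "norm u = 1" "norm p = 1" "u \<bullet> p = 0"
    and e: "e \<le> 1" and d: "0 < d" "e - 3 / 4 \<le> d\<^sup>2" and W: "0 < W" "d\<^sup>2 + W\<^sup>2 = e - 2 / 3"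
  shows "heavy (height_weight e) {y. 0 < y \<bullet> u \<and> y \<bullet> u < d \<and> 0 < y \<bullet> p \<and> (y \<bullet> p) * d < W * (y \<bullet> u)}"
    (is "heavy _ ?T")
proof -
  define R where "R = (\<lambda>y. (y \<bullet> u, y \<bullet> p))"
  have linR: "linear R" unfolding R_def by (rule linearI) (auto simp: inner_add_left)
  have normR: "norm (R y) = norm y" for y
  proof -
    have a: "fst u * fst u + snd u * snd u = 1" "fst p * fst p + snd p * snd p = 1"
      "fst u * fst p + snd u * snd p = 0"
      using up by (simp_all add: norm_eq_1 inner_prod_def)
    have "(y \<bullet> u)\<^sup>2 + (y \<bullet> p)\<^sup>2 = y \<bullet> y"
      using a unfolding inner_prod_def inner_real_def power2_eq_square by algebra
    thus ?thesis by (simp add: R_def norm_eq_sqrt_inner[of y] norm_Pair)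
  qed
  have [measurable]: "R \<in> borel_measurable borel"
    using linR by (simp add: borel_measurable_continuous_onI linear_continuous_on linear_conv_bounded_linear)
  let ?U = "{y. 0 < fst y \<and> fst y < d \<and> 0 < snd y \<and> snd y * d < W * fst y}"
  have [measurable]: "?U \<in> sets borel"
    by (intro borel_open open_Collect_conj open_Collect_less continuous_intros)
  have TT: "indicator ?T y = (indicator ?U (R y) :: ennreal)" for y
  proof -
    have "R y \<in> ?U \<longleftrightarrow> y \<in> ?T" by (simp add: R_def)
    thus ?thesis by (simp only: indicator_def)
  qed
  have T [measurable]: "?T \<in> sets borel"
    by (intro borel_open open_Collect_conj open_Collect_less continuous_intros)
  have rot: "(\<integral>\<^sup>+y. g (norm y) * indicator ?T y \<partial>lborel) = (\<integral>\<^sup>+y. g (norm y) * indicator ?U y \<partial>lborel)"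
    if [measurable]: "g \<in> borel_measurable borel" for g
  proof -
    have "(\<integral>\<^sup>+y. g (norm y) * indicator ?U y \<partial>lborel)
        = (\<integral>\<^sup>+y. g (norm y) * indicator ?U y \<partial>distr lborel borel R)"
      by (simp only: lborel_linear_isometry_plane[OF linR normR])
    also have "\<dots> = (\<integral>\<^sup>+y. g (norm y) * indicator ?T y \<partial>lborel)"
      unfolding TT by (subst nn_integral_distr) (auto simp: normR)
    finally show ?thesis ..
  qed
  have half: "(\<integral>\<^sup>+s. ennreal s * indicator {0<..<1} s \<partial>lborel) = ennreal (1 / 2)"
  proof -
    have "((\<lambda>s::real. s) has_integral (1\<^sup>2 / 2 - 0\<^sup>2 / 2)) {0..1}"
      by (rule fundamental_theorem_of_calculus)
         (auto intro!: derivative_eq_intros simp: has_real_derivative_iff_has_vector_derivative[symmetric])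
    from nn_integral_has_integral_lebesgue'[OF _ this] show ?thesis
      by (simp add: nn_integral_Icc_Ioo)
  qed
  have area: "emeasure lborel ?T = ennreal (d * W * (1 / 2))"
  proof -
    have "emeasure lborel ?T = (\<integral>\<^sup>+y. 1 * indicator ?T y \<partial>lborel)" by simp
    also have "\<dots> = (\<integral>\<^sup>+y. 1 * indicator ?U y \<partial>lborel)" by (rule rot) simp
    also have "\<dots> = ennreal (d * W) * (\<integral>\<^sup>+x. (\<integral>\<^sup>+s. ennreal s * 1 * indicator {0<..<1} s \<partial>lborel)
         * indicator {0<..<1::real} x \<partial>lborel)"
      using nn_integral_triangle[OF d(1) W(1), of "\<lambda>_. 1"] by simp
    also have "\<dots> = ennreal (d * W) * ennreal (1 / 2)"
      by (simp add: half nn_integral_cmult_indicator)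
    also have "\<dots> = ennreal (d * W * (1 / 2))" using d W by (intro ennreal_mult[symmetric]) auto
    finally show ?thesis .
  qed
  have "ennreal s0_series * emeasure lborel ?T = ennreal (s0_series * (d * W * (1 / 2)))"
    unfolding area using s0_series_bounds d W by (intro ennreal_mult[symmetric]) auto
  also have "s0_series * (d * W * (1 / 2)) = d * W * (s0_series / 2)" by simp
  also have "ennreal \<dots> = ennreal (d * W) * ennreal (s0_series / 2)"
    using s0_series_bounds d W by (intro ennreal_mult) auto
  also have "\<dots> = ennreal (d * W) * (\<integral>\<^sup>+x. (\<integral>\<^sup>+s. ennreal (s / (1 - s\<^sup>2 * (3 + x\<^sup>2) / 12)) * indicator {0<..<1} s \<partial>lborel)
      * indicator {0<..<1} x \<partial>lborel)"
    by (simp only: nn_integral_orthoscheme[symmetric] nn_integral_Icc_Ioo)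
  also have "\<dots> \<le> ennreal (d * W) * (\<integral>\<^sup>+x. (\<integral>\<^sup>+s. ennreal s * height_weight e (s * d, s * x * W) * indicator {0<..<1} s \<partial>lborel)
      * indicator {0<..<1} x \<partial>lborel)"
  proof (intro mult_left_mono nn_integral_mono)
    fix x :: real
    have pt: "ennreal (s / (1 - s\<^sup>2 * (3 + x\<^sup>2) / 12)) * indicator {0<..<1} s
      \<le> ennreal s * height_weight e (s * d, s * x * W) * indicator {0<..<1} s" if "x \<in> {0<..<1}" for s
    proof (cases "s \<in> {0<..<1}")
      case True
      have x2: "0 \<le> x\<^sup>2" "x\<^sup>2 \<le> 1" "0 \<le> s\<^sup>2" "s\<^sup>2 \<le> 1" using that True by (auto simp: power_le_one)
      have "s\<^sup>2 * (3 + x\<^sup>2) \<le> 1 * 4" using x2 by (intro mult_mono) auto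
      hence h: "2 / 3 \<le> 1 - s\<^sup>2 * (3 + x\<^sup>2) / 12" by simp
      \<comment> \<open>Convex combination of the squared legs' end values \<open>d\<^sup>2\<close>
        and \<open>d\<^sup>2 + W\<^sup>2\<close>: this is where the bounds \<open>3 / 4\<close> and
        \<open>2 / 3\<close> enter.\<close>
      have "(norm (s * d, s * x * W))\<^sup>2 = s\<^sup>2 * (d\<^sup>2 * (1 - x\<^sup>2) + (d\<^sup>2 + W\<^sup>2) * x\<^sup>2)"
        by (simp add: norm_Pair power_mult_distrib algebra_simps)
      also have "\<dots> \<ge> s\<^sup>2 * ((e - 3 / 4) * (1 - x\<^sup>2) + (e - 2 / 3) * x\<^sup>2)"
        unfolding W(2) using x2 d by (intro mult_left_mono add_mono mult_right_mono) auto
      finally have "e - (norm (s * d, s * x * W))\<^sup>2 \<le> e * (1 - s\<^sup>2) + s\<^sup>2 * (3 / 4 - x\<^sup>2 / 12)"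
        by (simp add: field_simps)
      also have "\<dots> \<le> 1 * (1 - s\<^sup>2) + s\<^sup>2 * (3 / 4 - x\<^sup>2 / 12)"
        using e x2 by (intro add_mono mult_right_mono) auto
      also have "\<dots> = 1 - s\<^sup>2 * (3 + x\<^sup>2) / 12" by (simp add: algebra_simps)
      finally have "ennreal (1 / (1 - s\<^sup>2 * (3 + x\<^sup>2) / 12)) \<le> height_weight e (s * d, s * x * W)"
        using h by (intro height_weight_ge)
      hence "ennreal s * ennreal (1 / (1 - s\<^sup>2 * (3 + x\<^sup>2) / 12)) \<le> ennreal s * height_weight e (s * d, s * x * W)"
        by (intro mult_left_mono) auto
      thus ?thesis using True h by (simp add: ennreal_mult[symmetric])
    qed auto
    show "(\<integral>\<^sup>+s. ennreal (s / (1 - s\<^sup>2 * (3 + x\<^sup>2) / 12)) * indicator {0<..<1} s \<partial>lborel) * indicator {0<..<1} x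
      \<le> (\<integral>\<^sup>+s. ennreal s * height_weight e (s * d, s * x * W) * indicator {0<..<1} s \<partial>lborel) * indicator {0<..<1} x"
    proof (cases "x \<in> {0<..<1}")
      case True
      show ?thesis by (intro mult_right_mono nn_integral_mono pt True) auto
    qed auto
  qed auto
  also have "\<dots> = (\<integral>\<^sup>+y. height_weight e y * indicator ?U y \<partial>lborel)"
    by (rule nn_integral_triangle[symmetric]) (use d W in auto)
  also have "\<dots> = (\<integral>\<^sup>+y. height_weight e y * indicator ?T y \<partial>lborel)"
    unfolding height_weight_def by (rule rot[symmetric]) measurable
  finally show ?thesis by (simp add: heavy_def)
qed


text \<open>
  Comparing \<open>\<Omega> \<inter> ball 0 \<rho>\<close> with its image under a contraction bounds the mean of \<open>|y|\<^sup>2\<close> over it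
  from below by almost \<open>\<rho>\<^sup>2 / 2\<close>; the claim follows from the tangent of the convex function
  \<open>u \<mapsto> 1 / (e - u)\<close> at this mean.
\<close>

lemma heavy_sector:
  fixes \<Omega> :: "(real \<times> real) set"
  assumes [measurable]: "\<Omega> \<in> sets borel" and cone: "\<And>c y. c > 0 \<Longrightarrow> y \<in> \<Omega> \<Longrightarrow> c *\<^sub>R y \<in> \<Omega>"
    and e: "2 / 3 < e" "e \<le> 1" and \<rho>: "0 < \<rho>" "\<rho>\<^sup>2 = e - 2 / 3"
  shows "heavy (height_weight e) (\<Omega> \<inter> ball 0 \<rho>)"
proof -
  define A where "A = \<Omega> \<inter> ball 0 \<rho>"
  \<comment> \<open>Area scales by \<open>19 / 20\<close> and the second moment by its square, and
    the ring left over has a twentieth of the area at squared distance at least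
    \<open>19 / 20 * \<rho>\<^sup>2\<close>. Solving for the second moment bounds the mean below by
    \<open>19 / 39 * \<rho>\<^sup>2\<close>.\<close>
  define l where "l = sqrt (19 / 20 :: real)"
  have l: "0 < l" "l\<^sup>2 = 19 / 20" "l < 1" by (auto simp: l_def real_less_lsqrt)
  define A' where "A' = \<Omega> \<inter> ball 0 (l * \<rho>)"
  have [measurable]: "A \<in> sets borel" "A' \<in> sets borel" by (auto simp: A_def A'_def)
  have lr: "l * \<rho> < \<rho>" using l \<rho> by simp
  have A'A: "A' \<subseteq> A" using lr by (auto simp: A_def A'_def)
  have inA': "l *\<^sub>R y \<in> A' \<longleftrightarrow> y \<in> A" for y
  proof -
    have "l *\<^sub>R y \<in> \<Omega> \<longleftrightarrow> y \<in> \<Omega>"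
      using cone[OF l(1), of y] cone[of "1 / l" "l *\<^sub>R y"] l by auto
    thus ?thesis using l by (simp add: A_def A'_def)
  qed
  have finA: "emeasure lborel B < \<infinity>" if "B \<subseteq> A" for B
    using that by (intro emeasure_bounded_finite bounded_subset[of "ball 0 \<rho>" B]) (auto simp: A_def)
  define \<mu> where "\<mu> = measure lborel A"
  have emA: "emeasure lborel A = ennreal \<mu>" "0 \<le> \<mu>"
    using finA[of A] by (auto simp: \<mu>_def emeasure_eq_ennreal_measure)
  have emA': "emeasure lborel A' = ennreal (19 / 20 * \<mu>)"
  proof -
    have "emeasure lborel A' = (\<integral>\<^sup>+y. indicator A' y \<partial>lborel)" by simp
    also have "\<dots> = ennreal (l ^ 2) * (\<integral>\<^sup>+y. indicator A' (l *\<^sub>R y) \<partial>lborel)"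
      using l by (subst nn_integral_lborel_scale[of _ l]) (auto simp: power2_eq_square)
    also have "(\<lambda>y. indicator A' (l *\<^sub>R y) :: ennreal) = indicator A"
      by (auto simp: indicator_def inA' fun_eq_iff)
    also have "(\<integral>\<^sup>+y. indicator A y \<partial>lborel) = ennreal \<mu>" using emA by simp
    also have "ennreal (l\<^sup>2) * ennreal \<mu> = ennreal (l\<^sup>2 * \<mu>)" using emA by (intro ennreal_mult[symmetric]) auto
    finally show ?thesis using l by simp
  qed
  define I where "I = (\<integral>\<^sup>+y. ennreal ((norm y)\<^sup>2) * indicator A y \<partial>lborel)"
  have I': "(\<integral>\<^sup>+y. ennreal ((norm y)\<^sup>2) * indicator A' y \<partial>lborel) = ennreal ((19 / 20)\<^sup>2) * I"
  proof -
    have "(\<integral>\<^sup>+y. ennreal ((norm y)\<^sup>2) * indicator A' y \<partial>lborel)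
      = ennreal (l ^ 2) * (\<integral>\<^sup>+y. ennreal ((norm (l *\<^sub>R y))\<^sup>2) * indicator A' (l *\<^sub>R y) \<partial>lborel)"
      using l by (subst nn_integral_lborel_scale[of _ l]) (auto simp: power2_eq_square)
    also have "(\<lambda>y. ennreal ((norm (l *\<^sub>R y))\<^sup>2) * indicator A' (l *\<^sub>R y))
        = (\<lambda>y. ennreal (19 / 20) * (ennreal ((norm y)\<^sup>2) * indicator A y))"
      using l by (auto simp: indicator_def inA' fun_eq_iff power_mult_distrib ennreal_mult[symmetric])
    also have "ennreal (l ^ 2) * (\<integral>\<^sup>+y. ennreal (19 / 20) * (ennreal ((norm y)\<^sup>2) * indicator A y) \<partial>lborel)
        = ennreal ((19 / 20)\<^sup>2) * I"
    proof -
      have "ennreal (l ^ 2) * ennreal (19 / 20) = ennreal ((19 / 20)\<^sup>2)"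
        unfolding l(2) unfolding power2_eq_square by (intro ennreal_mult[symmetric]) auto
      thus ?thesis by (subst nn_integral_cmult) (auto simp: I_def mult.assoc[symmetric])
    qed
    finally show ?thesis .
  qed
  have "I \<le> (\<integral>\<^sup>+y. ennreal (\<rho>\<^sup>2) * indicator A y \<partial>lborel)"
    unfolding I_def by (intro nn_integral_mono) (auto simp: A_def indicator_def intro!: ennreal_leI power_mono)
  also have "\<dots> = ennreal (\<rho>\<^sup>2 * \<mu>)" using emA by (simp add: nn_integral_cmult_indicator ennreal_mult)
  finally have "I < \<infinity>" using ennreal_less_top by (metis infinity_ennreal_def order_le_less_trans)
  then obtain J where J: "I = ennreal J" "0 \<le> J" by (cases I) auto
  have "ennreal ((19 / 20)\<^sup>2 * J + 19 / 20 * \<rho>\<^sup>2 * (\<mu> / 20)) \<le> ennreal J"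
  proof -
    have diff: "emeasure lborel (A - A') = ennreal (\<mu> / 20)"
    proof -
      have "emeasure lborel (A - A') = emeasure lborel A - emeasure lborel A'"
        using A'A finA[of A'] by (intro emeasure_Diff) auto
      also have "\<dots> = ennreal (\<mu> - 19 / 20 * \<mu>)"
        unfolding emA emA' using emA by (subst ennreal_minus) auto
      finally show ?thesis by simp
    qed
    have "ennreal ((19 / 20)\<^sup>2 * J + 19 / 20 * \<rho>\<^sup>2 * (\<mu> / 20))
      = (\<integral>\<^sup>+y. ennreal ((norm y)\<^sup>2) * indicator A' y \<partial>lborel) + (\<integral>\<^sup>+y. ennreal (19 / 20 * \<rho>\<^sup>2) * indicator (A - A') y \<partial>lborel)"
      unfolding I' J using J emA diff by (simp add: nn_integral_cmult_indicator ennreal_mult[symmetric] ennreal_plus)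
    also have "\<dots> = (\<integral>\<^sup>+y. ennreal ((norm y)\<^sup>2) * indicator A' y + ennreal (19 / 20 * \<rho>\<^sup>2) * indicator (A - A') y \<partial>lborel)"
      by (intro nn_integral_add[symmetric]) auto
    also have "\<dots> \<le> I" unfolding I_def
    proof (intro nn_integral_mono)
      fix y
      show "ennreal ((norm y)\<^sup>2) * indicator A' y + ennreal (19 / 20 * \<rho>\<^sup>2) * indicator (A - A') y
        \<le> ennreal ((norm y)\<^sup>2) * indicator A y"
      proof (cases "y \<in> A - A'")
        case True
        hence "l * \<rho> \<le> norm y" by (auto simp: A_def A'_def)
        hence "(l * \<rho>)\<^sup>2 \<le> (norm y)\<^sup>2" using l \<rho> by (intro power_mono) auto
        thus ?thesis using True l by (auto simp: power_mult_distrib intro!: ennreal_leI)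
      qed (use A'A in \<open>auto simp: indicator_def\<close>)
    qed
    finally show ?thesis by (simp add: J)
  qed
  hence "(19 / 20)\<^sup>2 * J + 19 / 20 * \<rho>\<^sup>2 * (\<mu> / 20) \<le> J" using J by (simp add: ennreal_le_iff)
  hence Jlow: "19 / 39 * \<rho>\<^sup>2 * \<mu> \<le> J" by (simp add: power2_eq_square field_simps)
  define u where "u = 19 / 39 * \<rho>\<^sup>2"
  have ueq: "u = 19 / 39 * e - 38 / 117" unfolding u_def \<rho>(2) by argo
  have u: "0 < u" "e - u \<le> 98 / 117" using e by (auto simp: ueq)
  moreover have "2 * u < e" "u < e" using e by (auto simp: ueq)
  ultimately have u: "0 < u" "e - u \<le> 98 / 117" "0 < e - 2 * u" "0 < e - u" by auto
  \<comment> \<open>\<open>\<alpha> + \<beta> * v\<close> is the tangent of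
    \<open>1 / (e - v)\<close> at \<open>v = u\<close>. Its value there is at least
    \<open>117 / 98\<close>, with equality for \<open>e = 1\<close>.\<close>
  define \<alpha> \<beta> where "\<alpha> = (e - 2 * u) / (e - u)\<^sup>2" and "\<beta> = 1 / (e - u)\<^sup>2"
  have \<alpha>\<beta>: "0 \<le> \<alpha>" "0 \<le> \<beta>" using u by (auto simp: \<alpha>_def \<beta>_def)
  have "s0_series * \<mu> \<le> 1 / (e - u) * \<mu>"
  proof (intro mult_right_mono)
    have "117 / 98 \<le> 1 / (e - u)" using u by (simp add: field_simps)
    thus "s0_series \<le> 1 / (e - u)" using s0_series_bounds by linarith
  qed (use emA in auto)
  also have "1 / (e - u) = \<alpha> + \<beta> * u"
  proof -
    have "\<alpha> + \<beta> * u = (e - u) / (e - u)\<^sup>2" by (simp add: \<alpha>_def \<beta>_def add_divide_distrib[symmetric])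
    thus ?thesis using u by (simp add: power2_eq_square)
  qed
  also have "(\<alpha> + \<beta> * u) * \<mu> \<le> \<alpha> * \<mu> + \<beta> * J"
    using mult_left_mono[OF Jlow \<alpha>\<beta>(2)] by (simp add: u_def algebra_simps)
  finally have "s0_series * \<mu> \<le> \<alpha> * \<mu> + \<beta> * J" .
  hence "ennreal s0_series * emeasure lborel A \<le> ennreal (\<alpha> * \<mu> + \<beta> * J)"
    using s0_series_bounds emA by (simp add: ennreal_mult[symmetric] ennreal_leI)
  also have "\<dots> = (\<integral>\<^sup>+y. ennreal \<alpha> * indicator A y \<partial>lborel) + (\<integral>\<^sup>+y. ennreal \<beta> * (ennreal ((norm y)\<^sup>2) * indicator A y) \<partial>lborel)"
    using \<alpha>\<beta> emA J by (simp add: nn_integral_cmult nn_integral_cmult_indicator I_def[symmetric] ennreal_mult ennreal_plus)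
  also have "\<dots> = (\<integral>\<^sup>+y. ennreal \<alpha> * indicator A y + ennreal \<beta> * (ennreal ((norm y)\<^sup>2) * indicator A y) \<partial>lborel)"
    by (intro nn_integral_add[symmetric]) auto
  also have "\<dots> \<le> (\<integral>\<^sup>+y. height_weight e y * indicator A y \<partial>lborel)"
  proof (intro nn_integral_mono)
    fix y :: "real \<times> real"
    show "ennreal \<alpha> * indicator A y + ennreal \<beta> * (ennreal ((norm y)\<^sup>2) * indicator A y) \<le> height_weight e y * indicator A y"
    proof (cases "y \<in> A")
      case True
      define v where "v = (norm y)\<^sup>2"
      have v: "0 \<le> v" "v < \<rho>\<^sup>2"
        unfolding v_def using True \<rho>(1) by (auto simp: A_def simp del: \<rho>(2) intro!: power_strict_mono)
      hence ev: "2 / 3 < e - v" using \<rho> by simp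
      have "(\<alpha> + \<beta> * v) * (e - v) = (e - 2 * u + v) * (e - v) / (e - u)\<^sup>2"
        by (simp add: \<alpha>_def \<beta>_def add_divide_distrib[symmetric])
      also have "(e - 2 * u + v) * (e - v) = (e - u)\<^sup>2 - (u - v)\<^sup>2" by (simp add: algebra_simps power2_eq_square)
      also have "\<dots> / (e - u)\<^sup>2 = 1 - (u - v)\<^sup>2 / (e - u)\<^sup>2" using u by (simp add: diff_divide_distrib)
      finally have "(\<alpha> + \<beta> * v) * (e - v) = 1 - (u - v)\<^sup>2 / (e - u)\<^sup>2" .
      hence "(\<alpha> + \<beta> * v) * (e - v) \<le> 1" by simp
      hence "\<alpha> + \<beta> * v \<le> 1 / (e - v)" using ev by (simp add: field_simps)
      hence "ennreal \<alpha> + ennreal \<beta> * ennreal v \<le> ennreal (1 / (e - v))"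
        using \<alpha>\<beta> v by (simp add: ennreal_mult[symmetric] ennreal_plus[symmetric] ennreal_leI del: ennreal_plus)
      also have "\<dots> \<le> height_weight e y" using ev by (intro height_weight_ge) (auto simp: v_def)
      finally show ?thesis using True by (simp add: v_def)
    qed auto
  qed
  finally show ?thesis by (simp add: heavy_def A_def)
qed

section \<open>The cell of a single centre\<close>

definition perp :: "real \<times> real \<Rightarrow> real \<times> real" where
  "perp u = (- snd u, fst u)"

lemma inner_perp_self [simp]: "u \<bullet> perp u = 0" "perp u \<bullet> u = 0"
  by (simp_all add: perp_def inner_prod_def)

lemma norm_perp [simp]: "norm (perp u) = norm u"
  by (simp add: perp_def norm_prod_def add.commute)

lemma orthogonal_to_unit:
  fixes n u :: "real \<times> real"
  assumes "norm u = 1" "n \<bullet> u = 0"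
  shows "n \<bullet> y = (n \<bullet> perp u) * (y \<bullet> perp u)"
proof -
  have "fst u * fst u + snd u * snd u = 1" "fst n * fst u + snd n * snd u = 0"
    using assms by (simp_all add: norm_eq_1 inner_prod_def)
  thus ?thesis unfolding inner_prod_def perp_def fst_conv snd_conv inner_real_def by algebra
qed

text \<open>
  The cell of a point of weight \<open>e\<close> at the origin. \<open>K\<close> lists the other centres with their weights
  (among them the mirror images of the origin in the sides not passing through it) and \<open>M\<close> the
  normals of the sides passing through the origin. Within distance \<open>\<rho>\<close>, \<open>\<rho>\<^sup>2 = e - 2 / 3\<close>, the edges of
  the cell cut disjoint caps from the disc; the sectors over these caps are the isosceles triangles
  treated in \<open>heavy_triangle\<close>, the rest of the disc is treated in \<open>heavy_sector\<close>.
\<close>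

lemma heavy_cell:
  fixes K :: "((real \<times> real) \<times> real) set" and M :: "(real \<times> real) set"
  assumes fin: "finite K" "finite M" and e: "0 < e" "e \<le> 1"
    and K1: "\<And>z \<epsilon>. (z, \<epsilon>) \<in> K \<Longrightarrow> 0 < \<epsilon> \<and> \<epsilon> \<le> 1 \<and> e * \<epsilon> \<le> (norm z)\<^sup>2"
    and K2: "\<And>z \<epsilon> z' \<epsilon>'. (z, \<epsilon>) \<in> K \<Longrightarrow> (z', \<epsilon>') \<in> K \<Longrightarrow> (z, \<epsilon>) \<noteq> (z', \<epsilon>') \<Longrightarrow> \<epsilon> * \<epsilon>' \<le> (norm (z - z'))\<^sup>2"
    and M1: "\<And>n. n \<in> M \<Longrightarrow> norm n = 1"
    and KM: "\<And>z \<epsilon> n. (z, \<epsilon>) \<in> K \<Longrightarrow> n \<in> M \<Longrightarrow> n \<bullet> z = 0 \<or> n \<bullet> z \<le> - \<epsilon> / 2"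
  shows "heavy (height_weight e)
    {y. (\<forall>n\<in>M. n \<bullet> y < 0) \<and> (\<forall>(z, \<epsilon>)\<in>K. 2 * (y \<bullet> z) < (norm z)\<^sup>2 + e - \<epsilon>)}" (is "heavy _ ?C")
proof -
  define C where "C = ?C"
  have C_eq: "C = (\<Inter>n\<in>M. {y. n \<bullet> y < 0}) \<inter> (\<Inter>k\<in>K. {y. 2 * (y \<bullet> fst k) < (norm (fst k))\<^sup>2 + e - snd k})"
    unfolding C_def by (intro set_eqI) (simp add: case_prod_beta)
  have "open C" unfolding C_eq using fin
    by (intro open_Int open_INT ballI open_Collect_less continuous_intros) auto
  hence [measurable]: "C \<in> sets borel" by (rule borel_open)
  have znz: "norm z > 0" if "(z, \<epsilon>) \<in> K" for z \<epsilon>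
  proof -
    have "0 < e * \<epsilon>" using K1[OF that] e by simp
    hence "0 < (norm z)\<^sup>2" using K1[OF that] by linarith
    thus ?thesis by simp
  qed
  \<comment> \<open>In two cases a pointwise bound suffices: all heights are small, or the origin is
    not strictly on its own side of some radical line, and then squared heights in the cell are at
    most \<open>3 / 4\<close>. In the third case \<open>\<rho>\<close> exists and every radical line
    has positive distance from the origin.\<close>
  consider "e \<le> 5 / 6" | z \<epsilon> where "(z, \<epsilon>) \<in> K" "(norm z)\<^sup>2 + e - \<epsilon> \<le> 0"
    | "5 / 6 < e" "\<And>z \<epsilon>. (z, \<epsilon>) \<in> K \<Longrightarrow> 0 < (norm z)\<^sup>2 + e - \<epsilon>"
    by fastforce
  hence "heavy (height_weight e) C"
  proof cases
    case 1
    show ?thesis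
    proof (rule heavy_const)
      fix y :: "real \<times> real"
      have "e - (norm y)\<^sup>2 \<le> e" by simp
      hence "e - (norm y)\<^sup>2 \<le> 5 / 6" using 1 by linarith
      hence "ennreal (1 / (5 / 6)) \<le> height_weight e y" by (intro height_weight_ge) auto
      thus "ennreal (6 / 5) \<le> height_weight e y" by simp
    qed (use s0_series_bounds in auto)
  next
    case (2 z \<epsilon>)
    show ?thesis
    proof (rule heavy_const)
      fix y assume "y \<in> C"
      hence y: "2 * (y \<bullet> z) < (norm z)\<^sup>2 + e - \<epsilon>" using 2(1) unfolding C_def by fast
      let ?D = "(norm z)\<^sup>2 + e - \<epsilon>"
      have "(?D / 2)\<^sup>2 \<le> (y \<bullet> z)\<^sup>2" using y 2 by (subst abs_le_square_iff[symmetric]) auto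
      also have "\<dots> \<le> (norm y)\<^sup>2 * (norm z)\<^sup>2"
        using Cauchy_Schwarz_ineq[of y z] by (simp add: power2_norm_eq_inner)
      finally have "?D\<^sup>2 / (4 * (norm z)\<^sup>2) \<le> (norm y)\<^sup>2"
        using znz[OF 2(1)] by (simp add: field_simps power_divide)
      moreover have "e - ?D\<^sup>2 / (4 * (norm z)\<^sup>2) \<le> 3 / 4"
        using K1[OF 2(1)] znz[OF 2(1)] e by (intro bisector_height_le) auto
      ultimately have "ennreal (1 / (3 / 4)) \<le> height_weight e y"
        by (intro height_weight_ge) auto
      thus "ennreal (4 / 3) \<le> height_weight e y" by simp
    qed (use s0_series_bounds in auto)
  next
    case 3
    define \<rho> where "\<rho> = sqrt (e - 2 / 3)"
    have \<rho>: "0 < \<rho>" "\<rho>\<^sup>2 = e - 2 / 3" using 3 by (auto simp: \<rho>_def)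
    define u where "u = (\<lambda>k :: (real \<times> real) \<times> real. sgn (fst k))"
    \<comment> \<open>\<open>d k\<close> is the distance from the origin to the radical line of
      \<open>k\<close>, \<open>L\<close> collects the lines that meet the disc of radius
      \<open>\<rho>\<close>, and \<open>cone k\<close> is the open cone over the cap cut
      off.\<close>
    define d where "d = (\<lambda>k :: (real \<times> real) \<times> real. ((norm (fst k))\<^sup>2 + e - snd k) / (2 * norm (fst k)))"
    define L where "L = {k \<in> K. d k < \<rho>}"
    define cone where "cone = (\<lambda>k. {y. d k * norm y < \<rho> * (y \<bullet> u k)})"
    have finL: "finite L" using fin by (simp add: L_def)
    have u1: "norm (u k) = 1" if "k \<in> K" for k
      using znz[of "fst k" "snd k"] that by (simp add: u_def norm_sgn)
    have zu: "fst k = norm (fst k) *\<^sub>R u k" for k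
      by (cases "fst k = 0") (simp_all add: u_def sgn_div_norm)
    have dpos: "0 < d k" if "k \<in> K" for k
      using znz[of "fst k" "snd k"] 3(2)[of "fst k" "snd k"] that by (simp add: d_def)
    have dineq: "2 * (y \<bullet> fst k) < (norm (fst k))\<^sup>2 + e - snd k \<longleftrightarrow> y \<bullet> u k < d k" if "k \<in> K" for k y
    proof -
      have "2 * (y \<bullet> fst k) = 2 * (norm (fst k) * (y \<bullet> u k))" by (subst zu) simp
      thus ?thesis using znz[of "fst k" "snd k"] that by (simp add: d_def field_simps)
    qed
    have dlow: "e - 3 / 4 \<le> (d k)\<^sup>2" if "k \<in> K" for k
    proof -
      have "e - ((norm (fst k))\<^sup>2 + e - snd k)\<^sup>2 / (4 * (norm (fst k))\<^sup>2) \<le> 3 / 4"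
        using K1[of "fst k" "snd k"] znz[of "fst k" "snd k"] that e by (intro bisector_height_le) auto
      thus ?thesis by (simp add: d_def power_divide power_mult_distrib)
    qed
    have cone_scale: "c *\<^sub>R y \<in> cone k \<longleftrightarrow> y \<in> cone k" if "c > 0" for c y k
    proof -
      have "d k * norm (c *\<^sub>R y) < \<rho> * ((c *\<^sub>R y) \<bullet> u k) \<longleftrightarrow> c * (d k * norm y) < c * (\<rho> * (y \<bullet> u k))"
        using that by (simp add: mult_ac)
      also have "\<dots> \<longleftrightarrow> d k * norm y < \<rho> * (y \<bullet> u k)" using that by simp
      finally show ?thesis by (simp add: cone_def)
    qed
    have cone_add: "y + y' \<in> cone k" if "y \<in> cone k" "y' \<in> cone k" "k \<in> K" for y y' k
    proof -
      have "d k * norm (y + y') \<le> d k * norm y + d k * norm y'"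
        using norm_triangle_ineq[of y y'] dpos[OF that(3)] by (simp add: distrib_left[symmetric])
      thus ?thesis using that by (simp add: cone_def inner_add_left distrib_left)
    qed
    have u_cone: "u k \<in> cone k" if "k \<in> L" for k
      using that u1[of k] by (simp add: L_def cone_def dot_square_norm)
    \<comment> \<open>At distance \<open>\<rho>\<close> the power with respect to the origin is
      exactly \<open>2 / 3\<close>; beyond the radical line the power with respect to
      \<open>k\<close> is larger.\<close>
    have cone_near: "(norm (fst k - y))\<^sup>2 < snd k - 2 / 3" if "k \<in> K" "y \<in> cone k" "norm y = \<rho>" for k y
    proof -
      have "d k < y \<bullet> u k" using that \<rho> by (simp add: cone_def)
      hence "d k * (2 * norm (fst k)) < (y \<bullet> u k) * (2 * norm (fst k))"
        using znz[of "fst k" "snd k"] that by simp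
      moreover have "2 * (y \<bullet> fst k) = (y \<bullet> u k) * (2 * norm (fst k))" by (subst zu) simp
      moreover have "d k * (2 * norm (fst k)) = (norm (fst k))\<^sup>2 + e - snd k"
        using znz[of "fst k" "snd k"] that by (simp add: d_def)
      moreover have "(norm (fst k - y))\<^sup>2 = (norm (fst k))\<^sup>2 - 2 * (y \<bullet> fst k) + \<rho>\<^sup>2"
        unfolding that(3)[symmetric] power2_norm_eq_inner
        by (simp add: inner_diff_left inner_diff_right inner_commute)
      ultimately show ?thesis using \<rho> by simp
    qed
    have cone_norm: "(\<rho> / norm y) *\<^sub>R y \<in> cone k" "norm ((\<rho> / norm y) *\<^sub>R y) = \<rho>" if "y \<in> cone k" for y k
    proof -
      have "y \<noteq> 0" using that by (auto simp: cone_def)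
      thus "(\<rho> / norm y) *\<^sub>R y \<in> cone k" "norm ((\<rho> / norm y) *\<^sub>R y) = \<rho>"
        using that \<rho> by (simp_all add: cone_scale)
    qed
    \<comment> \<open>A common direction, scaled to length \<open>\<rho>\<close>, would give a point
      with three powers of at least \<open>2 / 3\<close>.\<close>
    have cone_disj: "cone k \<inter> cone k' = {}" if k: "k \<in> K" "k' \<in> K" "k \<noteq> k'" for k k'
    proof (rule ccontr)
      assume "cone k \<inter> cone k' \<noteq> {}"
      then obtain y0 where "y0 \<in> cone k" "y0 \<in> cone k'" by auto
      then obtain y where y: "y \<in> cone k" "y \<in> cone k'" "norm y = \<rho>" using cone_norm by blast
      show False
      proof (rule three_powers_contradiction[of e "snd k" "snd k'" "- y" "fst k - y" "fst k' - y"])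
        show "(norm (fst k - y))\<^sup>2 < snd k - 2 / 3" "(norm (fst k' - y))\<^sup>2 < snd k' - 2 / 3"
          using cone_near k y by auto
        show "snd k * snd k' \<le> (norm (fst k - y - (fst k' - y)))\<^sup>2"
          using K2[of "fst k" "snd k" "fst k'" "snd k'"] k by (auto simp: prod_eq_iff)
      qed (use e y \<rho> K1[of "fst k" "snd k"] K1[of "fst k'" "snd k'"] k in auto)
    qed
    \<comment> \<open>Suppose a side through the origin but not through the centre of
      \<open>k\<close> met the cone. At a common point of length \<open>\<rho>\<close> that centre
      and its mirror image, at least \<open>snd k\<close> apart, would compete with the origin:
      three powers again. By convexity the cone stays on the side of its axis.\<close>
    have cone_side: "n \<bullet> y < 0" if k: "k \<in> L" and n: "n \<in> M" "n \<bullet> fst k \<noteq> 0" and y: "y \<in> cone k" for k n y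
    proof -
      have kK: "k \<in> K" using k by (simp add: L_def)
      have nz: "n \<bullet> fst k \<le> - snd k / 2" using KM[of "fst k" "snd k" n] kK n by auto
      have no: "n \<bullet> w \<noteq> 0" if w: "w \<in> cone k" for w
      proof
        assume "n \<bullet> w = 0"
        define y where "y = (\<rho> / norm w) *\<^sub>R w"
        have y: "y \<in> cone k" "norm y = \<rho>" "n \<bullet> y = 0"
          using cone_norm[OF w] \<open>n \<bullet> w = 0\<close> by (auto simp: y_def)
        define z' where "z' = fst k - (2 * (n \<bullet> fst k)) *\<^sub>R n"
        have nn: "n \<bullet> n = 1" using M1[OF n(1)] by (simp add: norm_eq_1)
        have refl: "(norm (z' - y))\<^sup>2 = (norm (fst k - y))\<^sup>2"
          using y(3) nn unfolding z'_def power2_norm_eq_inner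
          by (simp add: inner_diff_left inner_diff_right inner_commute algebra_simps)
        have refl0: "(norm z')\<^sup>2 = (norm (fst k))\<^sup>2"
          using nn unfolding z'_def power2_norm_eq_inner
          by (simp add: inner_diff_left inner_diff_right inner_commute algebra_simps)
        show False
        proof (rule three_powers_contradiction[of e "snd k" "snd k" "- y" "fst k - y" "z' - y"])
          show "(norm (fst k - y))\<^sup>2 < snd k - 2 / 3" "(norm (z' - y))\<^sup>2 < snd k - 2 / 3"
            unfolding refl using cone_near kK y by auto
          have "snd k \<le> norm (fst k - z')"
            using nz M1[OF n(1)] by (simp add: z'_def)
          hence "(snd k)\<^sup>2 \<le> (norm (fst k - z'))\<^sup>2"
            using K1[of "fst k" "snd k"] kK by (intro power_mono) auto
          thus "snd k * snd k \<le> (norm (fst k - y - (z' - y)))\<^sup>2"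
            by (simp add: power2_eq_square)
        qed (use e y \<rho> refl0 K1[of "fst k" "snd k"] kK in auto)
      qed
      have nu: "n \<bullet> u k < 0"
      proof -
        have "n \<bullet> fst k < 0" using nz K1[of "fst k" "snd k"] kK by auto
        hence "norm (fst k) * (n \<bullet> u k) < 0" by (subst (asm) zu) simp
        thus ?thesis using znz[of "fst k" "snd k"] kK by (simp add: mult_less_0_iff)
      qed
      show ?thesis
      proof (rule ccontr)
        assume "\<not> n \<bullet> y < 0"
        hence ny: "n \<bullet> y > 0" using no[OF y] by auto
        have "(n \<bullet> y) *\<^sub>R u k + (- (n \<bullet> u k)) *\<^sub>R y \<in> cone k"
          using ny nu y u_cone[OF k] kK by (intro cone_add) (simp_all add: cone_scale del: scaleR_minus_left)
        from no[OF this] show False by (simp add: inner_diff_right mult.commute)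
      qed
    qed
    define hc where "hc = (\<lambda>k \<sigma>::real. {y \<in> cone k. 0 < y \<bullet> (\<sigma> *\<^sub>R perp (u k))})"
    define T where "T = (\<lambda>k \<sigma>. {y \<in> hc k \<sigma>. y \<bullet> u k < d k})"
    define Sec where "Sec = {y. \<forall>n\<in>M. n \<bullet> y < 0}"
    define \<Omega> where "\<Omega> = Sec - (\<Union>k\<in>L. cone k)"
    define G where "G = {(k, \<sigma>) \<in> L \<times> {1, -1}. hc k \<sigma> \<subseteq> Sec}"
    \<comment> \<open>A side that fails on a half cone contains the axis, by
      \<open>cone_side\<close>, and hence excludes the whole half. So each half cone lies entirely
      inside or entirely outside \<open>Sec\<close>; this is why the caps are halved.\<close>
    have bad: "y \<notin> Sec" if k: "k \<in> L" "\<sigma> \<in> {1, -1}" and ng: "\<not> hc k \<sigma> \<subseteq> Sec" and y: "y \<in> hc k \<sigma>" for k \<sigma> y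
    proof -
      obtain y0 n where y0: "y0 \<in> hc k \<sigma>" "n \<in> M" "n \<bullet> y0 \<ge> 0"
        using ng unfolding Sec_def subset_iff mem_Collect_eq not_less[symmetric] by blast
      have "n \<bullet> fst k = 0" using cone_side[OF k(1) y0(2), of y0] y0 by (auto simp: hc_def)
      hence "n \<bullet> u k = 0" by (simp add: u_def sgn_div_norm)
      hence nf: "n \<bullet> w = (n \<bullet> perp (u k)) * (w \<bullet> perp (u k))" for w
        using u1[of k] k by (intro orthogonal_to_unit) (auto simp: L_def)
      have "0 \<le> n \<bullet> y"
      proof (cases "\<sigma> = 1")
        case True
        hence "0 < y0 \<bullet> perp (u k)" "0 < y \<bullet> perp (u k)" using y0 y by (auto simp: hc_def)
        with y0(3) show ?thesis unfolding nf[of y] nf[of y0] by (auto simp: zero_le_mult_iff)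
      next
        case False
        hence "y0 \<bullet> perp (u k) < 0" "y \<bullet> perp (u k) < 0" using y0 y k by (auto simp: hc_def)
        with y0(3) show ?thesis unfolding nf[of y] nf[of y0] by (auto simp: zero_le_mult_iff)
      qed
      thus ?thesis using y0(2) unfolding Sec_def mem_Collect_eq not_less[symmetric] by blast
    qed
    have near: "y \<bullet> u k < d k" if "k \<in> K" "norm y < \<rho>" "y \<notin> cone k" for y k
    proof -
      have "\<rho> * (y \<bullet> u k) \<le> d k * norm y" using that by (simp add: cone_def not_less)
      also have "\<dots> < d k * \<rho>" using that dpos by simp
      finally show ?thesis using \<rho> by (simp add: mult.commute)
    qed
    have far: "y \<bullet> u k < d k" if "k \<in> K" "k \<notin> L" "norm y < \<rho>" for y k
    proof -
      have "y \<bullet> u k \<le> norm y * norm (u k)" by (rule norm_cauchy_schwarz)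
      thus ?thesis using that u1[of k] by (simp add: L_def)
    qed
    have inC: "y \<in> C \<longleftrightarrow> y \<in> Sec \<and> (\<forall>k\<in>K. y \<bullet> u k < d k)" for y
    proof -
      have "(\<forall>k\<in>K. 2 * (y \<bullet> fst k) < (norm (fst k))\<^sup>2 + e - snd k) \<longleftrightarrow> (\<forall>k\<in>K. y \<bullet> u k < d k)"
        by (intro ball_cong refl dineq)
      thus ?thesis by (simp add: C_eq Sec_def)
    qed
    have T_ball: "norm y < \<rho>" if "y \<in> T k \<sigma>" "k \<in> K" for y k \<sigma>
    proof -
      have "d k * norm y < \<rho> * (y \<bullet> u k)" "y \<bullet> u k < d k" using that by (auto simp: T_def hc_def cone_def)
      hence "d k * norm y < \<rho> * d k" using \<rho> by (meson mult_strict_left_mono order_less_trans)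
      thus ?thesis using dpos[OF that(2)] by (simp add: mult.commute)
    qed
    \<comment> \<open>Cut off by the radical line, a half cone is the right triangle required by
      \<open>heavy_triangle\<close>, with hypotenuse \<open>\<rho>\<close>. The cone condition is
      squared and Pythagoras applied.\<close>
    have T_tri: "T k \<sigma> = {y. 0 < y \<bullet> u k \<and> y \<bullet> u k < d k \<and> 0 < y \<bullet> (\<sigma> *\<^sub>R perp (u k)) \<and>
        (y \<bullet> (\<sigma> *\<^sub>R perp (u k))) * d k < sqrt (\<rho>\<^sup>2 - (d k)\<^sup>2) * (y \<bullet> u k)}"
      if k: "k \<in> L" and \<sigma>: "\<sigma> \<in> {1, -1}" for k \<sigma>
    proof -
      have kK: "k \<in> K" "d k < \<rho>" using k by (auto simp: L_def)
      have dd: "(d k)\<^sup>2 < \<rho>\<^sup>2" using kK dpos[of k] by (intro power_strict_mono) auto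
      have "y \<in> cone k \<longleftrightarrow> 0 < y \<bullet> u k \<and> (y \<bullet> p) * d k < sqrt (\<rho>\<^sup>2 - (d k)\<^sup>2) * (y \<bullet> u k)"
        if p: "p = \<sigma> *\<^sub>R perp (u k)" "0 < y \<bullet> p" for y p
      proof -
        have ny: "(norm y)\<^sup>2 = (y \<bullet> u k)\<^sup>2 + (y \<bullet> p)\<^sup>2"
        proof -
          have "fst (u k) * fst (u k) + snd (u k) * snd (u k) = 1"
            using u1[OF kK(1)] by (simp add: norm_eq_1 inner_prod_def)
          moreover have "\<sigma> * \<sigma> = 1" using \<sigma> by auto
          moreover have n: "(norm y)\<^sup>2 = fst y * fst y + snd y * snd y"
            by (simp add: power2_norm_eq_inner inner_prod_def)
          ultimately show ?thesis
            unfolding n p inner_prod_def perp_def inner_real_def fst_scaleR snd_scaleR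
              fst_conv snd_conv real_scaleR_def power2_eq_square by algebra
        qed
        have "y \<in> cone k \<longleftrightarrow> 0 < y \<bullet> u k \<and> (d k * norm y)\<^sup>2 < (\<rho> * (y \<bullet> u k))\<^sup>2"
        proof (cases "0 < y \<bullet> u k")
          case True
          thus ?thesis using dpos[OF kK(1)] \<rho>
            by (auto simp: cone_def intro: power_strict_mono dest: power_less_imp_less_base)
        next
          case False
          hence "\<rho> * (y \<bullet> u k) \<le> 0" using \<rho> by (simp add: mult_le_0_iff)
          moreover have "0 \<le> d k * norm y" using dpos[OF kK(1)] by simp
          ultimately show ?thesis using False by (simp add: cone_def)
        qed
        also have "(d k * norm y)\<^sup>2 < (\<rho> * (y \<bullet> u k))\<^sup>2 \<longleftrightarrow> ((y \<bullet> p) * d k)\<^sup>2 < (sqrt (\<rho>\<^sup>2 - (d k)\<^sup>2) * (y \<bullet> u k))\<^sup>2"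
          using dd by (simp add: power_mult_distrib ny algebra_simps)
        also have "0 < y \<bullet> u k \<and> \<dots> \<longleftrightarrow> 0 < y \<bullet> u k \<and> (y \<bullet> p) * d k < sqrt (\<rho>\<^sup>2 - (d k)\<^sup>2) * (y \<bullet> u k)"
          using p dd dpos[OF kK(1)]
          by (auto intro!: power_strict_mono dest: power_less_imp_less_base)
        finally show ?thesis .
      qed
      from this[OF refl] show ?thesis unfolding T_def hc_def by blast
    qed
    have T_heavy: "heavy (height_weight e) (T k \<sigma>)" if k: "k \<in> L" and \<sigma>: "\<sigma> \<in> {1, -1}" for k \<sigma>
    proof -
      have kK: "k \<in> K" "d k < \<rho>" using k by (auto simp: L_def)
      have dd: "(d k)\<^sup>2 < \<rho>\<^sup>2" using kK dpos[of k] by (intro power_strict_mono) auto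
      have "norm (\<sigma> *\<^sub>R perp (u k)) = 1" using \<sigma> u1[OF kK(1)] by auto
      thus ?thesis unfolding T_tri[OF k \<sigma>] using dd \<rho>
        by (intro heavy_triangle u1 kK e dpos dlow) auto
    qed
    have [measurable]: "cone k \<in> sets borel" for k
      unfolding cone_def by (intro borel_open open_Collect_less continuous_intros)
    have [measurable]: "Sec \<in> sets borel"
    proof -
      have "Sec = (\<Inter>n\<in>M. {y. n \<bullet> y < 0})" by (auto simp: Sec_def)
      moreover have "open \<dots>" using fin by (intro open_INT ballI open_Collect_less continuous_intros) auto
      ultimately show ?thesis by (simp add: borel_open)
    qed
    have \<Omega>meas [measurable]: "\<Omega> \<in> sets borel" unfolding \<Omega>_def using finL by (intro sets.Diff sets.finite_UN) auto
    have H1: "heavy (height_weight e) (\<Omega> \<inter> ball 0 \<rho>)"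
    proof (rule heavy_sector[OF \<Omega>meas])
      show "c *\<^sub>R y \<in> \<Omega>" if "c > 0" "y \<in> \<Omega>" for c y
        using that by (auto simp: \<Omega>_def Sec_def cone_scale mult_pos_neg)
    qed (use 3 e \<rho> in auto)
    have H2: "heavy (height_weight e) (C - ball 0 \<rho>)"
    proof (rule heavy_const)
      fix y assume "y \<in> C - ball 0 \<rho>"
      hence "\<rho>\<^sup>2 \<le> (norm y)\<^sup>2" using \<rho> by (intro power_mono) auto
      hence "ennreal (1 / (2 / 3)) \<le> height_weight e y" using \<rho> by (intro height_weight_ge) auto
      thus "ennreal (3 / 2) \<le> height_weight e y" by simp
    qed (use s0_series_bounds in auto)
    have finG: "finite G" using finL by (auto simp: G_def intro: finite_subset[of _ "L \<times> {1, -1}"])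
    have H3: "heavy (height_weight e) (\<Union>g\<in>G. T (fst g) (snd g))"
    proof (rule heavy_UN)
      show "disjoint_family_on (\<lambda>g. T (fst g) (snd g)) G"
        unfolding disjoint_family_on_def
      proof (intro ballI impI, rule ccontr)
        fix g g' assume g: "g \<in> G" "g' \<in> G" "g \<noteq> g'" and "T (fst g) (snd g) \<inter> T (fst g') (snd g') \<noteq> {}"
        then obtain y where y: "y \<in> T (fst g) (snd g)" "y \<in> T (fst g') (snd g')" by auto
        have "fst g = fst g'"
          using cone_disj[of "fst g" "fst g'"] y g unfolding T_def hc_def G_def L_def by fastforce
        moreover from this have "snd g = snd g'"
        proof -
          have "0 < y \<bullet> (snd g *\<^sub>R perp (u (fst g)))" "0 < y \<bullet> (snd g' *\<^sub>R perp (u (fst g)))"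
            using y unfolding T_def hc_def \<open>fst g = fst g'\<close> by blast+
          moreover have "snd g \<in> {1, -1}" "snd g' \<in> {1, -1}" using g by (auto simp: G_def)
          ultimately show ?thesis by auto
        qed
        ultimately show False using g by (simp add: prod_eq_iff)
      qed
    qed (use finG T_heavy in \<open>auto simp: G_def\<close>)
    have TC: "T k \<sigma> \<subseteq> C" if "(k, \<sigma>) \<in> G" for k \<sigma>
    proof
      fix y assume y: "y \<in> T k \<sigma>"
      have k: "k \<in> L" "k \<in> K" "hc k \<sigma> \<subseteq> Sec" using that by (auto simp: G_def L_def)
      have "y \<bullet> u k' < d k'" if k': "k' \<in> K" for k'
      proof (cases "k' = k")
        case False
        have "y \<notin> cone k'" using cone_disj[OF k(2) k'] False y by (auto simp: T_def hc_def)
        thus ?thesis using near k' T_ball[OF y k(2)] by auto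
      qed (use y in \<open>auto simp: T_def\<close>)
      thus "y \<in> C" using y k by (auto simp: inC T_def)
    qed
    have \<Omega>C: "\<Omega> \<inter> ball 0 \<rho> \<subseteq> C"
      using near far by (fastforce simp: inC \<Omega>_def)
    \<comment> \<open>Up to the axes of the cones, the cell consists of its part outside the disc,
      where the weight is \<open>3 / 2\<close>, the part of the disc outside all cones, and the
      triangles in the surviving half cones.\<close>
    let ?A = "(C - ball 0 \<rho>) \<union> (\<Omega> \<inter> ball 0 \<rho>) \<union> (\<Union>g\<in>G. T (fst g) (snd g))"
    have HA: "heavy (height_weight e) ?A"
    proof (intro heavy_Un H1 H2 H3)
      have "T (fst g) (snd g) \<subseteq> ball 0 \<rho> \<inter> cone (fst g)" if "g \<in> G" for g
        using T_ball[of _ "fst g" "snd g"] that by (auto simp: G_def L_def T_def hc_def)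
      thus "(C - ball 0 \<rho> \<union> \<Omega> \<inter> ball 0 \<rho>) \<inter> (\<Union>g\<in>G. T (fst g) (snd g)) = {}"
        by (fastforce simp: \<Omega>_def G_def)
    qed auto
    let ?N = "\<Union>k\<in>L. {y. perp (u k) \<bullet> y = 0}"
    show ?thesis
    proof (rule heavy_null_diff[OF HA])
      show "?A \<subseteq> C" using TC \<Omega>C by fastforce
      show "?N \<in> null_sets lborel"
      proof (intro null_sets.finite_UN finL hyperplane_null)
        fix k assume "k \<in> L"
        hence "norm (perp (u k)) = 1" using u1[of k] by (simp add: L_def)
        thus "perp (u k) \<noteq> 0" by (metis norm_zero zero_neq_one)
      qed
      show "C - ?A \<subseteq> ?N"
      proof
        fix y assume y: "y \<in> C - ?A"
        hence ys: "y \<in> Sec" "norm y < \<rho>" "y \<notin> \<Omega>" by (auto simp: inC)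
        then obtain k where k: "k \<in> L" "y \<in> cone k" by (auto simp: \<Omega>_def)
        have kd: "y \<bullet> u k < d k" using y k by (auto simp: inC L_def)
        have "y \<bullet> perp (u k) = 0"
        proof (rule ccontr)
          assume ne: "y \<bullet> perp (u k) \<noteq> 0"
          define \<sigma> where "\<sigma> = sgn (y \<bullet> perp (u k))"
          have \<sigma>: "\<sigma> \<in> {1, -1}" "0 < y \<bullet> (\<sigma> *\<^sub>R perp (u k))" using ne by (auto simp: \<sigma>_def sgn_if)
          hence yh: "y \<in> hc k \<sigma>" using k by (simp add: hc_def)
          hence "(k, \<sigma>) \<in> G" using bad[OF k(1) \<sigma>(1) _ yh] ys k \<sigma> by (auto simp: G_def)
          moreover have "y \<in> T k \<sigma>" using yh kd by (simp add: T_def)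
          ultimately show False using y by force
        qed
        thus "y \<in> ?N" using k by (auto simp: inner_commute)
      qed
    qed auto
  qed
  thus ?thesis by (simp add: C_def)
qed

section \<open>Power diagrams of weighted centres in a polygon\<close>

definition power_cell ::
  "('i \<Rightarrow> real \<times> real) \<Rightarrow> ('i \<Rightarrow> real) \<Rightarrow> 'i set \<Rightarrow> (real \<times> real) set \<Rightarrow> 'i \<Rightarrow> (real \<times> real) set" where
  "power_cell c e I Q i =
     {y \<in> Q. \<forall>l\<in>I - {i}. e l - (norm (y - c l))\<^sup>2 < e i - (norm (y - c i))\<^sup>2}"

lemma power_cell_disjoint:
  assumes "i \<in> I" "l \<in> I" "i \<noteq> l" "y \<in> power_cell c e I Q i"
  shows "y \<notin> power_cell c e I Q l"
proof
  assume "y \<in> power_cell c e I Q l"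
  with assms have "e l - (norm (y - c l))\<^sup>2 < e i - (norm (y - c i))\<^sup>2"
    "e i - (norm (y - c i))\<^sup>2 < e l - (norm (y - c l))\<^sup>2"
    unfolding power_cell_def by blast+
  thus False by simp
qed

lemma open_power_cell:
  assumes "finite I" "open Q"
  shows "open (power_cell c e I Q i)"
proof -
  have "power_cell c e I Q i = Q \<inter> (\<Inter>l\<in>I - {i}. {y. e l - (norm (y - c l))\<^sup>2 < e i - (norm (y - c i))\<^sup>2})"
    by (auto simp: power_cell_def)
  thus ?thesis using assms by (auto intro!: open_Int open_INT open_Collect_less continuous_intros)
qed

text \<open>Model: over \<open>c i\<close> rests a ball of diameter \<open>e i\<close>. Then
  \<open>sep\<close> says that two balls do not overlap, and \<open>side\<close> that a ball does
  not cross a wall unless centred on it. \<open>angle\<close> states that the sides are mirrors at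
  angles that are right or at most \<pi>/3.\<close>

locale weighted_polygon =
  fixes I :: "'i set" and c :: "'i \<Rightarrow> real \<times> real" and e :: "'i \<Rightarrow> real"
    and J :: "'j set" and n :: "'j \<Rightarrow> real \<times> real" and k :: "'j \<Rightarrow> real"
  assumes finI: "finite I" and finJ: "finite J"
    and weight: "i \<in> I \<Longrightarrow> 0 < e i \<and> e i \<le> 1"
    and sep: "i \<in> I \<Longrightarrow> l \<in> I \<Longrightarrow> i \<noteq> l \<Longrightarrow> e i * e l \<le> (norm (c i - c l))\<^sup>2"
    and side: "i \<in> I \<Longrightarrow> j \<in> J \<Longrightarrow> n j \<bullet> c i = k j \<or> n j \<bullet> c i \<le> k j - e i / 2"
    and norm_n: "j \<in> J \<Longrightarrow> norm (n j) = 1"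
    and angle: "j \<in> J \<Longrightarrow> j' \<in> J \<Longrightarrow> j \<noteq> j' \<Longrightarrow> n j \<bullet> n j' = 0 \<or> n j \<bullet> n j' \<le> - 1 / 2"
begin

definition Q where "Q = {y. \<forall>j\<in>J. n j \<bullet> y < k j}"

abbreviation cell where "cell \<equiv> power_cell c e I Q"

lemma open_Q: "open Q"
proof -
  have "Q = (\<Inter>j\<in>J. {y. n j \<bullet> y < k j})" by (auto simp: Q_def)
  thus ?thesis using finJ by (auto intro!: open_INT open_Collect_less continuous_intros)
qed

lemma measurable_cell [measurable]: "cell i \<in> sets borel"
  by (intro borel_open open_power_cell finI open_Q)

lemma heavy_power_cell:
  assumes i: "i \<in> I"
  shows "ennreal s0_series * emeasure lborel (cell i) \<le>
    (\<integral>\<^sup>+y. height_weight (e i) (y - c i) * indicator (cell i) y \<partial>lborel)"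
proof -
  define \<delta> where "\<delta> = (\<lambda>j. k j - n j \<bullet> c i)"
  define F where "F = {j \<in> J. \<delta> j \<noteq> 0}"
  define K1 where "K1 = (\<lambda>l. (c l - c i, e l)) ` (I - {i})"
  \<comment> \<open>Mirror images of \<open>c i\<close> in the sides not through it, with its own
    weight: the radical line of two equal weights is their perpendicular bisector, here the side
    itself.\<close>
  define K2 where "K2 = (\<lambda>j. ((2 * \<delta> j) *\<^sub>R n j, e i)) ` F"
  define M where "M = n ` {j \<in> J. \<delta> j = 0}"
  have ei: "0 < e i" "e i \<le> 1" using weight[OF i] by auto
  have \<delta>F: "e i / 2 \<le> \<delta> j" "0 < \<delta> j" if "j \<in> F" for j
    using side[OF i, of j] that ei by (auto simp: F_def \<delta>_def)
  have nn: "n j \<bullet> n j = 1" if "j \<in> J" for j using norm_n[OF that] by (simp add: norm_eq_1)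
  have e4: "e i * e i \<le> 4 * (\<delta> j)\<^sup>2" if "j \<in> F" for j
  proof -
    have "(e i)\<^sup>2 \<le> (2 * \<delta> j)\<^sup>2" using \<delta>F[OF that] ei by (intro power_mono) auto
    thus ?thesis by (simp add: power2_eq_square)
  qed
  have nz: "n j \<bullet> (c l - c i) \<le> \<delta> j" if "l \<in> I" "j \<in> J" for j l
    using side[OF that] weight[OF that(1)] by (auto simp: \<delta>_def inner_diff_right)
  \<comment> \<open>The other centre is on the same side of the mirror as \<open>c i\<close>, hence
    no nearer to the image than to \<open>c i\<close>.\<close>
  have mirror: "e l * e i \<le> (norm (c l - c i - (2 * \<delta> j) *\<^sub>R n j))\<^sup>2" if l: "l \<in> I - {i}" and j: "j \<in> F" for l j
  proof -
    have jJ: "j \<in> J" using j by (simp add: F_def)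
    have "(norm (c l - c i - (2 * \<delta> j) *\<^sub>R n j))\<^sup>2 = (norm (c l - c i))\<^sup>2 + 4 * \<delta> j * (\<delta> j - n j \<bullet> (c l - c i))"
      unfolding power2_norm_eq_inner using nn[OF jJ]
      by (simp add: inner_diff_left inner_diff_right inner_commute algebra_simps power2_eq_square)
    moreover have "0 \<le> 4 * \<delta> j * (\<delta> j - n j \<bullet> (c l - c i))"
      using \<delta>F[OF j] nz[of l j] l jJ by (intro mult_nonneg_nonneg) auto
    moreover have "e l * e i \<le> (norm (c l - c i))\<^sup>2" using sep[of l i] l i by auto
    ultimately show ?thesis by linarith
  qed
  \<comment> \<open>As \<open>n j \<bullet> n j'\<close> is not positive, the two images are at
    least as far apart as they would be in orthogonal directions.\<close>
  have mm: "e i * e i \<le> (norm ((2 * \<delta> j) *\<^sub>R n j - (2 * \<delta> j') *\<^sub>R n j'))\<^sup>2"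
    if j: "j \<in> F" "j' \<in> F" "j \<noteq> j'" for j j'
  proof -
    have jJ: "j \<in> J" "j' \<in> J" using j by (auto simp: F_def)
    have "(norm ((2 * \<delta> j) *\<^sub>R n j - (2 * \<delta> j') *\<^sub>R n j'))\<^sup>2
       = 4 * (\<delta> j)\<^sup>2 + 4 * (\<delta> j')\<^sup>2 + 8 * (\<delta> j * \<delta> j') * (- (n j \<bullet> n j'))"
      unfolding power2_norm_eq_inner using nn[OF jJ(1)] nn[OF jJ(2)]
      by (simp add: inner_diff_left inner_diff_right inner_commute algebra_simps power2_eq_square)
    moreover have "0 \<le> 8 * (\<delta> j * \<delta> j') * (- (n j \<bullet> n j'))"
      using angle[OF jJ j(3)] \<delta>F(2)[OF j(1)] \<delta>F(2)[OF j(2)] by (intro mult_nonneg_nonneg) auto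
    ultimately show ?thesis using e4[OF j(1)] zero_le_power2[of "\<delta> j'"] by linarith
  qed
  have heavy0: "heavy (height_weight (e i))
    {y. (\<forall>m\<in>M. m \<bullet> y < 0) \<and> (\<forall>(z, \<epsilon>)\<in>K1 \<union> K2. 2 * (y \<bullet> z) < (norm z)\<^sup>2 + e i - \<epsilon>)}"
  proof (rule heavy_cell)
    show "finite (K1 \<union> K2)" "finite M"
      using finI finJ by (auto simp: K1_def K2_def F_def M_def)
    fix z \<epsilon> assume "(z, \<epsilon>) \<in> K1 \<union> K2"
    then consider l where "l \<in> I - {i}" "z = c l - c i" "\<epsilon> = e l"
      | j where "j \<in> F" "z = (2 * \<delta> j) *\<^sub>R n j" "\<epsilon> = e i"
      unfolding K1_def K2_def by blast
    hence "0 < \<epsilon> \<and> \<epsilon> \<le> 1 \<and> e i * \<epsilon> \<le> (norm z)\<^sup>2 \<and>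
      (\<forall>m\<in>M. m \<bullet> z = 0 \<or> m \<bullet> z \<le> - \<epsilon> / 2) \<and>
      (\<forall>z' \<epsilon>'. (z', \<epsilon>') \<in> K1 \<union> K2 \<longrightarrow> (z, \<epsilon>) \<noteq> (z', \<epsilon>') \<longrightarrow> \<epsilon> * \<epsilon>' \<le> (norm (z - z'))\<^sup>2)"
    proof cases
      case (1 l)
      have "e i * e l \<le> (norm (c l - c i))\<^sup>2" using sep[of i l] 1 i by (auto simp: norm_minus_commute)
      moreover have "m \<bullet> z = 0 \<or> m \<bullet> z \<le> - \<epsilon> / 2" if "m \<in> M" for m
      proof -
        obtain j where j: "j \<in> J" "\<delta> j = 0" "m = n j" using \<open>m \<in> M\<close> by (auto simp: M_def)
        thus ?thesis using side[of l j] 1 by (auto simp: inner_diff_right \<delta>_def)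
      qed
      moreover have "\<epsilon> * \<epsilon>' \<le> (norm (z - z'))\<^sup>2" if "(z', \<epsilon>') \<in> K1 \<union> K2" "(z, \<epsilon>) \<noteq> (z', \<epsilon>')" for z' \<epsilon>'
      proof -
        from that consider l' where "l' \<in> I - {i}" "z' = c l' - c i" "\<epsilon>' = e l'"
          | j where "j \<in> F" "z' = (2 * \<delta> j) *\<^sub>R n j" "\<epsilon>' = e i"
          unfolding K1_def K2_def by blast
        thus ?thesis
        proof cases
          case (1 l')
          hence "l \<noteq> l'" using that(2) \<open>z = c l - c i\<close> \<open>\<epsilon> = e l\<close> by auto
          thus ?thesis using sep[of l l'] 1 \<open>l \<in> I - {i}\<close> \<open>z = c l - c i\<close> \<open>\<epsilon> = e l\<close> by simp
        next
          case (2 j)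
          thus ?thesis using mirror[of l j] \<open>l \<in> I - {i}\<close> \<open>z = c l - c i\<close> \<open>\<epsilon> = e l\<close> by simp
        qed
      qed
      ultimately show ?thesis using weight[of l] 1 by auto
    next
      case (2 j)
      have jJ: "j \<in> J" using 2 by (simp add: F_def)
      have "e i * e i \<le> (norm z)\<^sup>2"
        using e4[OF 2(1)] norm_n[OF jJ] 2 by (simp add: power_mult_distrib)
      moreover have "m \<bullet> z = 0 \<or> m \<bullet> z \<le> - \<epsilon> / 2" if "m \<in> M" for m
      proof -
        obtain j' where j': "j' \<in> J" "\<delta> j' = 0" "m = n j'" using \<open>m \<in> M\<close> by (auto simp: M_def)
        hence "j' \<noteq> j" using 2(1) by (auto simp: F_def)
        from angle[OF j'(1) jJ this] show ?thesis
        proof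
          assume "n j' \<bullet> n j \<le> - 1 / 2"
          hence "2 * \<delta> j * (n j' \<bullet> n j) \<le> 2 * \<delta> j * (- 1 / 2)"
            using \<delta>F[OF 2(1)] by (intro mult_left_mono) auto
          thus ?thesis using \<delta>F[OF 2(1)] 2 j' by auto
        qed (use 2 j' in auto)
      qed
      moreover have "\<epsilon> * \<epsilon>' \<le> (norm (z - z'))\<^sup>2" if "(z', \<epsilon>') \<in> K1 \<union> K2" "(z, \<epsilon>) \<noteq> (z', \<epsilon>')" for z' \<epsilon>'
      proof -
        from that consider l' where "l' \<in> I - {i}" "z' = c l' - c i" "\<epsilon>' = e l'"
          | j' where "j' \<in> F" "z' = (2 * \<delta> j') *\<^sub>R n j'" "\<epsilon>' = e i"
          unfolding K1_def K2_def by blast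
        thus ?thesis
        proof cases
          case (1 l')
          thus ?thesis using mirror[of l' j] 2 by (simp add: norm_minus_commute mult.commute)
        next
          case (2 j')
          hence "j' \<noteq> j" using that(2) \<open>z = (2 * \<delta> j) *\<^sub>R n j\<close> \<open>\<epsilon> = e i\<close> by auto
          thus ?thesis using mm[of j j'] 2 \<open>j \<in> F\<close> \<open>z = (2 * \<delta> j) *\<^sub>R n j\<close> \<open>\<epsilon> = e i\<close> by simp
        qed
      qed
      ultimately show ?thesis using ei 2 by auto
    qed
    thus "0 < \<epsilon> \<and> \<epsilon> \<le> 1 \<and> e i * \<epsilon> \<le> (norm z)\<^sup>2"
      "\<And>m. m \<in> M \<Longrightarrow> m \<bullet> z = 0 \<or> m \<bullet> z \<le> - \<epsilon> / 2"
      "\<And>z' \<epsilon>'. (z', \<epsilon>') \<in> K1 \<union> K2 \<Longrightarrow> (z, \<epsilon>) \<noteq> (z', \<epsilon>') \<Longrightarrow> \<epsilon> * \<epsilon>' \<le> (norm (z - z'))\<^sup>2"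
      by blast+
  next
    show "norm m = 1" if "m \<in> M" for m using that norm_n by (auto simp: M_def)
  qed (use ei in auto)
  have mem: "y \<in> {y. (\<forall>m\<in>M. m \<bullet> y < 0) \<and> (\<forall>(z, \<epsilon>)\<in>K1 \<union> K2. 2 * (y \<bullet> z) < (norm z)\<^sup>2 + e i - \<epsilon>)}
      \<longleftrightarrow> c i + y \<in> cell i" for y
  proof -
    have 1: "2 * (y \<bullet> (c l - c i)) < (norm (c l - c i))\<^sup>2 + e i - e l \<longleftrightarrow>
        e l - (norm (c i + y - c l))\<^sup>2 < e i - (norm (c i + y - c i))\<^sup>2" for l
    proof -
      have "(norm (c i + y - c l))\<^sup>2 = (norm (c l - c i))\<^sup>2 - 2 * (y \<bullet> (c l - c i)) + (norm y)\<^sup>2"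
        unfolding power2_norm_eq_inner by (simp add: inner_diff_left inner_diff_right inner_add_left inner_add_right inner_commute)
      thus ?thesis by auto
    qed
    have 2: "2 * (y \<bullet> ((2 * \<delta> j) *\<^sub>R n j)) < (norm ((2 * \<delta> j) *\<^sub>R n j))\<^sup>2 + e i - e i \<longleftrightarrow> n j \<bullet> (c i + y) < k j"
      if "j \<in> F" for j
    proof -
      have "j \<in> J" using that by (simp add: F_def)
      hence "2 * (y \<bullet> ((2 * \<delta> j) *\<^sub>R n j)) < (norm ((2 * \<delta> j) *\<^sub>R n j))\<^sup>2 + e i - e i
          \<longleftrightarrow> (4 * \<delta> j) * (n j \<bullet> y) < (4 * \<delta> j) * \<delta> j"
        using norm_n[of j] by (simp add: power_mult_distrib power2_eq_square inner_commute mult_ac)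
      also have "\<dots> \<longleftrightarrow> n j \<bullet> y < \<delta> j" using \<delta>F[OF that] by simp
      finally show ?thesis by (auto simp: \<delta>_def inner_add_right)
    qed
    have 3: "n j \<bullet> y < 0 \<longleftrightarrow> n j \<bullet> (c i + y) < k j" if "\<delta> j = 0" for j
      using that by (auto simp: \<delta>_def inner_add_right)
    have "y \<in> {y. (\<forall>m\<in>M. m \<bullet> y < 0) \<and> (\<forall>(z, \<epsilon>)\<in>K1 \<union> K2. 2 * (y \<bullet> z) < (norm z)\<^sup>2 + e i - \<epsilon>)}
      \<longleftrightarrow> (\<forall>j\<in>{j \<in> J. \<delta> j = 0}. n j \<bullet> y < 0)
        \<and> (\<forall>l\<in>I - {i}. 2 * (y \<bullet> (c l - c i)) < (norm (c l - c i))\<^sup>2 + e i - e l)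
        \<and> (\<forall>j\<in>F. 2 * (y \<bullet> ((2 * \<delta> j) *\<^sub>R n j)) < (norm ((2 * \<delta> j) *\<^sub>R n j))\<^sup>2 + e i - e i)"
      unfolding M_def K1_def K2_def by (simp only: mem_Collect_eq ball_Un ball_simps split_conv)
    also have "\<dots> \<longleftrightarrow> (\<forall>j\<in>{j \<in> J. \<delta> j = 0}. n j \<bullet> (c i + y) < k j)
        \<and> (\<forall>l\<in>I - {i}. e l - (norm (c i + y - c l))\<^sup>2 < e i - (norm (c i + y - c i))\<^sup>2)
        \<and> (\<forall>j\<in>F. n j \<bullet> (c i + y) < k j)"
      using 1 2 3 by simp
    also have "\<dots> \<longleftrightarrow> c i + y \<in> cell i"
      unfolding power_cell_def Q_def F_def mem_Collect_eq by blast
    finally show ?thesis .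
  qed
  have "heavy (height_weight (e i)) {y. c i + y \<in> cell i}"
  proof -
    have "{y. (\<forall>m\<in>M. m \<bullet> y < 0) \<and> (\<forall>(z, \<epsilon>)\<in>K1 \<union> K2. 2 * (y \<bullet> z) < (norm z)\<^sup>2 + e i - \<epsilon>)}
        = {y. c i + y \<in> cell i}" (is "?X = _")
    proof (intro set_eqI)
      fix y
      show "y \<in> ?X \<longleftrightarrow> y \<in> {y. c i + y \<in> cell i}" unfolding mem by simp
    qed
    with heavy0 show ?thesis by (simp only:)
  qed
  hence "ennreal s0_series * emeasure lborel {y. c i + y \<in> cell i} \<le>
     (\<integral>\<^sup>+y. height_weight (e i) y * indicator (cell i) (c i + y) \<partial>lborel)"
    by (simp add: heavy_def indicator_def)
  moreover have "emeasure lborel (cell i) = emeasure lborel {y. c i + y \<in> cell i}"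
  proof -
    have "emeasure lborel (cell i) = emeasure (distr lborel borel ((+) (c i))) (cell i)"
      by (simp only: lborel_distr_plus)
    also have "\<dots> = emeasure lborel {y. c i + y \<in> cell i}"
      by (subst emeasure_distr) (auto simp: vimage_def)
    finally show ?thesis .
  qed
  moreover have "(\<integral>\<^sup>+y. height_weight (e i) (y - c i) * indicator (cell i) y \<partial>lborel)
    = (\<integral>\<^sup>+y. height_weight (e i) y * indicator (cell i) (c i + y) \<partial>lborel)"
  proof -
    have "(\<integral>\<^sup>+y. height_weight (e i) (y - c i) * indicator (cell i) y \<partial>lborel)
      = (\<integral>\<^sup>+y. height_weight (e i) (y - c i) * indicator (cell i) y \<partial>distr lborel borel ((+) (c i)))"
      by (simp only: lborel_distr_plus)
    also have "\<dots> = (\<integral>\<^sup>+y. height_weight (e i) y * indicator (cell i) (c i + y) \<partial>lborel)"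
      by (subst nn_integral_distr) auto
    finally show ?thesis .
  qed
  ultimately show ?thesis by simp
qed

lemma heavy_polygon:
  assumes "I \<noteq> {}"
  shows "ennreal s0_series * emeasure lborel Q \<le>
    (\<integral>\<^sup>+y. (\<Sum>i\<in>I. height_weight (e i) (y - c i) * indicator (cell i) y) \<partial>lborel)"
proof -
  \<comment> \<open>Ties lie on finitely many radical lines; these are lines because
    \<open>sep\<close> with positive weights keeps the centres distinct.\<close>
  define N where "N = (\<Union>i\<in>I. \<Union>l\<in>I - {i}. {y. (2 *\<^sub>R (c l - c i)) \<bullet> y = (norm (c l))\<^sup>2 - (norm (c i))\<^sup>2 + e i - e l})"
  have "c l \<noteq> c i" if "i \<in> I" "l \<in> I - {i}" for i l
  proof
    assume "c l = c i"
    hence "e i * e l \<le> 0" using sep[of i l] that by auto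
    moreover have "0 < e i * e l" using weight[of i] weight[of l] that by simp
    ultimately show False by simp
  qed
  hence "N \<in> null_sets lborel"
    unfolding N_def using finI by (intro null_sets.finite_UN hyperplane_null) auto
  hence N0: "emeasure lborel N = 0" "N \<in> sets lborel" by auto
  have UN [measurable]: "(\<Union>i\<in>I. cell i) \<in> sets borel" using finI by (intro sets.finite_UN) auto
  have cover: "Q \<subseteq> (\<Union>i\<in>I. cell i) \<union> N"
  proof
    fix y assume y: "y \<in> Q"
    define g where "g = (\<lambda>i. e i - (norm (y - c i))\<^sup>2)"
    have "Max (g ` I) \<in> g ` I" using finI assms by (intro Max_in) auto
    then obtain i where i: "i \<in> I" "Max (g ` I) = g i" by auto
    hence mx: "g l \<le> g i" if "l \<in> I" for l using that finI by (metis Max_ge finite_imageI imageI)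
    show "y \<in> (\<Union>i\<in>I. cell i) \<union> N"
    proof (cases "\<forall>l\<in>I - {i}. g l < g i")
      case True
      hence "y \<in> cell i" using y by (simp add: power_cell_def g_def)
      thus ?thesis using i by blast
    next
      case False
      then obtain l where l: "l \<in> I - {i}" "g l = g i" using mx by force
      have "(norm (y - c j))\<^sup>2 = (norm y)\<^sup>2 - 2 * (c j \<bullet> y) + (norm (c j))\<^sup>2" for j
        unfolding power2_norm_eq_inner by (simp add: inner_diff_left inner_diff_right inner_commute)
      hence "(2 *\<^sub>R (c l - c i)) \<bullet> y = (norm (c l))\<^sup>2 - (norm (c i))\<^sup>2 + e i - e l"
        using l(2) by (simp add: g_def inner_diff_left)
      hence "y \<in> N" unfolding N_def using i l by blast
      thus ?thesis by blast
    qed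
  qed
  have "emeasure lborel Q \<le> emeasure lborel ((\<Union>i\<in>I. cell i) \<union> N)"
    using cover N0 UN by (intro emeasure_mono) auto
  also have "\<dots> \<le> emeasure lborel (\<Union>i\<in>I. cell i) + emeasure lborel N"
    using N0 UN by (intro emeasure_subadditive) auto
  also have "\<dots> \<le> (\<Sum>i\<in>I. emeasure lborel (cell i))"
    using N0 finI by (simp add: emeasure_subadditive_finite image_subset_iff)
  finally have "ennreal s0_series * emeasure lborel Q \<le> (\<Sum>i\<in>I. ennreal s0_series * emeasure lborel (cell i))"
    by (simp add: mult_left_mono flip: sum_distrib_left)
  also have "\<dots> \<le> (\<Sum>i\<in>I. (\<integral>\<^sup>+y. height_weight (e i) (y - c i) * indicator (cell i) y \<partial>lborel))"
    by (intro sum_mono heavy_power_cell)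
  also have "\<dots> = (\<integral>\<^sup>+y. (\<Sum>i\<in>I. height_weight (e i) (y - c i) * indicator (cell i) y) \<partial>lborel)"
    by (intro nn_integral_sum[symmetric]) auto
  finally show ?thesis .
qed

end

section \<open>Horospherical coordinates\<close>

text \<open>In the half-space model the volume over a unit of area above height h is the integral of
  1/z^3 from h on, which is 1/(2 h^2). Here \<open>t\<close> is the projective parameter of a
  vertical line, 0 its end at infinity, and \<open>T\<close> the parameter of squared height
  \<open>\<eta>\<close>.\<close>

lemma nn_integral_cone_segment:
  fixes m s \<eta> :: real
  assumes m: "1 \<le> m" and s: "0 < s" and \<eta>: "0 < \<eta>"
  defines "T \<equiv> 2 / (m + \<eta> / s\<^sup>2)"
  shows "(\<integral>\<^sup>+t. ennreal (1 / (s\<^sup>2 * (2 - t * m)\<^sup>2)) * indicator {0..T} t \<partial>lborel) = ennreal (1 / (2 * \<eta>))"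
proof -
  have den: "0 < m + \<eta> / s\<^sup>2" using assms by (simp add: add_pos_nonneg)
  have T: "0 < T" "T * m < 2" using m s \<eta> den by (auto simp: T_def field_simps)
  have p: "0 < 2 - t * m" if "t \<in> {0..T}" for t
  proof -
    have "t * m \<le> T * m" using that m by (intro mult_right_mono) auto
    thus ?thesis using T by linarith
  qed
  define F where "F = (\<lambda>t. t / (s\<^sup>2 * 2 * (2 - t * m)))"
  have "((\<lambda>t. 1 / (s\<^sup>2 * (2 - t * m)\<^sup>2)) has_integral (F T - F 0)) {0..T}"
  proof (rule fundamental_theorem_of_calculus)
    fix t assume t: "t \<in> {0..T}"
    have "(F has_field_derivative (1 * (s\<^sup>2 * 2 * (2 - t * m)) - t * (s\<^sup>2 * 2 * (- m))) / ((s\<^sup>2 * 2 * (2 - t * m)) * (s\<^sup>2 * 2 * (2 - t * m)))) (at t within {0..T})"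
      unfolding F_def using p[OF t] s
      by (intro DERIV_divide) (auto intro!: derivative_eq_intros)
    moreover have "(1 * (s\<^sup>2 * 2 * (2 - t * m)) - t * (s\<^sup>2 * 2 * (- m))) / ((s\<^sup>2 * 2 * (2 - t * m)) * (s\<^sup>2 * 2 * (2 - t * m)))
        = 1 / (s\<^sup>2 * (2 - t * m)\<^sup>2)"
    proof -
      have "(1 * (a * 2 * b) - t * (a * 2 * (- m))) / ((a * 2 * b) * (a * 2 * b)) = 1 / (a * b\<^sup>2)"
        if "a \<noteq> 0" "b \<noteq> 0" "b + t * m = 2" for a b :: real
      proof -
        have "1 * (a * 2 * b) - t * (a * 2 * (- m)) = 2 * a * (b + t * m)" by (simp add: algebra_simps)
        thus ?thesis using that by (simp add: power2_eq_square)
      qed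
      thus ?thesis using p[OF t] s by auto
    qed
    ultimately show "(F has_vector_derivative 1 / (s\<^sup>2 * (2 - t * m)\<^sup>2)) (at t within {0..T})"
      by (simp add: has_real_derivative_iff_has_vector_derivative)
  qed (use T in auto)
  moreover have "F T - F 0 = 1 / (2 * \<eta>)"
  proof -
    have "2 - T * m = T * (\<eta> / s\<^sup>2)" using den by (simp add: T_def field_simps)
    hence "F T = T / (s\<^sup>2 * 2 * (T * (\<eta> / s\<^sup>2)))" by (simp add: F_def)
    also have "\<dots> = 1 / (2 * \<eta>)" using T s \<eta> by (simp add: field_simps)
    finally show ?thesis by (simp add: F_def)
  qed
  ultimately have "((\<lambda>t. 1 / (s\<^sup>2 * (2 - t * m)\<^sup>2)) has_integral 1 / (2 * \<eta>)) {0..T}" by simp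
  thus ?thesis by (intro nn_integral_has_integral_lebesgue') auto
qed

locale horospherical_frame =
  fixes v e1 e2 :: point
  assumes norm_v: "v \<bullet> v = 1" and norm_e: "e1 \<bullet> e1 = 1" "e2 \<bullet> e2 = 1"
    and orth: "e1 \<bullet> e2 = 0" "e1 \<bullet> v = 0" "e2 \<bullet> v = 0"
    and basis: "\<And>x. x = (x \<bullet> e1) *\<^sub>R e1 + (x \<bullet> e2) *\<^sub>R e2 + (x \<bullet> v) *\<^sub>R v"
begin

definition lift :: "real \<times> real \<Rightarrow> point" where
  "lift y = fst y *\<^sub>R e1 + snd y *\<^sub>R e2"

definition proj :: "point \<Rightarrow> real \<times> real" where
  "proj x = (x \<bullet> e1, x \<bullet> e2)"

text \<open>
  The point at parameter \<open>t\<close> of the line from the ideal point \<open>v\<close> indexed by \<open>y\<close>. In the upper half-space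
  model with \<open>v\<close> at infinity the lines are vertical, and \<open>s\<close> is scaled away so that
  \<open>horoball v s\<close> is the region above height 1.
\<close>

definition ray :: "real \<Rightarrow> real \<times> real \<Rightarrow> real \<Rightarrow> point" where
  "ray s y t = (1 - t) *\<^sub>R v + (t / s) *\<^sub>R lift y"

lemma inner_lift: "lift y \<bullet> x = y \<bullet> proj x" "x \<bullet> lift y = y \<bullet> proj x"
  by (simp_all add: lift_def proj_def inner_prod_def inner_add_left inner_add_right inner_commute)

lemma proj_v [simp]: "proj v = 0"
  by (simp add: proj_def orth inner_commute zero_prod_def)

lemma orth': "e2 \<bullet> e1 = 0" "v \<bullet> e1 = 0" "v \<bullet> e2 = 0"
  using orth by (simp_all add: inner_commute)

lemma proj_lift [simp]: "proj (lift y) = y"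
  by (simp add: proj_def lift_def inner_add_left orth orth' norm_e)

lemma inner_proj: "proj a \<bullet> proj b = a \<bullet> b - (a \<bullet> v) * (b \<bullet> v)"
proof -
  have "a \<bullet> b = a \<bullet> ((b \<bullet> e1) *\<^sub>R e1 + (b \<bullet> e2) *\<^sub>R e2 + (b \<bullet> v) *\<^sub>R v)" by (subst basis) simp
  thus ?thesis by (simp add: proj_def inner_prod_def inner_add_right mult.commute)
qed

lemma inner_ray: "ray s y t \<bullet> x = (1 - t) * (v \<bullet> x) + (t / s) * (y \<bullet> proj x)"
  by (simp add: ray_def inner_add_left inner_lift)

lemma inner_ray_v: "ray s y t \<bullet> v = 1 - t"
  by (simp add: inner_ray norm_v)

lemma proj_add [simp]: "proj (a + b) = proj a + proj b"
  and proj_scaleR [simp]: "proj (r *\<^sub>R a) = r *\<^sub>R proj a"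
  by (simp_all add: proj_def inner_add_left)

lemma proj_ray: "proj (ray s y t) = (t / s) *\<^sub>R y"
  by (cases y) (simp add: proj_def ray_def lift_def inner_add_left orth orth' norm_e)

lemma ray_self: "s \<noteq> 0 \<Longrightarrow> 1 - ray s y t \<bullet> ray s y t = t * (2 - t * (1 + (norm y)\<^sup>2 / s\<^sup>2))"
proof -
  assume s: "s \<noteq> 0"
  have "ray s y t \<bullet> ray s y t = (1 - t)\<^sup>2 + (t / s)\<^sup>2 * (norm y)\<^sup>2"
  proof -
    have "ray s y t \<bullet> ray s y t = (1 - t) * (v \<bullet> ray s y t) + (t / s) * (y \<bullet> proj (ray s y t))" by (rule inner_ray)
    also have "v \<bullet> ray s y t = 1 - t" using inner_ray_v by (simp add: inner_commute)
    finally show ?thesis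
      unfolding power2_norm_eq_inner by (simp only: proj_ray inner_scaleR_right power2_eq_square mult.assoc)
  qed
  thus ?thesis using s by (simp add: power2_eq_square field_simps)
qed

text \<open>Orthogonally to \<open>v\<close> the point at parameter \<open>t\<close> is scaled by
  \<open>t / s\<close>, with Jacobian \<open>(t / s)\<^sup>2\<close>. By \<open>ray_self\<close> the
  volume density contributes another \<open>1 / t\<^sup>2\<close>, so the powers of \<open>t\<close>
  cancel.\<close>

lemma emeasure_hyp_measure_ray:
  assumes s: "0 < s" and A [measurable]: "A \<in> sets borel"
  shows "emeasure hyp_measure A =
    (\<integral>\<^sup>+y. (\<integral>\<^sup>+t. ennreal (1 / (s\<^sup>2 * (2 - t * (1 + (norm y)\<^sup>2 / s\<^sup>2))\<^sup>2)) *
       indicator {t. 0 < t \<and> t * (1 + (norm y)\<^sup>2 / s\<^sup>2) < 2 \<and> ray s y t \<in> A} t \<partial>lborel) \<partial>lborel)"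
proof -
  let ?k = "\<lambda>y t. ennreal (1 / (s\<^sup>2 * (2 - t * (1 + (norm y)\<^sup>2 / s\<^sup>2))\<^sup>2)) *
       indicator {t. 0 < t \<and> t * (1 + (norm y)\<^sup>2 / s\<^sup>2) < 2 \<and> ray s y t \<in> A} t"
  define g where "g = (\<lambda>x::point. ennreal (indicator hyp_space x / (1 - x \<bullet> x)\<^sup>2) * indicator A x)"
  have [measurable]: "hyp_space \<in> sets borel" by (rule borel_open) simp
  have [measurable]: "(\<lambda>x::point. (1 - x \<bullet> x)\<^sup>2) \<in> borel_measurable borel"
    by (intro borel_measurable_continuous_onI continuous_intros)
  have [measurable]: "g \<in> borel_measurable borel" unfolding g_def by measurable
  define f where "f = (\<lambda>p :: (real \<times> real) \<times> real. lift (fst p) + snd p *\<^sub>R v)"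
  have linf: "linear f"
    unfolding f_def lift_def by (rule linearI) (auto simp: algebra_simps)
  have [measurable]: "f \<in> borel_measurable borel"
    using linf by (simp add: borel_measurable_continuous_onI linear_continuous_on linear_conv_bounded_linear)
  hence [measurable]: "f \<in> borel_measurable (borel \<Otimes>\<^sub>M borel)" by (simp add: borel_prod)
  have [measurable]: "(\<lambda>p. g (f p)) \<in> borel_measurable ((borel :: (real \<times> real) measure) \<Otimes>\<^sub>M (borel :: real measure))"
    by measurable
  have isof: "norm (f p) = norm p" for p
  proof -
    have "f p \<bullet> f p = p \<bullet> p"
      by (simp add: f_def inner_add_left inner_add_right inner_lift norm_v inner_prod_def[of p])
    thus ?thesis by (simp add: norm_eq_sqrt_inner)
  qed
  have df: "distr lborel borel f = lborel"
    by (rule lborel_linear_isometry_vec[OF linf isof]) simp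
  have "emeasure hyp_measure A = (\<integral>\<^sup>+x. g x \<partial>lborel)"
    by (simp add: hyp_measure_def emeasure_density g_def)
  also have "\<dots> = (\<integral>\<^sup>+x. g x \<partial>distr lborel borel f)" by (simp only: df)
  also have "\<dots> = (\<integral>\<^sup>+p. g (f p) \<partial>lborel)" by (rule nn_integral_distr) auto
  also have "\<dots> = (\<integral>\<^sup>+p. g (f p) \<partial>(lborel \<Otimes>\<^sub>M lborel))" by (simp only: lborel_prod)
  also have "\<dots> = (\<integral>\<^sup>+\<tau>. (\<integral>\<^sup>+z. g (f (z, \<tau>)) \<partial>lborel) \<partial>lborel)"
    by (rule lborel_pair.nn_integral_snd[symmetric]) simp
  also have "\<dots> = \<bar>- 1 :: real\<bar> * (\<integral>\<^sup>+t. (\<integral>\<^sup>+z. g (f (z, 1 + (- 1) * t)) \<partial>lborel) \<partial>lborel)"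
    by (rule nn_integral_real_affine) auto
  also have "\<dots> = (\<integral>\<^sup>+t. (\<integral>\<^sup>+z. g (f (z, 1 - t)) \<partial>lborel) \<partial>lborel)" by simp
  also have "\<dots> = (\<integral>\<^sup>+t. (\<integral>\<^sup>+y. ?k y t \<partial>lborel) \<partial>lborel)"
  proof (rule nn_integral_cong)
    fix t :: real
    show "(\<integral>\<^sup>+z. g (f (z, 1 - t)) \<partial>lborel) = (\<integral>\<^sup>+y. ?k y t \<partial>lborel)"
    proof (cases "0 < t")
      case True
      have "(\<integral>\<^sup>+z. g (f (z, 1 - t)) \<partial>lborel) = ennreal ((t / s)\<^sup>2) * (\<integral>\<^sup>+y. g (f ((t / s) *\<^sub>R y, 1 - t)) \<partial>lborel)"
        using True s by (subst nn_integral_lborel_scale[of _ "t / s"]) (auto simp: power2_eq_square)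
      also have "\<dots> = (\<integral>\<^sup>+y. ennreal ((t / s)\<^sup>2) * g (f ((t / s) *\<^sub>R y, 1 - t)) \<partial>lborel)"
        by (rule nn_integral_cmult[symmetric]) auto
      also have "\<dots> = (\<integral>\<^sup>+y. ?k y t \<partial>lborel)"
      proof (rule nn_integral_cong)
        fix y
        have fr: "f ((t / s) *\<^sub>R y, 1 - t) = ray s y t"
          by (simp add: f_def ray_def lift_def algebra_simps)
        define m where "m = 1 + (norm y)\<^sup>2 / s\<^sup>2"
        have self: "1 - ray s y t \<bullet> ray s y t = t * (2 - t * m)" using ray_self[of s y t] s by (simp add: m_def)
        have "ray s y t \<in> hyp_space \<longleftrightarrow> ray s y t \<bullet> ray s y t < 1"
          by (simp add: norm_lt_square)
        also have "\<dots> \<longleftrightarrow> 0 < t * (2 - t * m)" using self by linarith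
        also have "\<dots> \<longleftrightarrow> t * m < 2" using True by (simp add: zero_less_mult_iff)
        finally have hs: "ray s y t \<in> hyp_space \<longleftrightarrow> t * m < 2" .
        have R: "(t / s)\<^sup>2 * (1 / (t * w)\<^sup>2) = 1 / (s\<^sup>2 * w\<^sup>2)" for w
          using True by (simp add: power_divide power_mult_distrib)
        have "ennreal ((t / s)\<^sup>2) * ennreal (1 / (t * (2 - t * m))\<^sup>2) = ennreal (1 / (s\<^sup>2 * (2 - t * m)\<^sup>2))"
          by (subst ennreal_mult[symmetric]) (simp_all only: R zero_le_power2 zero_le_divide_1_iff)
        thus "ennreal ((t / s)\<^sup>2) * g (f ((t / s) *\<^sub>R y, 1 - t)) = ?k y t"
          unfolding fr g_def self m_def[symmetric] using hs True
          by (cases "ray s y t \<in> A"; cases "t * m < 2") (simp_all add: indicator_def)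
      qed
      finally show ?thesis .
    next
      case False
      have "g (f (z, 1 - t)) = 0" for z
      proof -
        have "1 \<le> f (z, 1 - t) \<bullet> v" using False by (simp add: f_def inner_add_left inner_lift norm_v)
        also have "\<dots> \<le> norm (f (z, 1 - t)) * norm v" by (rule norm_cauchy_schwarz)
        also have "norm v = 1" using norm_v by (simp add: norm_eq_1)
        finally show ?thesis by (simp add: g_def)
      qed
      thus ?thesis using False by simp
    qed
  qed
  also have "\<dots> = (\<integral>\<^sup>+y. (\<integral>\<^sup>+t. ?k y t \<partial>lborel) \<partial>lborel)"
  proof (rule lborel_pair.Fubini')
    let ?S = "{p :: (real \<times> real) \<times> real. 0 < snd p \<and> snd p * (1 + (norm (fst p))\<^sup>2 / s\<^sup>2) < 2 \<and> ray s (fst p) (snd p) \<in> A}"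
    have "(\<lambda>p :: (real \<times> real) \<times> real. ray s (fst p) (snd p)) \<in> borel_measurable borel"
      unfolding ray_def lift_def using s by (intro borel_measurable_continuous_onI continuous_intros) auto
    hence [measurable]: "(\<lambda>p. ray s (fst p) (snd p)) \<in> borel_measurable ((borel :: (real \<times> real) measure) \<Otimes>\<^sub>M (borel :: real measure))"
      by (subst borel_prod)
    have "{p \<in> space ((borel :: (real \<times> real) measure) \<Otimes>\<^sub>M (borel :: real measure)).
        0 < snd p \<and> snd p * (1 + (norm (fst p))\<^sup>2 / s\<^sup>2) < 2 \<and> ray s (fst p) (snd p) \<in> A} \<in> sets (borel \<Otimes>\<^sub>M borel)"
      by measurable
    hence [measurable]: "?S \<in> sets (borel \<Otimes>\<^sub>M borel)" by (simp add: space_pair_measure)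
    have "(\<lambda>p. ennreal (1 / (s\<^sup>2 * (2 - snd p * (1 + (norm (fst p))\<^sup>2 / s\<^sup>2))\<^sup>2)) * indicator ?S p)
      \<in> borel_measurable ((borel :: (real \<times> real) measure) \<Otimes>\<^sub>M (borel :: real measure))"
      by measurable
    thus "(\<lambda>(y, t). ?k y t)
       \<in> borel_measurable (lborel \<Otimes>\<^sub>M lborel)"
      by (simp add: case_prod_beta indicator_def)
  qed
  finally show ?thesis .
qed

end

lemma horospherical_frame_exists:
  assumes v: "norm v = 1"
  obtains e1 e2 where "horospherical_frame v e1 e2"
proof -
  have "norm (axis 3 1 :: point) = norm v" using v by simp
  then obtain f :: "point \<Rightarrow> point" where f: "orthogonal_transformation f" "f (axis 3 1) = v"
    by (rule orthogonal_transformation_exists)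
  have inn: "f x \<bullet> f y = x \<bullet> y" for x y using f(1) by (simp add: orthogonal_transformation_def)
  have lin: "linear f" using f(1) by (rule orthogonal_transformation_linear)
  have "horospherical_frame v (f (axis 1 1)) (f (axis 2 1))"
  proof
    fix x :: point
    obtain w where w: "x = f w" using orthogonal_transformation_surj[OF f(1)] unfolding surj_def by blast
    have "w = (w \<bullet> axis 1 1) *\<^sub>R axis 1 1 + (w \<bullet> axis 2 1) *\<^sub>R axis 2 1 + (w \<bullet> axis 3 1) *\<^sub>R axis 3 (1::real)"
    proof -
      have "w \<bullet> axis i 1 = w $ i" for i by (simp add: inner_axis)
      thus ?thesis by (simp add: vec_eq_iff forall_3) (simp add: axis_def)
    qed
    hence "f w = f ((w \<bullet> axis 1 1) *\<^sub>R axis 1 1 + (w \<bullet> axis 2 1) *\<^sub>R axis 2 1 + (w \<bullet> axis 3 1) *\<^sub>R axis 3 1)"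
      by simp
    thus "x = (x \<bullet> f (axis 1 1)) *\<^sub>R f (axis 1 1) + (x \<bullet> f (axis 2 1)) *\<^sub>R f (axis 2 1) + (x \<bullet> v) *\<^sub>R v"
      unfolding f(2)[symmetric] w inn by (simp add: linear_add[OF lin] linear_scale[OF lin])
  qed (auto simp: f(2)[symmetric] inn inner_axis_axis)
  thus ?thesis by (rule that)
qed

section \<open>Polyhedra with non-obtuse dihedral angles\<close>

text \<open>The Lorentz form on pairs of normal and offset. For outward unit normals of facets
  meeting at dihedral angle a it is - cos a; values of at most -1 belong to distinct planes without
  a common point in hyperbolic space.\<close>

definition mink :: "point \<times> real \<Rightarrow> point \<times> real \<Rightarrow> real" where
  "mink m n = fst m \<bullet> fst n - snd m * snd n"

lemma mink_commute: "mink m n = mink n m"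
  by (simp add: mink_def inner_commute mult.commute)

definition side :: "point set \<Rightarrow> point \<times> real \<Rightarrow> point set" where
  "side P n = P \<inter> {x. fst n \<bullet> x = snd n}"

section \<open>Facet planes and perpendicular feet\<close>

lemma midpoint_in_ball:
  fixes x y :: "'a::euclidean_space"
  assumes "x \<in> cball 0 1" "y \<in> cball 0 1" "x \<noteq> y"
  shows "norm (midpoint x y) < 1"
proof -
  have "(norm (x + y))\<^sup>2 + (norm (x - y))\<^sup>2 = 2 * (norm x)\<^sup>2 + 2 * (norm y)\<^sup>2"
    unfolding power2_norm_eq_inner by (simp add: inner_add_left inner_add_right inner_diff_left inner_diff_right inner_commute)
  moreover have "0 < (norm (x - y))\<^sup>2" using assms by simp
  moreover have "(norm x)\<^sup>2 \<le> 1" "(norm y)\<^sup>2 \<le> 1" using assms by (auto simp: power_le_one)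
  ultimately have "(norm (x + y))\<^sup>2 < 4" by linarith
  hence "(norm (x + y))\<^sup>2 < 2\<^sup>2" by simp
  hence "norm (x + y) < 2" by (rule power_less_imp_less_base) simp
  thus ?thesis by (simp add: midpoint_def)
qed

lemma aff_dim_pos_inner_point:
  fixes C :: "point set"
  assumes "convex C" "C \<subseteq> cball 0 1" "1 \<le> aff_dim C"
  obtains x where "x \<in> C" "norm x < 1"
proof -
  have "C \<noteq> {}" using assms(3) by auto
  then obtain x where x: "x \<in> C" by auto
  have "C \<noteq> {x}" using assms(3) by auto
  then obtain y where y: "y \<in> C" "y \<noteq> x" using x by auto
  have "midpoint x y \<in> closed_segment x y" by simp
  hence "midpoint x y \<in> C" using assms(1) x y closed_segment_subset by blast
  moreover have "norm (midpoint x y) < 1" using assms(2) x y by (intro midpoint_in_ball) auto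
  ultimately show ?thesis by (rule that)
qed

text \<open>A facet has dimension 2 and so contains a point of the open ball; its plane meets
  hyperbolic space, which makes the normal spacelike.\<close>

lemma facet_hyperplane_pos:
  assumes "hyp_polyhedron P" "side P (a, b) facet_of P" "a \<noteq> 0"
  shows "0 < a \<bullet> a - b\<^sup>2"
proof -
  have "aff_dim P = 3"
    using assms(1) by (simp add: hyp_polyhedron_def aff_dim_nonempty_interior)
  hence "aff_dim (side P (a, b)) = 2" using assms(2) by (simp add: facet_of_def)
  moreover have "convex (side P (a, b))" "side P (a, b) \<subseteq> cball 0 1"
    using assms(1,2) by (auto simp: hyp_polyhedron_def side_def facet_of_def face_of_imp_convex)
  ultimately obtain x where x: "x \<in> side P (a, b)" "norm x < 1"
    using aff_dim_pos_inner_point[of "side P (a, b)"] by auto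
  have "\<bar>b\<bar> = \<bar>a \<bullet> x\<bar>" using x by (simp add: side_def)
  also have "\<dots> \<le> norm a * norm x" by (rule Cauchy_Schwarz_ineq2)
  also have "\<dots> < norm a * 1" using x assms(3) by (intro mult_strict_left_mono) auto
  finally have "\<bar>b\<bar>\<^sup>2 < (norm a)\<^sup>2" by (intro power_strict_mono) auto
  thus ?thesis by (simp add: power2_norm_eq_inner)
qed

lemma hyperplane_normal_unique:
  fixes a a' :: point
  assumes eq: "{x. a \<bullet> x = b} \<subseteq> {x. a' \<bullet> x = b'}" and a: "a \<noteq> 0"
  obtains r where "a' = r *\<^sub>R a" "b' = r * b"
proof -
  define r where "r = (a' \<bullet> a) / (a \<bullet> a)"
  define x0 where "x0 = (b / (a \<bullet> a)) *\<^sub>R a"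
  define d where "d = a' - r *\<^sub>R a"
  have ad: "a \<bullet> d = 0" using a by (simp add: d_def r_def inner_diff_right inner_commute)
  have "x0 \<in> {x. a \<bullet> x = b}" "x0 + d \<in> {x. a \<bullet> x = b}" using a ad by (simp_all add: x0_def inner_add_right)
  hence "a' \<bullet> x0 = b'" "a' \<bullet> (x0 + d) = b'" using eq by auto
  hence "a' \<bullet> d = 0" by (simp add: inner_add_right)
  hence "d \<bullet> d = 0" using ad by (simp add: d_def inner_diff_left)
  hence "a' = r *\<^sub>R a" by (simp add: d_def)
  moreover from this have "b' = r * b" using \<open>a' \<bullet> x0 = b'\<close> a by (auto simp: x0_def mult.commute)
  ultimately show ?thesis by (rule that)
qed

locale facet_normals =
  fixes P :: "point set" and N :: "(point \<times> real) set"
  assumes poly: "hyp_polyhedron P"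
    and finN: "finite N"
    and P_eq: "P = {x. \<forall>n\<in>N. fst n \<bullet> x \<le> snd n}"
    and unit: "n \<in> N \<Longrightarrow> mink n n = 1"
    and facet: "n \<in> N \<Longrightarrow> side P n facet_of P"
    and facet_ex: "C facet_of P \<Longrightarrow> \<exists>n\<in>N. C = side P n"
begin

lemma polyP: "polyhedron P" and polytopeP: "polytope P" and PB: "P \<subseteq> cball 0 1" and intP: "interior P \<noteq> {}"
  using poly by (auto simp: hyp_polyhedron_def polytope_imp_polyhedron)

lemma aff_dim_P: "aff_dim P = 3"
  using intP by (simp add: aff_dim_nonempty_interior)

lemma normal_nz: "n \<in> N \<Longrightarrow> fst n \<noteq> 0"
proof
  assume "n \<in> N" "fst n = 0"
  hence "- (snd n * snd n) = 1" using unit[of n] by (simp add: mink_def)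
  thus False using zero_le_square[of "snd n"] by linarith
qed

lemma le: "n \<in> N \<Longrightarrow> x \<in> P \<Longrightarrow> fst n \<bullet> x \<le> snd n"
  unfolding P_eq by blast

lemma face_side: "n \<in> N \<Longrightarrow> side P n face_of P"
  using facet by (simp add: facet_of_def)

lemma aff_dim_side: "n \<in> N \<Longrightarrow> aff_dim (side P n) = 2"
  using facet[of n] aff_dim_P by (simp add: facet_of_def)

lemma affine_hull_side: "n \<in> N \<Longrightarrow> affine hull (side P n) = {x. fst n \<bullet> x = snd n}"
proof -
  assume n: "n \<in> N"
  have "aff_dim {x. fst n \<bullet> x = snd n} = 2" using normal_nz[OF n] by simp
  hence "affine hull (side P n) = affine hull {x. fst n \<bullet> x = snd n}"
    using aff_dim_eq_full_gen[of "side P n" "{x. fst n \<bullet> x = snd n}"] aff_dim_side[OF n]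
    by (auto simp: side_def)
  also have "\<dots> = {x. fst n \<bullet> x = snd n}" by (simp add: affine_hyperplane)
  finally show ?thesis .
qed

lemma inner_point_ex: obtains x0 where "norm x0 < 1" "x0 \<in> P" "\<And>n. n \<in> N \<Longrightarrow> fst n \<bullet> x0 < snd n"
proof -
  obtain x0 where x0: "x0 \<in> interior P" using intP by auto
  have "norm x0 < 1" using x0 PB interior_mono[OF PB] by auto
  moreover have "fst n \<bullet> x0 < snd n" if n: "n \<in> N" for n
  proof (rule ccontr)
    assume "\<not> fst n \<bullet> x0 < snd n"
    hence "x0 \<in> side P n" using le[OF n, of x0] x0 interior_subset by (force simp: side_def)
    moreover have "side P n \<noteq> P" using aff_dim_side[OF n] aff_dim_P by auto
    ultimately show False using face_of_disjoint_interior[OF face_side[OF n]] x0 by auto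
  qed
  ultimately show ?thesis using that x0 interior_subset by blast
qed

lemma side_inj:
  assumes n: "n \<in> N" "m \<in> N" "side P n = side P m"
  shows "n = m"
proof -
  obtain x0 where x0: "\<And>n. n \<in> N \<Longrightarrow> fst n \<bullet> x0 < snd n" using inner_point_ex by blast
  have "{x. fst n \<bullet> x = snd n} = {x. fst m \<bullet> x = snd m}"
    using affine_hull_side[OF n(1)] affine_hull_side[OF n(2)] n(3) by simp
  then obtain r where r: "fst m = r *\<^sub>R fst n" "snd m = r * snd n"
    using hyperplane_normal_unique[of "fst n" "snd n" "fst m" "snd m"] normal_nz[OF n(1)] by auto
  have "mink m m = r\<^sup>2 * mink n n" by (simp add: mink_def r power2_eq_square algebra_simps)
  hence "r\<^sup>2 = 1" using unit n by simp
  moreover have "r > 0"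
  proof (rule ccontr)
    assume "\<not> r > 0"
    moreover have "r * (fst n \<bullet> x0) < r * snd n" using x0[OF n(2)] by (simp add: r)
    ultimately show False using x0[OF n(1)] by (simp add: mult_less_cancel_left)
  qed
  ultimately have "r = 1" by (simp add: power2_eq_1_iff)
  thus ?thesis using r by (simp add: prod_eq_iff)
qed

lemma side_not_subset:
  assumes n: "n \<in> N" "m \<in> N" "n \<noteq> m"
  shows "side P n \<inter> side P m \<noteq> side P m"
proof
  assume "side P n \<inter> side P m = side P m"
  hence sub: "side P m \<subseteq> side P n" by blast
  hence "side P m face_of side P n"
    using face_of_face[OF face_side[OF n(1)]] face_side[OF n(2)] by blast
  moreover have "side P m \<noteq> side P n" using side_inj n by metis
  ultimately have "aff_dim (side P m) < aff_dim (side P n)"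
    using face_of_aff_dim_lt[OF face_of_imp_convex[OF face_side[OF n(1)] ]] by blast
  thus False using aff_dim_side n by simp
qed

lemma aff_dim_side_Int:
  assumes n: "n \<in> N" "m \<in> N" "n \<noteq> m"
  shows "aff_dim (side P n \<inter> side P m) < 2" "side P n \<inter> side P m face_of side P m"
proof -
  have f: "side P n \<inter> side P m face_of P" using face_side n by (intro face_of_Int)
  show g: "side P n \<inter> side P m face_of side P m"
    using face_of_face[OF face_side[OF n(2)]] f by blast
  have "aff_dim (side P n \<inter> side P m) < aff_dim (side P m)"
    using face_of_aff_dim_lt[OF face_of_imp_convex[OF face_side[OF n(2)]] g side_not_subset[OF n]] .
  thus "aff_dim (side P n \<inter> side P m) < 2" using aff_dim_side[OF n(2)] by simp
qed

lemma edge_side_Int: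
  assumes n: "n \<in> N" "m \<in> N" "n \<noteq> m" and "1 \<le> aff_dim (side P n \<inter> side P m)"
  shows "(side P n \<inter> side P m) edge_of P"
  using aff_dim_side_Int[OF n] assms(4) face_of_Int[OF face_side[OF n(1)] face_side[OF n(2)]]
  by (simp add: edge_of_def)

text \<open>This is the last coordinate of the Minkowski projection of \<open>(p, 1)\<close> to the
  plane. It is positive for ideal \<open>p\<close> as well, and feet of ideal vertices will be
  used.\<close>

lemma foot_denominator_pos:
  assumes n: "n \<in> N" and p: "p \<in> P"
  shows "0 < 1 + (snd n - fst n \<bullet> p) * snd n"
proof -
  have u: "fst n \<bullet> fst n = 1 + snd n * snd n" using unit[OF n] by (simp add: mink_def)
  have "snd n * (fst n \<bullet> p) \<le> \<bar>snd n\<bar> * \<bar>fst n \<bullet> p\<bar>" by (simp flip: abs_mult)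
  also have "\<dots> \<le> \<bar>snd n\<bar> * (norm (fst n) * norm p)"
    by (intro mult_left_mono Cauchy_Schwarz_ineq2) auto
  also have "\<dots> \<le> \<bar>snd n\<bar> * (norm (fst n) * 1)"
    using p PB by (intro mult_left_mono) auto
  also have "\<dots> < norm (fst n) * norm (fst n)"
  proof -
    have "(snd n)\<^sup>2 < (norm (fst n))\<^sup>2"
      unfolding power2_norm_eq_inner using u by (simp add: power2_eq_square)
    hence "\<bar>snd n\<bar>\<^sup>2 < (norm (fst n))\<^sup>2" by simp
    hence "\<bar>snd n\<bar> < norm (fst n)" by (rule power_less_imp_less_base) simp
    thus ?thesis using normal_nz[OF n] by simp
  qed
  finally show ?thesis using u by (simp add: algebra_simps flip: power2_eq_square power2_norm_eq_inner)
qed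

text \<open>The Minkowski projection of \<open>(p, 1)\<close> to the orthogonal complement of the
  unit normal \<open>n\<close>, rescaled to last coordinate 1: the hyperbolic foot of the
  perpendicular.\<close>

definition foot :: "point \<times> real \<Rightarrow> point \<Rightarrow> point" where
  "foot n p = (1 / (1 + (snd n - fst n \<bullet> p) * snd n)) *\<^sub>R (p + (snd n - fst n \<bullet> p) *\<^sub>R fst n)"

text \<open>Pairing the unscaled projection with a normal \<open>m\<close> is linear, so the sign of
  \<open>mink n m\<close> decides whether projecting to \<open>n\<close> moves towards the plane of
  \<open>m\<close> or away from it.\<close>

lemma foot_eval:
  assumes n: "n \<in> N" and p: "p \<in> P"
  shows "(1 + (snd n - fst n \<bullet> p) * snd n) * (fst m \<bullet> foot n p - snd m)
     = (fst m \<bullet> p - snd m) + (snd n - fst n \<bullet> p) * mink n m"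
proof -
  define g where "g = snd n - fst n \<bullet> p"
  define D where "D = 1 + g * snd n"
  have D: "D > 0" using foot_denominator_pos[OF n p] by (simp add: D_def g_def)
  have "D * (fst m \<bullet> foot n p) = fst m \<bullet> p + g * (fst m \<bullet> fst n)"
    using D unfolding foot_def g_def[symmetric] D_def[symmetric] by (simp add: inner_add_right)
  thus ?thesis unfolding g_def[symmetric] D_def[symmetric] mink_def
    by (simp add: D_def algebra_simps inner_commute)
qed

end

locale acute_cell = facet_normals +
  assumes acute_adjacent: "n \<in> N \<Longrightarrow> m \<in> N \<Longrightarrow> n \<noteq> m \<Longrightarrow> (side P n \<inter> side P m) edge_of P \<Longrightarrow> mink n m = 0 \<or> mink n m = - 1 / 2"
    and ideal: "vertices P \<subseteq> sphere 0 1"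
begin

text \<open>
  If the foot lay outside the facet, the segment to it from inside the facet would leave the facet
  through an edge; as the dihedral angle there is not obtuse, projecting to the facet does not lead
  across the adjacent one.
\<close>

lemma foot_in_side:
  assumes n: "n \<in> N" and p: "p \<in> P"
  shows "foot n p \<in> side P n"
proof (rule ccontr)
  define C where "C = side P n"
  define f where "f = foot n p"
  assume "foot n p \<notin> side P n"
  hence fC: "f \<notin> C" by (simp add: f_def C_def)
  have D: "0 < 1 + (snd n - fst n \<bullet> p) * snd n" by (rule foot_denominator_pos[OF n p])
  have "(1 + (snd n - fst n \<bullet> p) * snd n) * (fst n \<bullet> f - snd n) = 0"
    unfolding f_def foot_eval[OF n p] using unit[OF n] by simp
  hence fn: "fst n \<bullet> f = snd n" using D by auto
  have Cconv: "convex C" "C face_of P" using face_side[OF n] by (auto simp: C_def face_of_imp_convex)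
  have "polytope C" using Cconv polytopeP face_of_polytope_polytope by blast
  hence Cp: "polyhedron C" "bounded C" "closed C"
    by (auto simp: polytope_imp_polyhedron polytope_imp_bounded polytope_imp_closed)
  have "C \<noteq> {}" using facet[OF n] by (simp add: C_def facet_of_def)
  then obtain x0 where x0: "x0 \<in> rel_interior C" using Cconv rel_interior_eq_empty by blast
  have x0C: "x0 \<in> C" using x0 rel_interior_subset by blast
  have ne: "f - x0 \<noteq> 0" using x0C fC by auto
  have aff: "x0 + (f - x0) \<in> affine hull C" using fn affine_hull_side[OF n] by (simp add: C_def)
  obtain d where d: "0 < d" "x0 + d *\<^sub>R (f - x0) \<in> rel_frontier C"
    "\<And>e. 0 \<le> e \<Longrightarrow> e < d \<Longrightarrow> x0 + e *\<^sub>R (f - x0) \<in> rel_interior C"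
    using ray_to_rel_frontier[OF Cp(2) x0 aff ne] by blast
  define z where "z = x0 + d *\<^sub>R (f - x0)"
  have zC: "z \<in> C" using d(2) Cp by (auto simp: z_def rel_frontier_def closure_closed)
  have "d < 1"
  proof (rule ccontr)
    assume "\<not> d < 1"
    then consider "d = 1" | "1 < d" by linarith
    hence "f \<in> C"
    proof cases
      case 1
      thus ?thesis using zC by (simp add: z_def)
    next
      case 2
      thus ?thesis using d(3)[of 1] rel_interior_subset by auto
    qed
    thus False using fC by simp
  qed
  obtain E where E: "E facet_of C" "z \<in> E"
    using d(2) rel_frontier_of_polyhedron[OF Cp(1)] by (auto simp: z_def)
  have Edim: "aff_dim E = 1" "E face_of C" using E aff_dim_side[OF n] by (auto simp: facet_of_def C_def)
  have EP: "E face_of P" using Edim Cconv face_of_trans by blast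
  have "E \<noteq> {}" "E \<noteq> P" "E \<noteq> C" using Edim E aff_dim_P aff_dim_side[OF n] by (auto simp: C_def)
  \<comment> \<open>The edge through which the segment leaves is the intersection of the facets
    containing it, so one of them does not contain \<open>C\<close>: the adjacent facet across this
    edge.\<close>
  hence "E = \<Inter>{F. F facet_of P \<and> E \<subseteq> F}" using face_of_polyhedron[OF polyP EP] by blast
  then obtain G where G: "G facet_of P" "E \<subseteq> G" "\<not> C \<subseteq> G"
    using \<open>E \<noteq> C\<close> face_of_imp_subset[OF Edim(2)] by blast
  then obtain m where m: "m \<in> N" "G = side P m" using facet_ex by blast
  have nm: "m \<noteq> n" using m G C_def by auto
  have "E \<subseteq> side P m \<inter> side P n" using G m face_of_imp_subset[OF Edim(2)] by (auto simp: C_def)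
  hence "1 \<le> aff_dim (side P m \<inter> side P n)" using Edim aff_dim_subset by metis
  hence "(side P m \<inter> side P n) edge_of P" using edge_side_Int m n nm by blast
  hence ac: "mink n m \<le> 0" using acute_adjacent[OF m(1) n nm] by (auto simp: mink_commute)
  have "x0 \<notin> side P m"
  proof
    assume "x0 \<in> side P m"
    moreover have "side P m \<inter> side P n \<noteq> side P n" using side_not_subset[OF m(1) n nm] .
    ultimately show False
      using face_of_disjoint_rel_interior[OF aff_dim_side_Int(2)[OF m(1) n nm]] x0 x0C by (auto simp: C_def)
  qed
  hence "fst m \<bullet> x0 < snd m" using le[OF m(1), of x0] x0C by (force simp: C_def side_def)
  moreover have "fst m \<bullet> z = snd m" using E G m by (auto simp: side_def)
  hence "fst m \<bullet> x0 + d * (fst m \<bullet> f - fst m \<bullet> x0) = snd m" by (simp add: z_def inner_add_right inner_diff_right)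
  ultimately have "snd m < fst m \<bullet> f"
  proof -
    assume a: "fst m \<bullet> x0 < snd m" "fst m \<bullet> x0 + d * (fst m \<bullet> f - fst m \<bullet> x0) = snd m"
    define q where "q = fst m \<bullet> f - fst m \<bullet> x0"
    have "0 < d * q" using a unfolding q_def[symmetric] by linarith
    hence "0 < q" using d(1) by (simp add: zero_less_mult_iff)
    hence "d * q < 1 * q" using \<open>d < 1\<close> by (intro mult_strict_right_mono)
    hence "fst m \<bullet> x0 + d * q < fst m \<bullet> x0 + q" by simp
    thus ?thesis using a(2) unfolding q_def[symmetric] by (simp add: q_def)
  qed
  \<comment> \<open>The foot lies beyond the plane of \<open>m\<close>, but both terms of the
    evaluation are nonpositive: \<open>p\<close> is in the cell and the angle at the edge is not
    obtuse.\<close>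
  hence "0 < (1 + (snd n - fst n \<bullet> p) * snd n) * (fst m \<bullet> f - snd m)" using D by simp
  also have "\<dots> = (fst m \<bullet> p - snd m) + (snd n - fst n \<bullet> p) * mink n m"
    unfolding f_def by (rule foot_eval[OF n p])
  also have "\<dots> \<le> 0"
  proof -
    have "(snd n - fst n \<bullet> p) * mink n m \<le> 0" using le[OF n p] ac by (intro mult_nonneg_nonpos) auto
    thus ?thesis using le[OF m(1) p] by linarith
  qed
  finally show False by simp
qed

text \<open>Test with a point of facet \<open>m\<close> off facet \<open>n\<close>: its foot on
  \<open>n\<close> stays in the cell, so projecting cannot cross \<open>m\<close>. This carries the
  sign from adjacent facets to all pairs.\<close>

lemma mink_nonpos:
  assumes n: "n \<in> N" "m \<in> N" "n \<noteq> m"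
  shows "mink n m \<le> 0"
proof -
  obtain x where x: "x \<in> side P m" "x \<notin> side P n" using side_not_subset[OF n] by blast
  have xP: "x \<in> P" "fst m \<bullet> x = snd m" using x by (auto simp: side_def)
  have g: "0 < snd n - fst n \<bullet> x" using x(2) xP le[OF n(1) xP(1)] by (auto simp: side_def)
  have "fst m \<bullet> foot n x \<le> snd m"
    using foot_in_side[OF n(1) xP(1)] le[OF n(2)] by (auto simp: side_def)
  hence "(1 + (snd n - fst n \<bullet> x) * snd n) * (fst m \<bullet> foot n x - snd m) \<le> 0"
    using foot_denominator_pos[OF n(1) xP(1)] by (intro mult_nonneg_nonpos) auto
  hence "(snd n - fst n \<bullet> x) * mink n m \<le> 0" unfolding foot_eval[OF n(1) xP(1)] using xP by simp
  thus ?thesis using g by (simp add: mult_le_0_iff)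
qed

text \<open>
  Unless the product is at most \<open>-1\<close>, the two planes meet in hyperbolic space, and projecting an
  inner point of the cell to both of them at once shows that they do so in an edge of the cell.
\<close>

lemma mink_cases:
  assumes n: "n \<in> N" "m \<in> N" "n \<noteq> m"
  shows "mink n m = 0 \<or> mink n m \<le> - 1 / 2"
proof (cases "mink n m \<le> - 1")
  case False
  define c where "c = - mink n m"
  have c: "0 \<le> c" "c < 1" using False mink_nonpos[OF n] by (auto simp: c_def)
  hence c2: "0 < 1 - c\<^sup>2" by (simp add: power2_eq_square mult_strict_mono[of c 1 c 1, simplified])
  obtain x where x: "norm x < 1" "x \<in> P" "\<And>n. n \<in> N \<Longrightarrow> fst n \<bullet> x < snd n" using inner_point_ex by blast
  define g h where "g = snd n - fst n \<bullet> x" and "h = snd m - fst m \<bullet> x"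
  have gh: "0 < g" "0 < h" using x(3) n by (auto simp: g_def h_def)
  \<comment> \<open>The solution of the linear system that makes
    \<open>(x, 1) + al * n + be * m\<close> orthogonal to both normals; \<open>0 \<le> c < 1\<close>
    makes the coefficients positive.\<close>
  define al be where "al = (g + c * h) / (1 - c\<^sup>2)" and "be = (h + c * g) / (1 - c\<^sup>2)"
  have lm: "0 < al" "0 < be" using gh c c2 by (auto simp: al_def be_def intro!: divide_pos_pos add_pos_nonneg)
  have e1: "al - c * be = g" and e2: "be - c * al = h"
  proof -
    have "al * (1 - c\<^sup>2) = g + c * h" "be * (1 - c\<^sup>2) = h + c * g" using c2 by (auto simp: al_def be_def)
    hence "(al - c * be) * (1 - c\<^sup>2) = g * (1 - c\<^sup>2)" "(be - c * al) * (1 - c\<^sup>2) = h * (1 - c\<^sup>2)"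
      by (simp_all add: left_diff_distrib mult.assoc) (simp_all add: algebra_simps power2_eq_square)
    thus "al - c * be = g" "be - c * al = h" using c2 by auto
  qed
  define y where "y = x + al *\<^sub>R fst n + be *\<^sub>R fst m"
  define t where "t = 1 + al * snd n + be * snd m"
  have ev: "fst k \<bullet> y - t * snd k = (fst k \<bullet> x - snd k) + al * mink n k + be * mink m k" for k
    by (simp add: y_def t_def mink_def inner_add_right algebra_simps inner_commute)
  have evn: "fst n \<bullet> y = t * snd n"
  proof -
    have "fst n \<bullet> y - t * snd n = - g + (al - c * be)"
      unfolding ev using unit[OF n(1)] by (simp add: g_def c_def mink_commute)
    thus ?thesis using e1 by simp
  qed
  have evm: "fst m \<bullet> y = t * snd m"
  proof -
    have "fst m \<bullet> y - t * snd m = - h + (be - c * al)"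
      unfolding ev using unit[OF n(2)] by (simp add: h_def c_def)
    thus ?thesis using e2 by simp
  qed
  \<comment> \<open>\<open>(y, t)\<close> is an orthogonal projection of \<open>(x, 1)\<close>, so
    its square is its product with \<open>(x, 1)\<close>. This product is negative, hence the
    projection is timelike and yields a point of hyperbolic space.\<close>
  have yy: "y \<bullet> y - t * t = x \<bullet> y - t"
    by (subst (1) y_def, subst (2) t_def) (simp add: inner_add_left evn evm algebra_simps)
  have xy: "x \<bullet> y - t < 0"
  proof -
    have "x \<bullet> y - t = (x \<bullet> x - 1) - al * g - be * h"
      by (simp add: y_def t_def g_def h_def inner_add_right algebra_simps inner_commute)
    moreover have "x \<bullet> x < 1" using x(1) by (simp add: norm_lt_square)
    moreover have "0 < al * g" "0 < be * h" using lm gh by auto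
    ultimately show ?thesis by linarith
  qed
  have ny: "norm y < \<bar>t\<bar>"
  proof -
    have "(norm y)\<^sup>2 < \<bar>t\<bar>\<^sup>2" unfolding power2_norm_eq_inner power2_abs power2_eq_square[of t] using yy xy by linarith
    thus ?thesis by (rule power_less_imp_less_base) simp
  qed
  have t: "0 < t"
  proof (rule ccontr)
    assume "\<not> 0 < t"
    hence "\<bar>t\<bar> < - (x \<bullet> y)" using xy by simp
    also have "\<dots> \<le> norm x * norm y" using Cauchy_Schwarz_ineq2[of x y] by linarith
    also have "\<dots> \<le> 1 * norm y" using x(1) by (intro mult_right_mono) auto
    finally show False using ny by simp
  qed
  define w where "w = (1 / t) *\<^sub>R y"
  have nw: "norm w < 1" using ny t by (simp add: w_def)
  have wk: "fst k \<bullet> w \<le> snd k \<longleftrightarrow> fst k \<bullet> y - t * snd k \<le> 0" for k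
    using t by (simp add: w_def field_simps)
  have "fst k \<bullet> w \<le> snd k" if k: "k \<in> N" for k
  proof (cases "k = n \<or> k = m")
    case True
    thus ?thesis unfolding wk using evn evm by auto
  next
    case False
    have "mink n k \<le> 0" "mink m k \<le> 0"
      using False mink_nonpos[OF n(1) k] mink_nonpos[OF n(2) k] by blast+
    hence "al * mink n k \<le> 0" "be * mink m k \<le> 0"
      using lm by (simp_all add: mult_nonneg_nonpos)
    thus ?thesis unfolding wk ev using x(3)[OF k] by linarith
  qed
  hence "w \<in> P" unfolding P_eq by blast
  moreover have "fst n \<bullet> w = snd n" "fst m \<bullet> w = snd m" using t evn evm by (auto simp: w_def)
  ultimately have wE: "w \<in> side P n \<inter> side P m" by (simp add: side_def)
  \<comment> \<open>An intersection in a single point would be a vertex; vertices are ideal, but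
    \<open>w\<close> is not.\<close>
  have "1 \<le> aff_dim (side P n \<inter> side P m)"
  proof (rule ccontr)
    assume "\<not> 1 \<le> aff_dim (side P n \<inter> side P m)"
    moreover have "0 \<le> aff_dim (side P n \<inter> side P m)"
      using wE aff_dim_geq[of "side P n \<inter> side P m"] aff_dim_empty[of "side P n \<inter> side P m"] by force
    ultimately have "aff_dim (side P n \<inter> side P m) = 0" by linarith
    hence "side P n \<inter> side P m = {w}" using wE by (metis aff_dim_eq_0 singletonD)
    hence "w extreme_point_of P"
      using face_of_Int[OF face_side[OF n(1)] face_side[OF n(2)]] face_of_singleton by metis
    hence "norm w = 1" using ideal by (auto simp: vertices_def)
    thus False using nw by simp
  qed
  thus ?thesis using edge_side_Int[OF n] acute_adjacent[OF n] by auto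
qed auto

end


section \<open>Unit normals of the regular cell\<close>

lemma facet_normals_exist:
  assumes P: "hyp_polyhedron P"
  obtains N where "facet_normals P N"
proof -
  have "polyhedron P" and "interior P \<noteq> {}"
    using P by (auto simp: hyp_polyhedron_def polytope_imp_polyhedron)
  hence affP: "affine hull P = UNIV" by (metis aff_dim_eq_full aff_dim_nonempty_interior)
  obtain F where F: "finite F" "P = affine hull P \<inter> \<Inter>F"
    "\<And>h. h \<in> F \<Longrightarrow> \<exists>a b. a \<noteq> 0 \<and> h = {x. a \<bullet> x \<le> b}"
    "\<And>F'. F' \<subset> F \<Longrightarrow> P \<subset> affine hull P \<inter> \<Inter>F'"
    using \<open>polyhedron P\<close> by (simp add: polyhedron_Int_affine_minimal) meson
  then obtain a b where ab: "\<And>h. h \<in> F \<Longrightarrow> a h \<noteq> 0 \<and> h = {x. a h \<bullet> x \<le> b h}"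
    by metis
  have fac: "C facet_of P \<longleftrightarrow> (\<exists>h. h \<in> F \<and> C = P \<inter> {x. a h \<bullet> x = b h})" for C
    using facet_of_polyhedron_explicit[OF F(1,2) ab F(4)] by blast
  define r where "r = (\<lambda>h. sqrt (a h \<bullet> a h - (b h)\<^sup>2))"
  define n where "n = (\<lambda>h. ((1 / r h) *\<^sub>R a h, b h / r h))"
  have r: "0 < r h" "(r h)\<^sup>2 = a h \<bullet> a h - (b h)\<^sup>2" if "h \<in> F" for h
  proof -
    have "side P (a h, b h) facet_of P" using fac that by (auto simp: side_def)
    hence "0 < a h \<bullet> a h - (b h)\<^sup>2" using facet_hyperplane_pos[OF P] ab[OF that] by blast
    thus "0 < r h" "(r h)\<^sup>2 = a h \<bullet> a h - (b h)\<^sup>2" by (auto simp: r_def)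
  qed
  have lei: "fst (n h) \<bullet> x \<le> snd (n h) \<longleftrightarrow> a h \<bullet> x \<le> b h" and eqi: "fst (n h) \<bullet> x = snd (n h) \<longleftrightarrow> a h \<bullet> x = b h"
    if "h \<in> F" for h x
    using r(1)[OF that] by (auto simp: n_def field_simps)
  have "facet_normals P (n ` F)"
  proof
    show "P = {x. \<forall>m\<in>n ` F. fst m \<bullet> x \<le> snd m}"
    proof (intro set_eqI)
      fix x
      have "x \<in> P \<longleftrightarrow> (\<forall>h\<in>F. x \<in> h)" by (subst F(2)) (simp add: affP)
      also have "\<dots> \<longleftrightarrow> (\<forall>h\<in>F. a h \<bullet> x \<le> b h)" using ab by (intro ball_cong refl) blast
      also have "\<dots> \<longleftrightarrow> (\<forall>h\<in>F. fst (n h) \<bullet> x \<le> snd (n h))" using lei by (intro ball_cong refl) blast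
      finally show "x \<in> P \<longleftrightarrow> x \<in> {x. \<forall>m\<in>n ` F. fst m \<bullet> x \<le> snd m}" by simp
    qed
    have sd: "side P (n h) = P \<inter> {x. a h \<bullet> x = b h}" if "h \<in> F" for h
      using eqi[OF that] by (auto simp: side_def)
    show "side P m facet_of P" if "m \<in> n ` F" for m using that sd fac by auto
    show "\<exists>m\<in>n ` F. C = side P m" if "C facet_of P" for C
    proof -
      obtain h where "h \<in> F" "C = P \<inter> {x. a h \<bullet> x = b h}" using fac \<open>C facet_of P\<close> by blast
      thus ?thesis using sd by blast
    qed
    show "mink m m = 1" if "m \<in> n ` F" for m
    proof -
      obtain h where h: "h \<in> F" "m = n h" using \<open>m \<in> n ` F\<close> by blast
      have "mink m m = (a h \<bullet> a h - (b h)\<^sup>2) / (r h)\<^sup>2"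
        by (simp add: h n_def mink_def power2_eq_square diff_divide_distrib)
      thus ?thesis using r[OF h(1)] by auto
    qed
  qed (use P F in auto)
  thus ?thesis by (rule that)
qed

lemma regular_cell_acute:
  assumes cell: "regular_cell p q r P" and r: "r = 4 \<or> r = 6" and ideal: "vertices P \<subseteq> sphere 0 1"
  obtains N where "acute_cell P N"
proof -
  have P: "hyp_polyhedron P" and ang: "all_dihedral_angles P (2 * pi / real r)"
    using cell by (auto simp: regular_cell_def)
  obtain N where "facet_normals P N" using facet_normals_exist[OF P] .
  then interpret facet_normals P N .
  have "acute_cell P N"
  proof
    fix n m assume n: "n \<in> N" "m \<in> N" "n \<noteq> m" and E: "(side P n \<inter> side P m) edge_of P"
    have "aff_dim (side P n \<inter> side P m) = 1" "convex (side P n \<inter> side P m)"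
      using E by (auto simp: edge_of_def face_of_imp_convex)
    then obtain x where x: "x \<in> side P n \<inter> side P m" "norm x < 1"
      using aff_dim_pos_inner_point[of "side P n \<inter> side P m"] PB by (force simp: side_def)
    define a b c d where "a = fst n" and "b = snd n" and "c = fst m" and "d = snd m"
    have u: "a \<bullet> a - b * b = 1" "c \<bullet> c - d * d = 1" and cc: "mink n m = a \<bullet> c - b * d"
      using unit[OF n(1)] unit[OF n(2)] by (auto simp: mink_def a_def b_def c_def d_def)
    have ax: "a \<bullet> x = b" "c \<bullet> x = d" using x by (auto simp: side_def a_def b_def c_def d_def)
    \<comment> \<open>\<open>arccos\<close> can be inverted only on [-1, 1]. Both normals are
      orthogonal to the timelike \<open>(x, 1)\<close>, where \<open>x\<close> is an inner point of
      the edge; on such vectors the form is nonnegative, and their sum and difference bound the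
      product.\<close>
    have psd: "0 \<le> y \<bullet> y - (y \<bullet> x) * (y \<bullet> x)" for y
    proof -
      have "(y \<bullet> x)\<^sup>2 \<le> (y \<bullet> y) * (x \<bullet> x)" by (rule Cauchy_Schwarz_ineq)
      also have "\<dots> \<le> (y \<bullet> y) * 1" using x(2) by (intro mult_left_mono) (auto simp: norm_lt_square)
      finally show ?thesis by (simp add: power2_eq_square)
    qed
    have "0 \<le> 2 + 2 * (a \<bullet> c - b * d)" "0 \<le> 2 - 2 * (a \<bullet> c - b * d)"
      using psd[of "a + c"] psd[of "a - c"] u
      by (simp_all add: inner_add_left inner_add_right inner_diff_left inner_diff_right ax inner_commute algebra_simps)
    hence bnd: "\<bar>mink n m\<bar> \<le> 1" unfolding cc by auto
    have "hyp_wedge_angle a b c d = 2 * pi / real r"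
      using ang[unfolded all_dihedral_angles_def, rule_format, of "side P n" "side P m" a b c d]
        facet[OF n(1)] facet[OF n(2)] E le[OF n(1)] le[OF n(2)]
      by (auto simp: side_def a_def b_def c_def d_def)
    moreover have "hyp_wedge_angle a b c d = arccos (- mink n m)"
      using u by (simp add: hyp_wedge_angle_def cc power2_eq_square)
    ultimately have "- mink n m = cos (2 * pi / real r)"
      using bnd by (metis abs_le_iff abs_minus_cancel cos_arccos minus_le_iff)
    moreover have "cos (2 * pi / real r) = 0 \<or> cos (2 * pi / real r) = 1 / 2"
      using r by (auto simp: cos_60 field_simps)
    ultimately show "mink n m = 0 \<or> mink n m = - 1 / 2" by auto
  qed (use ideal in auto)
  thus ?thesis by (rule that)
qed

section \<open>Horoballs and Voronoi regions in the cell\<close>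

lemma inner_less_1: "x \<in> hyp_space \<longleftrightarrow> x \<bullet> x < 1"
  by (simp add: norm_lt_square)

lemma open_horoball_subset_interior:
  "{x \<in> hyp_space. (1 - x \<bullet> u) / sqrt (1 - x \<bullet> x) < s} \<subseteq> interior (horoball u s)"
proof (rule interior_maximal)
  let ?f = "\<lambda>x. (1 - x \<bullet> u) / sqrt (1 - x \<bullet> x)"
  have "sqrt (1 - x \<bullet> x) \<noteq> 0" if "x \<in> hyp_space" for x
    using that unfolding inner_less_1 by simp
  hence "continuous_on hyp_space ?f" by (intro continuous_intros) auto
  hence "open (hyp_space \<inter> ?f -` {..<s})" by (intro continuous_open_preimage) auto
  moreover have "hyp_space \<inter> ?f -` {..<s} = {x \<in> hyp_space. ?f x < s}" by auto
  ultimately show "open {x \<in> hyp_space. ?f x < s}" by simp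
qed (auto simp: horoball_def)

lemma measurable_horoball [measurable]: "horoball u s \<in> sets borel"
proof -
  have [measurable]: "(\<lambda>x::point. x \<bullet> u) \<in> borel_measurable borel" "(\<lambda>x::point. x \<bullet> x) \<in> borel_measurable borel"
    by (intro borel_measurable_continuous_onI continuous_intros)+
  have "{x \<in> space borel. x \<bullet> x < 1 \<and> (1 - x \<bullet> u) / sqrt (1 - x \<bullet> x) \<le> s} \<in> sets borel" by measurable
  thus ?thesis by (simp add: horoball_def inner_less_1 del: mem_ball)
qed

text \<open>The witness of the intersection lies on the line joining the two centres.\<close>

lemma disjoint_horoballs:
  assumes v: "norm v = 1" "norm w = 1" "v \<noteq> w" and s: "0 < s" "0 < s'"
    and disj: "interior (horoball v s) \<inter> interior (horoball w s') = {}"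
  shows "s * s' \<le> (1 - v \<bullet> w) / 2"
proof (rule ccontr)
  define k where "k = (1 - v \<bullet> w) / 2"
  assume "\<not> s * s' \<le> (1 - v \<bullet> w) / 2"
  hence k: "k < s * s'" by (simp add: k_def)
  have vw: "v \<bullet> v = 1" "w \<bullet> w = 1" "v \<bullet> w = 1 - 2 * k" "w \<bullet> v = 1 - 2 * k"
    using v by (simp_all add: norm_eq_1 k_def inner_commute[of w v] field_simps)
  have "0 < (v - w) \<bullet> (v - w)" using v by simp
  hence k0: "0 < k" by (simp add: inner_diff_left inner_diff_right vw)
  \<comment> \<open>This ratio balances the two conditions: the levels seen from the two centres are
    \<open>sqrt (k * s / s')\<close> and \<open>sqrt (k * s' / s)\<close>, so both memberships
    amount to \<open>k < s * s'\<close>.\<close>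
  define l where "l = s / (s + s')"
  have l: "0 < l" "l < 1" "1 - l = s' / (s + s')" using s by (auto simp: l_def field_simps)
  define x where "x = (1 - l) *\<^sub>R v + l *\<^sub>R w"
  have xv: "1 - x \<bullet> v = 2 * l * k" and xw: "1 - x \<bullet> w = 2 * (1 - l) * k"
    by (simp_all add: x_def inner_add_left vw algebra_simps)
  have xx: "1 - x \<bullet> x = 4 * (l * (1 - l)) * k"
    by (simp add: x_def inner_add_left inner_add_right vw algebra_simps)
  have pos: "0 < l * (1 - l) * k" using l(1,2) k0 by simp
  have sq: "sqrt (1 - x \<bullet> x) = 2 * sqrt (l * (1 - l) * k)"
    unfolding xx by (simp add: real_sqrt_mult)
  have ball: "x \<in> hyp_space" unfolding inner_less_1 using xx pos by simp
  have bound: "a * k < \<sigma> * sqrt (a * b * k)" if "0 < a" "0 < \<sigma>" "k * a < \<sigma>\<^sup>2 * b" for a b \<sigma>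
  proof -
    have "(a * k) * (k * a) < (a * k) * (\<sigma>\<^sup>2 * b)" using that k0 by (intro mult_strict_left_mono) auto
    hence "(a * k)\<^sup>2 < \<sigma>\<^sup>2 * (a * b * k)" by (simp add: power2_eq_square mult_ac)
    hence "sqrt ((a * k)\<^sup>2) < sqrt (\<sigma>\<^sup>2 * (a * b * k))" by (rule real_sqrt_less_mono)
    thus ?thesis using that k0 by (simp add: real_sqrt_mult)
  qed
  have ls: "s * (1 - l) = s' * l" unfolding l(3) by (simp add: l_def)
  have "s\<^sup>2 * (1 - l) = (s * s') * l" unfolding power2_eq_square mult.assoc ls by simp
  hence 1: "l * k < s * sqrt (l * (1 - l) * k)" using l(1) s k by (intro bound) auto
  have "s'\<^sup>2 * l = (s * s') * (1 - l)" unfolding power2_eq_square mult.assoc ls[symmetric] by simp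
  hence "(1 - l) * k < s' * sqrt ((1 - l) * l * k)" using l(2) s k by (intro bound) auto
  hence 2: "(1 - l) * k < s' * sqrt (l * (1 - l) * k)" by (simp only: mult.commute[of "1 - l" l])
  have "x \<in> {x \<in> hyp_space. (1 - x \<bullet> v) / sqrt (1 - x \<bullet> x) < s}"
    unfolding mem_Collect_eq xv sq using ball pos 1 by (simp add: field_simps)
  moreover have "x \<in> {x \<in> hyp_space. (1 - x \<bullet> w) / sqrt (1 - x \<bullet> x) < s'}"
    unfolding mem_Collect_eq xw sq using ball pos 2 by (simp add: field_simps)
  ultimately show False using disj open_horoball_subset_interior by blast
qed

text \<open>The foot from the ideal point \<open>v\<close> is the point of the plane deepest in the
  horoballs at \<open>v\<close>, at level \<open>snd n - fst n \<bullet> v\<close>. By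
  \<open>foot_in_side\<close> it belongs to the facet, so a horoball avoiding the facet avoids the
  plane.\<close>

lemma (in acute_cell) horoball_below_side:
  assumes v: "v \<in> P" "norm v = 1" and n: "n \<in> N" "fst n \<bullet> v < snd n"
    and disj: "interior (horoball v s) \<inter> side P n = {}"
  shows "s \<le> snd n - fst n \<bullet> v"
proof (rule ccontr)
  define g where "g = snd n - fst n \<bullet> v"
  define D where "D = 1 + g * snd n"
  assume "\<not> s \<le> snd n - fst n \<bullet> v"
  hence gs: "g < s" by (simp add: g_def)
  have g: "0 < g" using n by (simp add: g_def)
  have D: "0 < D" using foot_denominator_pos[OF n(1) v(1)] by (simp add: D_def g_def)
  define f where "f = foot n v"
  have f: "f = (1 / D) *\<^sub>R (v + g *\<^sub>R fst n)" by (simp add: f_def foot_def g_def D_def)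
  have nn: "fst n \<bullet> fst n = 1 + snd n * snd n" using unit[OF n(1)] by (simp add: mink_def)
  have nv: "fst n \<bullet> v = snd n - g" "v \<bullet> fst n = snd n - g" "v \<bullet> v = 1"
    using v by (auto simp: g_def inner_commute norm_eq_1)
  have "(v + g *\<^sub>R fst n) \<bullet> v = D - g\<^sup>2"
    by (simp add: inner_add_left nv D_def power2_eq_square algebra_simps)
  moreover have "f \<bullet> v = ((v + g *\<^sub>R fst n) \<bullet> v) / D" by (simp add: f)
  ultimately have fv: "1 - f \<bullet> v = g\<^sup>2 / D" using D by (simp add: diff_divide_distrib)
  have "(v + g *\<^sub>R fst n) \<bullet> (v + g *\<^sub>R fst n) = D\<^sup>2 - g\<^sup>2"
    by (simp add: inner_add_left inner_add_right nv nn D_def power2_eq_square algebra_simps)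
  moreover have "f \<bullet> f = ((v + g *\<^sub>R fst n) \<bullet> (v + g *\<^sub>R fst n)) / D\<^sup>2"
    by (simp add: f power2_eq_square)
  ultimately have ff: "1 - f \<bullet> f = (g / D)\<^sup>2" using D by (simp add: diff_divide_distrib power_divide)
  have "f \<in> hyp_space" unfolding inner_less_1 using ff g D by (metis diff_gt_0_iff_gt divide_pos_pos zero_less_power)
  moreover have "(1 - f \<bullet> v) / sqrt (1 - f \<bullet> f) = g"
  proof -
    have "sqrt ((g / D)\<^sup>2) = g / D" using g D by simp
    thus ?thesis unfolding fv ff using g D by (simp add: power2_eq_square)
  qed
  ultimately have "f \<in> interior (horoball v s)" using open_horoball_subset_interior[of v s] gs by auto
  moreover have "f \<in> side P n" unfolding f_def using foot_in_side n v by blast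
  ultimately show False using disj by blast
qed

locale cell_with_horoballs = acute_cell +
  fixes s :: "point \<Rightarrow> real"
  assumes s_pos: "v \<in> vertices P \<Longrightarrow> 0 < s v"
    and s_pair: "v \<in> vertices P \<Longrightarrow> w \<in> vertices P \<Longrightarrow> v \<noteq> w \<Longrightarrow> s v * s w \<le> (1 - v \<bullet> w) / 2"
    and s_side: "v \<in> vertices P \<Longrightarrow> n \<in> N \<Longrightarrow> fst n \<bullet> v < snd n \<Longrightarrow> s v \<le> snd n - fst n \<bullet> v"
begin

text \<open>The comparison is between Busemann levels divided by \<open>s\<close>, that is, signed
  distances to the horospheres. The factor \<open>sqrt (1 - x \<bullet> x)\<close> cancels, which
  leaves linear conditions.\<close>

definition voronoi :: "point \<Rightarrow> point set" where
  "voronoi v = {x \<in> P. \<forall>w\<in>vertices P - {v}. (1 - x \<bullet> v) * s w < (1 - x \<bullet> w) * s v}"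

lemma finite_vertices: "finite (vertices P)"
  unfolding vertices_def using polyP by (rule finite_polyhedron_extreme_points)

lemma vertexD: "v \<in> vertices P \<Longrightarrow> v \<in> P" "v \<in> vertices P \<Longrightarrow> norm v = 1" "v \<in> vertices P \<Longrightarrow> v \<bullet> v = 1"
  using ideal by (auto simp: vertices_def extreme_point_of_def norm_eq_1[symmetric])

lemma measurable_P [measurable]: "P \<in> sets borel"
  using polyP by (simp add: borel_closed polyhedron_imp_closed)

lemma measurable_voronoi [measurable]: "voronoi v \<in> sets borel"
proof -
  have "voronoi v = P \<inter> (\<Inter>w\<in>vertices P - {v}. {x. (1 - x \<bullet> v) * s w < (1 - x \<bullet> w) * s v})"
    by (auto simp: voronoi_def)
  moreover have "open (\<Inter>w\<in>vertices P - {v}. {x. (1 - x \<bullet> v) * s w < (1 - x \<bullet> w) * s v})"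
    using finite_vertices by (intro open_INT ballI open_Collect_less continuous_intros) auto
  ultimately show ?thesis by (simp add: borel_open)
qed

lemma voronoi_disjoint:
  assumes "v \<in> vertices P" "w \<in> vertices P" "v \<noteq> w"
  shows "voronoi v \<inter> voronoi w = {}"
proof (rule ccontr)
  assume "voronoi v \<inter> voronoi w \<noteq> {}"
  then obtain x where "x \<in> voronoi v" "x \<in> voronoi w" by blast
  hence "(1 - x \<bullet> v) * s w < (1 - x \<bullet> w) * s v" "(1 - x \<bullet> w) * s v < (1 - x \<bullet> v) * s w"
    using assms unfolding voronoi_def by blast+
  thus False by simp
qed

end

section \<open>The half-space picture at one ideal vertex\<close>

lemma norm_diff_scaled:
  fixes p q :: "'a::real_inner"
  shows "(norm (\<alpha> *\<^sub>R p - \<beta> *\<^sub>R q))\<^sup>2 = \<alpha>\<^sup>2 * (p \<bullet> p) - 2 * \<alpha> * \<beta> * (p \<bullet> q) + \<beta>\<^sup>2 * (q \<bullet> q)"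
  unfolding power2_norm_eq_inner
  by (simp add: inner_diff_left inner_diff_right inner_commute power2_eq_square algebra_simps)

locale vertex_frame = cell_with_horoballs P N s + horospherical_frame v e1 e2
  for P N s v e1 e2 +
  assumes v: "v \<in> vertices P"
begin

text \<open>A quarter of the squared chord; the horoballs at \<open>v\<close> and \<open>w\<close>
  touch when \<open>s v * s w\<close> equals it.\<close>

definition half_chord :: "point \<Rightarrow> real" where
  "half_chord w = (1 - v \<bullet> w) / 2"

text \<open>The level of the foot on the facet plane: the horoball at \<open>v\<close> touches the
  plane when \<open>s v\<close> equals it.\<close>

definition gap :: "point \<times> real \<Rightarrow> real" where
  "gap n = snd n - fst n \<bullet> v"

text \<open>
  Seen from \<open>v\<close>, the other vertices with their horoballs and the facets not through \<open>v\<close> bound the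
  Voronoi region from below; both kinds of boundary are hemispheres
  \<open>\<eta> = weight i - |y - centre i|\<^sup>2\<close>, \<open>\<eta>\<close> being the square of the height.
\<close>

definition centre :: "point + point \<times> real \<Rightarrow> real \<times> real" where
  "centre i = (case i of Inl w \<Rightarrow> (s v / (2 * half_chord w)) *\<^sub>R proj w
     | Inr n \<Rightarrow> (s v / gap n) *\<^sub>R proj (fst n))"

text \<open>For a vertex this is the Euclidean diameter of its horoball, which equals the squared
  radius of the bisecting hemisphere; for a facet it is the squared radius of the facet's own
  hemisphere.\<close>

definition weight :: "point + point \<times> real \<Rightarrow> real" where
  "weight i = (case i of Inl w \<Rightarrow> s v * s w / half_chord w | Inr n \<Rightarrow> (s v / gap n)\<^sup>2)"

definition floor_set :: "(point + point \<times> real) set" where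
  "floor_set = Inl ` (vertices P - {v}) \<union> Inr ` {n \<in> N. fst n \<bullet> v \<noteq> snd n}"

definition walls :: "(point \<times> real) set" where
  "walls = {n \<in> N. fst n \<bullet> v = snd n}"

lemma sv: "0 < s v"
  using s_pos[OF v] .

lemma half_chord:
  assumes "w \<in> vertices P" "w \<noteq> v"
  shows "0 < half_chord w" "v \<bullet> w = 1 - 2 * half_chord w" "w \<bullet> v = 1 - 2 * half_chord w" "s v * s w \<le> half_chord w"
proof -
  have "0 < (v - w) \<bullet> (v - w)" using assms by simp
  thus "0 < half_chord w" using vertexD(3)[OF v] vertexD(3)[OF assms(1)]
    by (simp add: inner_diff_left inner_diff_right half_chord_def inner_commute)
  show "v \<bullet> w = 1 - 2 * half_chord w" "w \<bullet> v = 1 - 2 * half_chord w"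
    by (simp_all add: half_chord_def inner_commute[of w v] field_simps)
  show "s v * s w \<le> half_chord w" using s_pair[OF v assms(1)] assms by (simp add: half_chord_def)
qed

lemma gap:
  assumes "n \<in> N" "fst n \<bullet> v \<noteq> snd n"
  shows "0 < gap n" "fst n \<bullet> v = snd n - gap n" "s v \<le> gap n"
proof -
  have "fst n \<bullet> v < snd n" using le[OF assms(1) vertexD(1)[OF v]] assms by simp
  thus "0 < gap n" "s v \<le> gap n" using s_side[OF v assms(1)] by (auto simp: gap_def)
  show "fst n \<bullet> v = snd n - gap n" by (simp add: gap_def)
qed

lemma proj_normal: "n \<in> N \<Longrightarrow> proj (fst n) \<bullet> proj (fst n) = 1 + (snd n)\<^sup>2 - (fst n \<bullet> v)\<^sup>2"
  using unit[of n] by (simp add: inner_proj mink_def power2_eq_square)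

lemma proj_vertex:
  assumes "w \<in> vertices P" "w \<noteq> v"
  shows "proj w \<bullet> proj w = 4 * half_chord w * (1 - half_chord w)"
  unfolding inner_proj vertexD(3)[OF assms(1)] half_chord(3)[OF assms] by (simp add: algebra_simps)

text \<open>The squared distance of the centres computes to
  \<open>(s v)\<^sup>2 * l / (k * k')\<close>, so the claim is the disjointness of the horoballs at
  \<open>w\<close> and \<open>w'\<close>.\<close>

lemma sep_vertices:
  assumes w: "w \<in> vertices P" "w \<noteq> v" and w': "w' \<in> vertices P" "w' \<noteq> v" and ne: "w \<noteq> w'"
  shows "weight (Inl w) * weight (Inl w') \<le> (norm (centre (Inl w) - centre (Inl w')))\<^sup>2"
proof -
  define k k' l where "k = half_chord w" and "k' = half_chord w'" and "l = (1 - w \<bullet> w') / 2"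
  have k: "0 < k" "0 < k'" using half_chord(1) w w' by (auto simp: k_def k'_def)
  have pp: "proj w \<bullet> proj w' = (1 - 2 * l) - (1 - 2 * k) * (1 - 2 * k')"
  proof -
    have "w \<bullet> w' = 1 - 2 * l" by (simp add: l_def field_simps)
    thus ?thesis unfolding inner_proj half_chord(3)[OF w] half_chord(3)[OF w'] k_def k'_def by simp
  qed
  have "(norm (centre (Inl w) - centre (Inl w')))\<^sup>2 = (s v / (2 * k))\<^sup>2 * (4 * k * (1 - k))
      - 2 * (s v / (2 * k)) * (s v / (2 * k')) * ((1 - 2 * l) - (1 - 2 * k) * (1 - 2 * k')) + (s v / (2 * k'))\<^sup>2 * (4 * k' * (1 - k'))"
    by (simp add: centre_def norm_diff_scaled pp proj_vertex[OF w] proj_vertex[OF w'] flip: k_def k'_def)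
  also have "\<dots> = (s v)\<^sup>2 * l / (k * k')" using k by (simp add: field_simps power2_eq_square)
  also have "\<dots> \<ge> (s v)\<^sup>2 * (s w * s w') / (k * k')"
    using s_pair[OF w(1) w'(1) ne] k by (intro divide_right_mono mult_left_mono) (auto simp: l_def)
  also have "(s v)\<^sup>2 * (s w * s w') / (k * k') = weight (Inl w) * weight (Inl w')"
    by (simp add: weight_def k_def k'_def power2_eq_square)
  finally show ?thesis .
qed

lemma weight_bounds:
  assumes "i \<in> floor_set"
  shows "0 < weight i" "weight i \<le> 1"
proof -
  have "0 < weight i \<and> weight i \<le> 1"
  proof (cases i)
    case (Inl w)
    hence w: "w \<in> vertices P" "w \<noteq> v" using assms by (auto simp: floor_set_def)
    thus ?thesis using half_chord[OF w] sv s_pos[OF w(1)] Inl by (simp add: weight_def)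
  next
    case (Inr n)
    hence n: "n \<in> N" "fst n \<bullet> v \<noteq> snd n" using assms by (auto simp: floor_set_def)
    thus ?thesis using gap[OF n] sv Inr by (auto simp: weight_def power_le_one)
  qed
  thus "0 < weight i" "weight i \<le> 1" by auto
qed

text \<open>The vertex is on the inner side of the facet, so it does not lie inside the circle under
  the hemisphere: the squared distance is at least the facet's weight, and the vertex weight is at
  most 1.\<close>

lemma sep_vertex_facet:
  assumes w: "w \<in> vertices P" "w \<noteq> v" and n: "n \<in> N" "fst n \<bullet> v \<noteq> snd n"
  shows "weight (Inl w) * weight (Inr n) \<le> (norm (centre (Inl w) - centre (Inr n)))\<^sup>2"
proof -
  define k g b z where "k = half_chord w" and "g = gap n" and "b = snd n" and "z = fst n \<bullet> w"
  have k: "0 < k" "0 < g" using half_chord(1)[OF w] gap(1)[OF n] by (auto simp: k_def g_def)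
  have pp: "proj w \<bullet> proj (fst n) = z - (1 - 2 * k) * (b - g)"
    using half_chord(3)[OF w] gap(2)[OF n] by (simp add: inner_proj k_def g_def b_def z_def inner_commute)
  have qq: "proj (fst n) \<bullet> proj (fst n) = 1 + b\<^sup>2 - (b - g)\<^sup>2"
    using proj_normal[OF n(1)] gap(2)[OF n] by (simp add: b_def g_def)
  have zb: "z \<le> b" using le[OF n(1) vertexD(1)[OF w(1)]] by (simp add: z_def b_def)
  have "weight (Inl w) * weight (Inr n) \<le> 1 * weight (Inr n)"
    using weight_bounds[of "Inl w"] weight_bounds[of "Inr n"] w n
    by (intro mult_right_mono) (auto simp: floor_set_def)
  also have "\<dots> \<le> (s v / g)\<^sup>2 + (s v)\<^sup>2 * (b - z) / (k * g)"
    using zb k by (simp add: weight_def g_def)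
  also have "\<dots> = (s v / (2 * k))\<^sup>2 * (4 * k * (1 - k)) - 2 * (s v / (2 * k)) * (s v / g) * (z - (1 - 2 * k) * (b - g))
      + (s v / g)\<^sup>2 * (1 + b\<^sup>2 - (b - g)\<^sup>2)"
    using k by (simp add: field_simps power2_eq_square)
  also have "\<dots> = (norm (centre (Inl w) - centre (Inr n)))\<^sup>2"
    by (simp add: centre_def norm_diff_scaled pp qq proj_vertex[OF w] flip: k_def g_def)
  finally show ?thesis .
qed

text \<open>As \<open>mink n m\<close> is not positive, the squared distance of the centres is at
  least the sum of the squared radii, hence at least their product, both being at most 1.\<close>

lemma sep_facets:
  assumes n: "n \<in> N" "fst n \<bullet> v \<noteq> snd n" and m: "m \<in> N" "fst m \<bullet> v \<noteq> snd m" and ne: "n \<noteq> m"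
  shows "weight (Inr n) * weight (Inr m) \<le> (norm (centre (Inr n) - centre (Inr m)))\<^sup>2"
proof -
  define g h b d where "g = gap n" and "h = gap m" and "b = snd n" and "d = snd m"
  have k: "0 < g" "0 < h" using gap(1)[OF n] gap(1)[OF m] by (auto simp: g_def h_def)
  define c where "c = mink n m"
  have c: "c \<le> 0" using mink_nonpos[OF n(1) m(1) ne] by (simp add: c_def)
  have pp: "proj (fst n) \<bullet> proj (fst m) = c + b * d - (b - g) * (d - h)"
    using gap(2)[OF n] gap(2)[OF m] by (simp add: inner_proj c_def mink_def g_def h_def b_def d_def)
  have qq: "proj (fst n) \<bullet> proj (fst n) = 1 + b\<^sup>2 - (b - g)\<^sup>2" "proj (fst m) \<bullet> proj (fst m) = 1 + d\<^sup>2 - (d - h)\<^sup>2"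
    using proj_normal[OF n(1)] proj_normal[OF m(1)] gap(2)[OF n] gap(2)[OF m] by (auto simp: b_def g_def d_def h_def)
  have "weight (Inr n) * weight (Inr m) \<le> 1 * weight (Inr m)"
    using weight_bounds[of "Inr m"] weight_bounds[of "Inr n"] m n
    by (intro mult_right_mono) (auto simp: floor_set_def)
  also have "\<dots> \<le> (s v / g)\<^sup>2 + (s v / h)\<^sup>2 + 2 * (s v)\<^sup>2 * (- c) / (g * h)"
  proof -
    have "0 \<le> 2 * (s v)\<^sup>2 * (- c) / (g * h)"
      using c k by (intro divide_nonneg_pos mult_nonneg_nonneg) auto
    moreover have "0 \<le> (s v / g)\<^sup>2" by simp
    moreover have wm: "weight (Inr m) = (s v / h)\<^sup>2" by (simp add: weight_def h_def)
    ultimately show ?thesis unfolding wm by linarith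
  qed
  also have "\<dots> = (s v / g)\<^sup>2 * (1 + b\<^sup>2 - (b - g)\<^sup>2) - 2 * (s v / g) * (s v / h) * (c + b * d - (b - g) * (d - h))
      + (s v / h)\<^sup>2 * (1 + d\<^sup>2 - (d - h)\<^sup>2)"
    using k by (simp add: field_simps power2_eq_square)
  also have "\<dots> = (norm (centre (Inr n) - centre (Inr m)))\<^sup>2"
    by (simp add: centre_def norm_diff_scaled pp qq flip: g_def h_def)
  finally show ?thesis .
qed

text \<open>Facets through \<open>v\<close> become vertical walls over the sides of the polygon. The
  product of two projected wall normals is their \<open>mink\<close>, so the dihedral angles
  reappear as angles of the polygon.\<close>

sublocale poly: weighted_polygon floor_set centre weight walls "\<lambda>n. proj (fst n)" "\<lambda>n. s v * snd n"
proof
  show "finite floor_set" "finite walls"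
    using finite_vertices finN by (auto simp: floor_set_def walls_def)
next
  fix i assume "i \<in> floor_set"
  thus "0 < weight i \<and> weight i \<le> 1" using weight_bounds by auto
next
  fix i l assume "i \<in> floor_set" "l \<in> floor_set" "i \<noteq> l"
  note il = this
  show "weight i * weight l \<le> (norm (centre i - centre l))\<^sup>2"
  proof (cases i)
    case (Inl w)
    hence w: "w \<in> vertices P" "w \<noteq> v" using il by (auto simp: floor_set_def)
    show ?thesis
    proof (cases l)
      case (Inl w')
      thus ?thesis using sep_vertices[OF w, of w'] il \<open>i = Inl w\<close> by (auto simp: floor_set_def)
    next
      case (Inr n)
      thus ?thesis using sep_vertex_facet[OF w, of n] il \<open>i = Inl w\<close> by (auto simp: floor_set_def)
    qed
  next
    case (Inr n)
    hence n: "n \<in> N" "fst n \<bullet> v \<noteq> snd n" using il by (auto simp: floor_set_def)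
    show ?thesis
    proof (cases l)
      case (Inl w)
      hence "w \<in> vertices P" "w \<noteq> v" using il by (auto simp: floor_set_def)
      from sep_vertex_facet[OF this n] show ?thesis
        by (simp only: Inl \<open>i = Inr n\<close> mult.commute[of "weight (Inr n)"] norm_minus_commute[of "centre (Inr n)"])
    next
      case (Inr m)
      hence m: "m \<in> N" "fst m \<bullet> v \<noteq> snd m" "n \<noteq> m" using il \<open>i = Inr n\<close> by (auto simp: floor_set_def)
      from sep_facets[OF n m] show ?thesis by (simp only: Inr \<open>i = Inr n\<close>)
    qed
  qed
next
  fix i j assume i: "i \<in> floor_set" and j: "j \<in> walls"
  have jN: "j \<in> N" "fst j \<bullet> v = snd j" using j by (auto simp: walls_def)
  show "proj (fst j) \<bullet> centre i = s v * snd j \<or> proj (fst j) \<bullet> centre i \<le> s v * snd j - weight i / 2"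
  proof (cases i)
    case (Inl w)
    hence w: "w \<in> vertices P" "w \<noteq> v" using i by (auto simp: floor_set_def)
    define k where "k = half_chord w"
    have k: "0 < k" using half_chord(1)[OF w] by (simp add: k_def)
    have "proj (fst j) \<bullet> centre i = (s v / (2 * k)) * (fst j \<bullet> w - snd j * (1 - 2 * k))"
      using half_chord(3)[OF w] jN by (simp add: Inl centre_def inner_proj k_def)
    also have "\<dots> = s v * snd j - (s v / (2 * k)) * (snd j - fst j \<bullet> w)"
      using k by (simp add: field_simps)
    finally have e: "proj (fst j) \<bullet> centre i = s v * snd j - (s v / (2 * k)) * (snd j - fst j \<bullet> w)" .
    show ?thesis
    proof (cases "fst j \<bullet> w = snd j")
      case False
      hence "s w \<le> snd j - fst j \<bullet> w" using le[OF jN(1) vertexD(1)[OF w(1)]] s_side[OF w(1) jN(1)] by simp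
      hence "(s v / (2 * k)) * s w \<le> (s v / (2 * k)) * (snd j - fst j \<bullet> w)"
        using k sv by (intro mult_left_mono) auto
      moreover have "(s v / (2 * k)) * s w = weight i / 2" by (simp add: Inl weight_def k_def)
      ultimately show ?thesis unfolding e by simp
    qed (simp add: e)
  next
    case (Inr n)
    hence n: "n \<in> N" "fst n \<bullet> v \<noteq> snd n" using i by (auto simp: floor_set_def)
    define g where "g = gap n"
    have g: "0 < g" "s v \<le> g" using gap[OF n] by (auto simp: g_def)
    have "proj (fst j) \<bullet> centre i = (s v / g) * (mink j n + snd j * g)"
    proof -
      have "proj (fst j) \<bullet> proj (fst n) = mink j n + snd j * g"
        unfolding inner_proj gap(2)[OF n] jN(2) mink_def g_def by (simp add: algebra_simps)
      thus ?thesis by (simp add: Inr centre_def flip: g_def)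
    qed
    also have "\<dots> = s v * snd j + (s v / g) * mink j n" using g by (simp add: field_simps)
    finally have e: "proj (fst j) \<bullet> centre i = s v * snd j + (s v / g) * mink j n" .
    have "j \<noteq> n" using jN n by auto
    from mink_cases[OF jN(1) n(1) this] show ?thesis
    proof
      assume "mink j n \<le> - 1 / 2"
      hence "(s v / g) * mink j n \<le> (s v / g) * (- 1 / 2)" using g sv by (intro mult_left_mono) auto
      \<comment> \<open>The angle yields a distance of half the radius from the wall, while half the
        squared radius is asked for; the radius is at most 1.\<close>
      moreover have "(s v / g)\<^sup>2 \<le> s v / g"
      proof -
        have "q\<^sup>2 \<le> q" if "0 \<le> q" "q \<le> 1" for q :: real
          using that by (simp add: power2_eq_square mult_left_le)
        thus ?thesis using g sv by simp
      qed
      ultimately show ?thesis unfolding e by (simp add: Inr weight_def g_def)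
    qed (simp add: e)
  qed
next
  fix j assume j: "j \<in> walls"
  hence "proj (fst j) \<bullet> proj (fst j) = 1" using proj_normal[of j] by (auto simp: walls_def)
  thus "norm (proj (fst j)) = 1" by (simp add: norm_eq_1)
next
  fix j j' assume "j \<in> walls" "j' \<in> walls" "j \<noteq> j'"
  thus "proj (fst j) \<bullet> proj (fst j') = 0 \<or> proj (fst j) \<bullet> proj (fst j') \<le> - 1 / 2"
    using mink_cases[of j j'] by (auto simp: walls_def inner_proj mink_def)
qed

end

section \<open>Volumes along the lines from the vertex\<close>

context vertex_frame
begin

text \<open>The line indexed by \<open>y\<close> leaves the ball at \<open>t = 2 / slope y\<close>,
  and its point at \<open>t\<close> has squared height
  \<open>(s v)\<^sup>2 * (2 / t - slope y)\<close>. For \<open>t > 0\<close> the condition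
  \<open>t * (slope y + \<eta> / (s v)\<^sup>2) < 2\<close> thus says that the squared height
  exceeds \<open>\<eta>\<close>.\<close>

definition slope :: "real \<times> real \<Rightarrow> real" where
  "slope y = 1 + (norm y)\<^sup>2 / (s v)\<^sup>2"

lemma slope_ge_1: "1 \<le> slope y"
  by (simp add: slope_def)

lemma ray_in_horoball:
  assumes t: "0 < t" "t * slope y < 2" and B: "ray (s v) y t \<in> horoball v (s v)"
  shows "t \<le> 2 / (slope y + 1 / (s v)\<^sup>2)"
proof -
  define D where "D = t * (2 - t * slope y)"
  have D: "0 < D" using t by (simp add: D_def)
  have "1 - ray (s v) y t \<bullet> v = t" "1 - ray (s v) y t \<bullet> ray (s v) y t = D"
    using ray_self[of "s v" y t] sv by (simp_all add: inner_ray_v D_def slope_def)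
  hence "t / sqrt D \<le> s v" using B by (simp add: horoball_def)
  hence "t \<le> s v * sqrt D" using D by (simp add: field_simps)
  hence "t\<^sup>2 \<le> (s v * sqrt D)\<^sup>2" using t by (intro power_mono) auto
  also have "\<dots> = (s v)\<^sup>2 * D" using D by (simp add: power_mult_distrib)
  finally have "t * t \<le> t * ((s v)\<^sup>2 * (2 - t * slope y))" by (simp add: D_def power2_eq_square mult_ac)
  hence "t \<le> (s v)\<^sup>2 * (2 - t * slope y)" using t by simp
  hence "t * (slope y + 1 / (s v)\<^sup>2) \<le> 2" using sv by (simp add: field_simps)
  moreover have "0 < slope y + 1 / (s v)\<^sup>2" using slope_ge_1[of y] by (simp add: add_pos_nonneg)
  ultimately show ?thesis by (simp add: field_simps)
qed

lemma inner_ray_normal: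
  "fst n \<bullet> ray (s v) y t = (1 - t) * (fst n \<bullet> v) + (t / s v) * (y \<bullet> proj (fst n))"
  using inner_ray[of "s v" y t "fst n"] by (simp add: inner_commute[of v "fst n"] inner_commute[of "fst n" "ray (s v) y t"])

lemma ray_in_wall:
  assumes "0 < t" and n: "n \<in> walls"
  shows "fst n \<bullet> ray (s v) y t \<le> snd n \<longleftrightarrow> proj (fst n) \<bullet> y \<le> s v * snd n"
proof -
  have nv: "fst n \<bullet> v = snd n" using n by (simp add: walls_def)
  have "fst n \<bullet> ray (s v) y t \<le> snd n \<longleftrightarrow> (t / s v) * (y \<bullet> proj (fst n)) \<le> (t / s v) * (s v * snd n)"
    unfolding inner_ray_normal nv using sv by (simp add: algebra_simps)
  also have "\<dots> \<longleftrightarrow> y \<bullet> proj (fst n) \<le> s v * snd n" using assms(1) sv by (intro mult_le_cancel_left_pos) auto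
  finally show ?thesis by (simp add: inner_commute)
qed

lemma ray_below_facet:
  assumes t: "0 < t" "t * (slope y + \<eta> / (s v)\<^sup>2) < 2"
    and n: "n \<in> N" "fst n \<bullet> v \<noteq> snd n" and \<eta>: "weight (Inr n) - (norm (y - centre (Inr n)))\<^sup>2 \<le> \<eta>"
  shows "fst n \<bullet> ray (s v) y t \<le> snd n"
proof -
  define g b p r where "g = gap n" and "b = snd n" and "p = y \<bullet> proj (fst n)" and "r = s v"
  have g: "0 < g" "0 < r" using gap(1)[OF n] sv by (auto simp: g_def r_def)
  have nv: "fst n \<bullet> v = b - g" using gap(2)[OF n] by (simp add: g_def b_def)
  have qq: "proj (fst n) \<bullet> proj (fst n) = 1 + b\<^sup>2 - (b - g)\<^sup>2"
    using proj_normal[OF n(1)] nv by (simp add: b_def)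
  define Y where "Y = (norm y)\<^sup>2 + \<eta>"
  have "(norm (y - centre (Inr n)))\<^sup>2 = (norm y)\<^sup>2 - 2 * (r / g) * p + (r / g)\<^sup>2 * (1 + b\<^sup>2 - (b - g)\<^sup>2)"
    using norm_diff_scaled[of 1 y "r / g" "proj (fst n)"]
    by (simp add: centre_def qq p_def r_def g_def power2_norm_eq_inner)
  hence "(r / g)\<^sup>2 \<le> Y - 2 * (r / g) * p + (r / g)\<^sup>2 * (1 + b\<^sup>2 - (b - g)\<^sup>2)"
    using \<eta> by (simp add: weight_def Y_def r_def g_def)
  \<comment> \<open>This factor turns the quadratic inequality for the hemisphere into the linear
    one for the facet plane.\<close>
  hence "0 \<le> (g * t / (2 * r\<^sup>2)) * (Y - 2 * (r / g) * p + (r / g)\<^sup>2 * (2 * b * g - g\<^sup>2))"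
    using g t by (intro mult_nonneg_nonneg) (auto simp: power2_eq_square algebra_simps)
  also have "\<dots> = (g / 2) * (t * Y / r\<^sup>2) - (t / r) * p + t * b - t * g / 2"
    using g by (simp add: field_simps power2_eq_square)
  also have "t * Y / r\<^sup>2 = t * (slope y + \<eta> / (s v)\<^sup>2) - t"
    using g by (simp add: slope_def Y_def r_def field_simps)
  also have "(g / 2) * (t * (slope y + \<eta> / (s v)\<^sup>2) - t) \<le> (g / 2) * (2 - t)"
    using t g by (intro mult_left_mono) auto
  also have "(g / 2) * (2 - t) = g - t * g / 2" by (simp add: right_diff_distrib)
  finally have "(t / r) * p \<le> g - t * g + t * b" by linarith
  thus ?thesis unfolding inner_ray_normal nv
    by (simp add: p_def r_def b_def algebra_simps)
qed

lemma ray_below_vertex: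
  assumes t: "0 < t" "t * (slope y + \<eta> / (s v)\<^sup>2) < 2"
    and w: "w \<in> vertices P" "w \<noteq> v" and \<eta>: "weight (Inl w) - (norm (y - centre (Inl w)))\<^sup>2 \<le> \<eta>"
  shows "(1 - ray (s v) y t \<bullet> v) * s w < (1 - ray (s v) y t \<bullet> w) * s v"
proof -
  define k p r where "k = half_chord w" and "p = y \<bullet> proj w" and "r = s v"
  have k: "0 < k" "0 < r" using half_chord(1)[OF w] sv by (auto simp: k_def r_def)
  have vw: "v \<bullet> w = 1 - 2 * k" using half_chord(2)[OF w] by (simp add: k_def)
  define Y where "Y = (norm y)\<^sup>2 + \<eta>"
  have "(norm (y - centre (Inl w)))\<^sup>2 = (norm y)\<^sup>2 - 2 * (r / (2 * k)) * p + (r / (2 * k))\<^sup>2 * (4 * k * (1 - k))"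
    using norm_diff_scaled[of 1 y "r / (2 * k)" "proj w"] proj_vertex[OF w]
    by (simp add: centre_def p_def r_def k_def power2_norm_eq_inner)
  hence "r * s w / k \<le> Y - 2 * (r / (2 * k)) * p + (r / (2 * k))\<^sup>2 * (4 * k * (1 - k))"
    using \<eta> by (simp add: weight_def Y_def r_def k_def)
  hence "(k * t / r) * (r * s w / k) \<le> (k * t / r) * (Y - 2 * (r / (2 * k)) * p + (r / (2 * k))\<^sup>2 * (4 * k * (1 - k)))"
    using k t by (intro mult_left_mono) auto
  also have "(k * t / r) * (r * s w / k) = t * s w" using k by simp
  also have "(k * t / r) * (Y - 2 * (r / (2 * k)) * p + (r / (2 * k))\<^sup>2 * (4 * k * (1 - k)))
    = k * r * (t * Y / r\<^sup>2) - t * p + r * t * (1 - k)"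
    using k by (simp add: field_simps power2_eq_square)
  also have "t * Y / r\<^sup>2 = t * (slope y + \<eta> / (s v)\<^sup>2) - t"
    using k by (simp add: slope_def Y_def r_def field_simps)
  also have "k * r * (t * (slope y + \<eta> / (s v)\<^sup>2) - t) - t * p + r * t * (1 - k)
      < k * r * (2 - t) - t * p + r * t * (1 - k)"
    using t k by simp
  also have "\<dots> = (1 - ray (s v) y t \<bullet> w) * s v"
    using k by (simp add: inner_ray vw p_def[symmetric] r_def[symmetric] field_simps)
  finally show ?thesis by (simp add: inner_ray_v)
qed

text \<open>On the power cell of \<open>i\<close> its hemisphere is the highest, so a point above it
  clears all other vertices and facets at once.\<close>

lemma cell_ray_in_voronoi:
  assumes i: "i \<in> floor_set" and y: "y \<in> poly.cell i"
    and \<eta>: "weight i - (norm (y - centre i))\<^sup>2 \<le> \<eta>" and t: "0 < t" "t * (slope y + \<eta> / (s v)\<^sup>2) < 2"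
  shows "ray (s v) y t \<in> voronoi v"
proof -
  have \<eta>l: "weight l - (norm (y - centre l))\<^sup>2 \<le> \<eta>" if "l \<in> floor_set" for l
  proof (cases "l = i")
    case False
    hence "weight l - (norm (y - centre l))\<^sup>2 < weight i - (norm (y - centre i))\<^sup>2"
      using y that unfolding power_cell_def by blast
    thus ?thesis using \<eta> by simp
  qed (use \<eta> in simp)
  have "fst n \<bullet> ray (s v) y t \<le> snd n" if n: "n \<in> N" for n
  proof (cases "fst n \<bullet> v = snd n")
    case True
    hence nw: "n \<in> walls" using n by (simp add: walls_def)
    moreover have "proj (fst n) \<bullet> y < s v * snd n" using y nw unfolding power_cell_def poly.Q_def by blast
    ultimately show ?thesis using ray_in_wall[OF t(1)] by simp
  next
    case False
    thus ?thesis using n by (intro ray_below_facet[OF t] \<eta>l) (auto simp: floor_set_def)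
  qed
  hence "ray (s v) y t \<in> P" unfolding P_eq by blast
  moreover have "(1 - ray (s v) y t \<bullet> v) * s w < (1 - ray (s v) y t \<bullet> w) * s v" if "w \<in> vertices P - {v}" for w
    using that by (intro ray_below_vertex[OF t] \<eta>l) (auto simp: floor_set_def)
  ultimately show ?thesis by (simp add: voronoi_def)
qed

text \<open>The volume above height 1 is \<open>1 / 2\<close> per unit of area. Points of the cell
  only force \<open>y\<close> into the closed polygon, which differs from the open one by a null
  set.\<close>

lemma emeasure_horoball_le:
  "emeasure hyp_measure (horoball v (s v) \<inter> P) \<le> ennreal (1 / 2) * emeasure lborel poly.Q"
proof -
  define Qc where "Qc = {y. \<forall>n\<in>walls. proj (fst n) \<bullet> y \<le> s v * snd n}"
  have "Qc = (\<Inter>n\<in>walls. {y. proj (fst n) \<bullet> y \<le> s v * snd n})" by (auto simp: Qc_def)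
  moreover have "closed \<dots>" by (intro closed_INT ballI closed_Collect_le continuous_intros)
  ultimately have [measurable]: "Qc \<in> sets borel" by (simp add: borel_closed)
  have [measurable]: "poly.Q \<in> sets borel" by (intro borel_open poly.open_Q)
  have "emeasure hyp_measure (horoball v (s v) \<inter> P) =
    (\<integral>\<^sup>+y. (\<integral>\<^sup>+t. ennreal (1 / ((s v)\<^sup>2 * (2 - t * slope y)\<^sup>2)) *
       indicator {t. 0 < t \<and> t * slope y < 2 \<and> ray (s v) y t \<in> horoball v (s v) \<inter> P} t \<partial>lborel) \<partial>lborel)"
    unfolding slope_def by (intro emeasure_hyp_measure_ray sv) auto
  also have "\<dots> \<le> (\<integral>\<^sup>+y. ennreal (1 / 2) * indicator Qc y \<partial>lborel)"
  proof (intro nn_integral_mono)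
    fix y
    let ?A = "{t. 0 < t \<and> t * slope y < 2 \<and> ray (s v) y t \<in> horoball v (s v) \<inter> P}"
    let ?T = "2 / (slope y + 1 / (s v)\<^sup>2)"
    show "(\<integral>\<^sup>+t. ennreal (1 / ((s v)\<^sup>2 * (2 - t * slope y)\<^sup>2)) * indicator ?A t \<partial>lborel) \<le> ennreal (1 / 2) * indicator Qc y"
    proof (cases "y \<in> Qc")
      case True
      have "(\<integral>\<^sup>+t. ennreal (1 / ((s v)\<^sup>2 * (2 - t * slope y)\<^sup>2)) * indicator ?A t \<partial>lborel)
        \<le> (\<integral>\<^sup>+t. ennreal (1 / ((s v)\<^sup>2 * (2 - t * slope y)\<^sup>2)) * indicator {0..?T} t \<partial>lborel)"
        using ray_in_horoball[of _ y] by (intro nn_integral_mono mult_left_mono) (auto simp: indicator_def)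
      also have "\<dots> = ennreal (1 / (2 * 1))" by (intro nn_integral_cone_segment slope_ge_1 sv) simp
      finally show ?thesis using True by simp
    next
      case False
      have "?A = {}"
      proof (rule ccontr)
        assume "?A \<noteq> {}"
        then obtain t where t: "0 < t" "ray (s v) y t \<in> P" by blast
        have "proj (fst n) \<bullet> y \<le> s v * snd n" if n: "n \<in> walls" for n
        proof -
          have "n \<in> N" using n by (simp add: walls_def)
          from le[OF this t(2)] show ?thesis by (rule iffD1[OF ray_in_wall[OF t(1) n]])
        qed
        thus False using False unfolding Qc_def by blast
      qed
      thus ?thesis by simp
    qed
  qed
  also have "\<dots> = ennreal (1 / 2) * emeasure lborel Qc" by (simp add: nn_integral_cmult_indicator)
  also have "emeasure lborel Qc \<le> emeasure lborel poly.Q"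
  proof -
    let ?N = "\<Union>n\<in>walls. {y. proj (fst n) \<bullet> y = s v * snd n}"
    have "?N \<in> null_sets lborel"
    proof (intro null_sets.finite_UN poly.finJ hyperplane_null)
      fix n assume "n \<in> walls"
      from poly.norm_n[OF this] show "proj (fst n) \<noteq> 0" by auto
    qed
    hence N: "emeasure lborel ?N = 0" "?N \<in> sets lborel" by auto
    have "Qc \<subseteq> poly.Q \<union> ?N"
    proof
      fix y assume "y \<in> Qc"
      thus "y \<in> poly.Q \<union> ?N" unfolding Qc_def poly.Q_def by (auto simp only: mem_Collect_eq Un_iff UN_iff not_less order.order_iff_strict)
    qed
    hence "emeasure lborel Qc \<le> emeasure lborel (poly.Q \<union> ?N)" using N by (intro emeasure_mono) auto
    also have "\<dots> \<le> emeasure lborel poly.Q + emeasure lborel ?N" using N by (intro emeasure_subadditive) auto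
    finally show ?thesis using N by simp
  qed
  finally show ?thesis by (simp add: mult_left_mono)
qed

text \<open>Over the power cell of \<open>i\<close> the region contains everything above the squared
  height truncated at \<open>2 / 3\<close>, which is the volume that \<open>height_weight\<close>
  counts. Lines over ties contribute nothing to the left side.\<close>

lemma emeasure_voronoi_ge:
  "ennreal (1 / 2) * (\<integral>\<^sup>+y. (\<Sum>i\<in>floor_set. height_weight (weight i) (y - centre i) * indicator (poly.cell i) y) \<partial>lborel)
    \<le> emeasure hyp_measure (voronoi v)"
proof -
  let ?H = "\<lambda>y. \<Sum>i\<in>floor_set. height_weight (weight i) (y - centre i) * indicator (poly.cell i) y"
  let ?K = "\<lambda>y t. ennreal (1 / ((s v)\<^sup>2 * (2 - t * slope y)\<^sup>2))"
  let ?A = "\<lambda>y. {t. 0 < t \<and> t * slope y < 2 \<and> ray (s v) y t \<in> voronoi v}"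
  have "ennreal (1 / 2) * (\<integral>\<^sup>+y. ?H y \<partial>lborel)
    = (\<integral>\<^sup>+y. ennreal (1 / 2) * ?H y \<partial>lborel)"
    by (intro nn_integral_cmult[symmetric]) auto
  also have "\<dots> \<le> (\<integral>\<^sup>+y. (\<integral>\<^sup>+t. ?K y t * indicator (?A y) t \<partial>lborel) \<partial>lborel)"
  proof (intro nn_integral_mono)
    fix y
    show "ennreal (1 / 2) * ?H y
      \<le> (\<integral>\<^sup>+t. ?K y t * indicator (?A y) t \<partial>lborel)"
    proof (cases "\<exists>i\<in>floor_set. y \<in> poly.cell i")
      case True
      then obtain i where i: "i \<in> floor_set" "y \<in> poly.cell i" by blast
      define \<eta> where "\<eta> = max (weight i - (norm (y - centre i))\<^sup>2) (2 / 3)"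
      have \<eta>: "0 < \<eta>" "weight i - (norm (y - centre i))\<^sup>2 \<le> \<eta>" by (auto simp: \<eta>_def)
      let ?T = "2 / (slope y + \<eta> / (s v)\<^sup>2)"
      have pos: "0 < slope y + \<eta> / (s v)\<^sup>2" using slope_ge_1[of y] \<eta> by (simp add: add_pos_nonneg)
      have "(\<Sum>l\<in>floor_set - {i}. height_weight (weight l) (y - centre l) * indicator (poly.cell l) y) = 0"
        using power_cell_disjoint[OF i(1) _ _ i(2)] by (intro sum.neutral) (auto simp: indicator_def)
      hence "?H y = ennreal (1 / \<eta>)"
        using i by (subst sum.remove[OF poly.finI i(1)]) (simp add: height_weight_def \<eta>_def)
      hence "ennreal (1 / 2) * ?H y
        = ennreal (1 / 2) * ennreal (1 / \<eta>)" by simp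
      also have "\<dots> = ennreal (1 / 2 * (1 / \<eta>))" using \<eta> by (intro ennreal_mult[symmetric]) auto
      also have "1 / 2 * (1 / \<eta>) = 1 / (2 * \<eta>)" by simp
      also have "ennreal (1 / (2 * \<eta>)) = (\<integral>\<^sup>+t. ?K y t * indicator {0..?T} t \<partial>lborel)"
        by (intro nn_integral_cone_segment[symmetric] slope_ge_1 sv \<eta>)
      also have "\<dots> = (\<integral>\<^sup>+t. ?K y t * indicator {0<..<?T} t \<partial>lborel)" by (rule nn_integral_Icc_Ioo)
      also have "\<dots> \<le> (\<integral>\<^sup>+t. ?K y t * indicator (?A y) t \<partial>lborel)"
      proof (intro nn_integral_mono mult_left_mono)
        fix t
        show "indicator {0<..<?T} t \<le> (indicator (?A y) t :: ennreal)"
        proof (cases "t \<in> {0<..<?T}")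
          case True
          hence t: "0 < t" "t * (slope y + \<eta> / (s v)\<^sup>2) < 2" using pos by (auto simp: field_simps)
          have "t * slope y \<le> t * (slope y + \<eta> / (s v)\<^sup>2)" using t \<eta> by (intro mult_left_mono) auto
          hence "t * slope y < 2" using t by linarith
          hence "t \<in> ?A y" using t cell_ray_in_voronoi[OF i \<eta>(2) t] by simp
          thus ?thesis by (auto simp: indicator_def)
        qed simp
      qed simp
      finally show ?thesis .
    next
      case False
      hence "?H y = 0"
        by (intro sum.neutral) (auto simp: indicator_def)
      thus ?thesis by simp
    qed
  qed
  also have "\<dots> = emeasure hyp_measure (voronoi v)"
    unfolding slope_def by (intro emeasure_hyp_measure_ray[symmetric] sv) auto
  finally show ?thesis .
qed

lemma floor_set_nonempty: "floor_set \<noteq> {}"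
proof
  assume "floor_set = {}"
  hence "vertices P \<subseteq> {v}" by (auto simp: floor_set_def)
  moreover have "P = convex hull (vertices P)"
    unfolding vertices_def using polytopeP by (intro Krein_Milman_Minkowski polytope_imp_compact polytope_imp_convex)
  ultimately have "P \<subseteq> {v}" by (metis convex_hull_singleton hull_mono)
  hence "interior P \<subseteq> interior {v}" by (rule interior_mono)
  thus False using intP by simp
qed

lemma horoball_density_in_voronoi:
  "ennreal s0_series * emeasure hyp_measure (horoball v (s v) \<inter> P) \<le> emeasure hyp_measure (voronoi v)"
proof -
  have "ennreal s0_series * emeasure hyp_measure (horoball v (s v) \<inter> P)
    \<le> ennreal s0_series * (ennreal (1 / 2) * emeasure lborel poly.Q)"
    by (intro mult_left_mono emeasure_horoball_le) simp
  also have "\<dots> = ennreal (1 / 2) * (ennreal s0_series * emeasure lborel poly.Q)" by (simp only: mult.left_commute)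
  also have "\<dots> \<le> ennreal (1 / 2) * (\<integral>\<^sup>+y. (\<Sum>i\<in>floor_set. height_weight (weight i) (y - centre i) * indicator (poly.cell i) y) \<partial>lborel)"
    by (intro mult_left_mono poly.heavy_polygon floor_set_nonempty) simp
  also have "\<dots> \<le> emeasure hyp_measure (voronoi v)" by (rule emeasure_voronoi_ge)
  finally show ?thesis .
qed

end

section \<open>Summation over the vertices of the cell\<close>

lemma (in cell_with_horoballs) total_horoball_volume:
  "ennreal s0_series * (\<Sum>v\<in>vertices P. emeasure hyp_measure (horoball v (s v) \<inter> P)) \<le> emeasure hyp_measure P"
proof -
  have sets_hyp: "sets hyp_measure = sets borel" by (simp add: hyp_measure_def)
  have each: "ennreal s0_series * emeasure hyp_measure (horoball v (s v) \<inter> P) \<le> emeasure hyp_measure (voronoi v)"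
    if v: "v \<in> vertices P" for v
  proof -
    obtain e1 e2 where "horospherical_frame v e1 e2" using horospherical_frame_exists vertexD(2)[OF v] by blast
    then interpret horospherical_frame v e1 e2 .
    interpret vertex_frame P N s v e1 e2 by unfold_locales (rule v)
    show ?thesis by (rule horoball_density_in_voronoi)
  qed
  have "ennreal s0_series * (\<Sum>v\<in>vertices P. emeasure hyp_measure (horoball v (s v) \<inter> P))
    \<le> (\<Sum>v\<in>vertices P. emeasure hyp_measure (voronoi v))"
    unfolding sum_distrib_left by (intro sum_mono each)
  also have "\<dots> = emeasure hyp_measure (\<Union>v\<in>vertices P. voronoi v)"
    using voronoi_disjoint finite_vertices
    by (intro sum_emeasure) (auto simp: sets_hyp disjoint_family_on_def)
  also have "\<dots> \<le> emeasure hyp_measure P"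
    by (intro emeasure_mono) (auto simp: sets_hyp voronoi_def)
  finally show ?thesis .
qed

theorem mainTheorem1:
  fixes p q r :: nat
    and T :: "point set set"
    and P :: "point set"
    and B :: "point \<Rightarrow> point set"
  assumes "(p, q, r) \<in> {(3, 3, 6), (3, 4, 4), (4, 3, 6), (5, 3, 6)}"
    and "fully_asymptotic_tiling p q r T"
    and "P \<in> T"
    and "admissible_arrangement P B"
  shows "packing_density P B \<le> s0"
proof -
  have cell: "regular_cell p q r P" and ideal: "vertices P \<subseteq> sphere 0 1"
    using assms(2,3) by (auto simp: fully_asymptotic_tiling_def regular_tiling_def)
  obtain N where "acute_cell P N" using regular_cell_acute[OF cell _ ideal] assms(1) by auto
  then interpret acute_cell P N .
  have "\<exists>c. \<forall>v\<in>vertices P. 0 < c v \<and> B v = horoball v (c v)"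
    using assms(4) unfolding admissible_arrangement_def is_horoball_at_def by (intro bchoice) blast
  then obtain s where s: "\<And>v. v \<in> vertices P \<Longrightarrow> 0 < s v" "\<And>v. v \<in> vertices P \<Longrightarrow> B v = horoball v (s v)"
    by blast
  have vP: "norm v = 1" "v \<in> P" if "v \<in> vertices P" for v
    using that ideal by (auto simp: vertices_def extreme_point_of_def)
  interpret cell_with_horoballs P N s
  proof
    fix v w assume vw: "v \<in> vertices P" "w \<in> vertices P" "v \<noteq> w"
    hence "interior (B v) \<inter> interior (B w) = {}"
      using assms(4) by (auto simp: admissible_arrangement_def pairwise_def)
    thus "s v * s w \<le> (1 - v \<bullet> w) / 2"
      using vw s vP by (intro disjoint_horoballs) auto
  next
    fix v n assume v: "v \<in> vertices P" and n: "n \<in> N" "fst n \<bullet> v < snd n"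
    have "v \<notin> side P n" using n by (simp add: side_def)
    hence "interior (B v) \<inter> side P n = {}"
      using assms(4) v facet[OF n(1)] by (auto simp: admissible_arrangement_def)
    thus "s v \<le> snd n - fst n \<bullet> v"
      using v n s vP by (intro horoball_below_side) auto
  qed (use s in auto)
  have s0: "s0 = inverse s0_series" "0 < s0"
    using s0_series_bounds by (auto simp: s0_def s0_series_def)
  show ?thesis
  \<comment> \<open>For infinite volume \<open>hyp_vol P\<close> is 0 by default, and division by
    zero makes the density 0. The split takes the place of a proof that the volume is finite and
    positive.\<close>
  proof (cases "emeasure hyp_measure P < \<infinity> \<and> 0 < hyp_vol P")
    case True
    have sets_hyp: "sets hyp_measure = sets borel" by (simp add: hyp_measure_def)
    have fin: "emeasure hyp_measure (horoball v (s v) \<inter> P) = ennreal (hyp_vol (horoball v (s v) \<inter> P))" for v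
    proof (rule emeasure_eq_ennreal_measure)
      have "emeasure hyp_measure (horoball v (s v) \<inter> P) \<le> emeasure hyp_measure P"
        by (intro emeasure_mono) (auto simp: sets_hyp)
      thus "emeasure hyp_measure (horoball v (s v) \<inter> P) \<noteq> top" using True by (auto simp: top_unique)
    qed
    have finP: "emeasure hyp_measure P = ennreal (hyp_vol P)"
      using True by (intro emeasure_eq_ennreal_measure) auto
    have "ennreal (s0_series * (\<Sum>v\<in>vertices P. hyp_vol (horoball v (s v) \<inter> P)))
      = ennreal s0_series * (\<Sum>v\<in>vertices P. emeasure hyp_measure (horoball v (s v) \<inter> P))"
      unfolding fin using s0_series_bounds by (simp add: ennreal_mult sum_nonneg)
    also have "\<dots> \<le> ennreal (hyp_vol P)" using total_horoball_volume finP by simp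
    finally have "s0_series * (\<Sum>v\<in>vertices P. hyp_vol (horoball v (s v) \<inter> P)) \<le> hyp_vol P"
      by (subst (asm) ennreal_le_iff) auto
    moreover have "(\<Sum>v\<in>vertices P. hyp_vol (horoball v (s v) \<inter> P)) = (\<Sum>v\<in>vertices P. hyp_vol (B v \<inter> P))"
      using s by (intro sum.cong) auto
    ultimately show ?thesis using True s0_series_bounds
      by (simp add: packing_density_def s0 field_simps)
  next
    case False
    hence "hyp_vol P = 0" by (auto simp: measure_def less_top[symmetric] zero_less_measure_iff[symmetric] less_le)
    thus ?thesis using s0 by (simp add: packing_density_def)
  qed
qed

end
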